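(* Let $\nu>0$ and let $n,m\to+\infty$ in such a way that $m/n\to\nu$. Let $F$ be a balanced and $2$-connected graph with $v_F\ge 3$ vertices and $e_F$ edges. Let $a>0$ and $0<\alpha<2$. Assume that $\mathbb{E}X<\infty$ and that $$\mathbb{P}\{N_F^*>t\}=(a+o(1))\,t^{-\alpha}\qquad\text{as } t\to+\infty .$$ Assume, in addition, that $$\mathbb{E}\left(X^{1+s\left(1-\frac{1}{\alpha e_F}\right)}Q^{s}\right)<\infty\qquad\text{for each } s=1,\dots,v_F-1.$$ Let $\mathcal{N}_F$ be the number of copies of $F$ in $G_{[n,m]}$. Then $(\mathcal{N}_F-B_m)/m^{1/\alpha}$ converges in distribution to $G_{\alpha,a}$, where the centering sequence $B_m$ and the $\alpha$-stable distribution $G_{\alpha,a}$ are those defined in the context.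
   Context: All graphs are finite and simple. A graph $F$ is $2$-connected if it is connected and stays connected after removal of any one of its vertices. $v_H$ and $e_H$ denote the numbers of vertices and edges of a graph $H$. $F$ is balanced if $e_F/v_F=\max\{e_H/v_H:\ H\subset F,\ e_H\ge 1\}$, the maximum being over subgraphs $H$ of $F$. A copy of $F$ in a graph $G$ is a (not necessarily induced) subgraph of $G$ isomorphic to $F$. $a_F$ is the number of distinct copies of $F$ in the complete graph on $v_F$ vertices. Model. $(X,Q)$ is a random vector with values in $\{0,1,2,\dots\}\times[0,1]$ (no independence between $X$ and $Q$ is assumed); its distribution does not depend on $n,m$. For an integer $x\ge 1$ and $p\in[0,1]$, $G(x,p)$ is the Bernoulli random graph on $\{1,\dots,x\}$ in which each pair of vertices is adjacent independently with probability $p$; $G(0,p)$ is the empty graph. $G(X,Q)$ is the corresponding mixture, $N_F$ is the number of copies of $F$ in $G(X,Q)$, and $$N_F^*=\mathbb{E}(N_F\mid X,Q)=a_F\binom{X}{v_F}Q^{e_F}.$$ The random graph $G_{[n,m]}$: let $(X_1,Q_1),\dots,(X_m,Q_m)$ be independent copies of $(X,Q)$ and put $\tilde X_i=\min\{X_i,n\}$. Given these, let $\mathcal{V}_{n,1},\dots,\mathcal{V}_{n,m}$ be independent random subsets of $[n]=\{1,\dots,n\}$, where $\mathcal{V}_{n,i}$ is uniformly distributed among the subsets of size $\tilde X_i$. Let $G_{n,1},\dots,G_{n,m}$ be independent random graphs, where $G_{n,i}$ has vertex set $\mathcal{V}_{n,i}$ and each pair of vertices in $\mathcal{V}_{n,i}$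 is adjacent in $G_{n,i}$ independently with probability $Q_i$. Let $\mathcal{E}_{n,i}$ be the edge set of $G_{n,i}$. Then $G_{[n,m]}$ is the graph with vertex set $[n]$ and edge set $\mathcal{E}_{n,1}\cup\dots\cup\mathcal{E}_{n,m}$. Centering and limit law. Let $N_{F,1}^*,\dots,N_{F,m}^*$ be i.i.d. copies of $N_F^*$ and $S_F^*=N_{F,1}^*+\dots+N_{F,m}^*$. Under the tail condition $\mathbb{P}\{N_F^*>t\}=(a+o(1))t^{-\alpha}$, $G_{\alpha,a}$ denotes the stable distribution, defined by $a$ and $\alpha$, to which the distribution of $m^{-1/\alpha}(S_F^*-B_m)$ converges (generalized central limit theorem of Gnedenko and Kolmogorov). Here $B_m=m\,\mathbb{E}N_F^*$ for $1<\alpha<2$ and $B_m\equiv0$ for $0<\alpha<1$; for $\alpha=1$, $B_m=c^{\star}_{\alpha,a}\ln m$, where the constant $c^{\star}_{\alpha,a}>0$ depends on $a$ and $\alpha$.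
   Formalization: For α=1, the stated B_m = c* ln m gives no limit law (S*_F/m tends to infinity); the formal claim allows B_m = c ln m or c m ln m with any c>0, and asserts convergence to every stable G to which (S*_F − B_m)/m converges, without asserting that such G exists. *)

theory Defs
  imports "HOL-Probability.Probability" "HOL-Library.Landau_Symbols"
begin

section \<open>Finite simple graphs and copies\<close>

text \<open>A graph is a pair of a vertex set and a set of edges, an edge being a two-element set.\<close>

type_synonym 'v graph = "'v set \<times> 'v set set"

abbreviation verts :: "'v graph \<Rightarrow> 'v set" where "verts \<equiv> fst"
abbreviation edges :: "'v graph \<Rightarrow> 'v set set" where "edges \<equiv> snd"

definition all_pairs :: "'v set \<Rightarrow> 'v set set" where
  "all_pairs V = {e. e \<subseteq> V \<and> card e = 2}"

definition simple_graph :: "'v graph \<Rightarrow> bool" where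
  "simple_graph G \<longleftrightarrow> finite (verts G) \<and> edges G \<subseteq> all_pairs (verts G)"

definition subgraph :: "'v graph \<Rightarrow> 'v graph \<Rightarrow> bool" where
  "subgraph H G \<longleftrightarrow> simple_graph H \<and> verts H \<subseteq> verts G \<and> edges H \<subseteq> edges G"

definition graph_iso :: "'v graph \<Rightarrow> 'w graph \<Rightarrow> bool" where
  "graph_iso G H \<longleftrightarrow>
     (\<exists>f. bij_betw f (verts G) (verts H) \<and> edges H = (\<lambda>e. f ` e) ` edges G)"

definition connected_graph :: "'v graph \<Rightarrow> bool" where
  "connected_graph G \<longleftrightarrow>
     (\<forall>u\<in>verts G. \<forall>v\<in>verts G. (u, v) \<in> {(x, y). {x, y} \<in> edges G}\<^sup>*)"

definition remove_vertex :: "'v graph \<Rightarrow> 'v \<Rightarrow> 'v graph" where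
  "remove_vertex G v = (verts G - {v}, {e \<in> edges G. v \<notin> e})"

definition two_connected :: "'v graph \<Rightarrow> bool" where
  "two_connected G \<longleftrightarrow>
     connected_graph G \<and> (\<forall>v\<in>verts G. connected_graph (remove_vertex G v))"

definition balanced :: "'v graph \<Rightarrow> bool" where
  "balanced F \<longleftrightarrow>
     real (card (edges F)) / real (card (verts F)) =
       Max {real (card (edges H)) / real (card (verts H)) | H.
              subgraph H F \<and> card (edges H) \<ge> 1}"

definition num_copies :: "'v graph \<Rightarrow> 'w graph \<Rightarrow> nat" where
  "num_copies F G = card {H. subgraph H G \<and> graph_iso F H}"

definition complete_graph :: "nat \<Rightarrow> nat graph" where
  "complete_graph x = ({1..x}, all_pairs {1..x})"

definition Nstar :: "'v graph \<Rightarrow> nat \<Rightarrow> real \<Rightarrow> real" where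
  "Nstar F x q =
     real (num_copies F (complete_graph (card (verts F)))) *
     real (x choose card (verts F)) * q ^ card (edges F)"

section \<open>The random graph\<close>

definition bernoulli_graph :: "'v set \<Rightarrow> real \<Rightarrow> 'v graph pmf" where
  "bernoulli_graph S q =
     map_pmf (\<lambda>f. (S, {e \<in> all_pairs S. f e}))
       (Pi_pmf (all_pairs S) False (\<lambda>_. bernoulli_pmf q))"

text \<open>The conditional law of one community, given that its size and density variables
  take the value \<open>(x, q)\<close>.\<close>

definition community :: "nat \<Rightarrow> nat \<times> real \<Rightarrow> nat graph pmf" where
  "community n = (\<lambda>(x, q).
     bind_pmf (pmf_of_set {S. S \<subseteq> {1..n} \<and> card S = min x n}) (\<lambda>S. bernoulli_graph S q))"

text \<open>The conditional law of the union of \<open>m\<close> communities on \<open>{1..n}\<close>, given that the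
  size and density variables are \<open>\<omega> 1, \<dots>, \<omega> m\<close>.\<close>

definition union_graph :: "nat \<Rightarrow> nat \<Rightarrow> (nat \<Rightarrow> nat \<times> real) \<Rightarrow> nat graph pmf" where
  "union_graph n m \<omega> =
     map_pmf (\<lambda>C. ({1..n}, \<Union>i\<in>{1..m}. edges (C i)))
       (Pi_pmf {1..m} ({}, {}) (\<lambda>i. community n (\<omega> i)))"

text \<open>The (unconditional) law of the random graph; \<open>D\<close> is the joint law of the size and
  density variables of a single community.\<close>

definition random_graph :: "(nat \<times> real) measure \<Rightarrow> nat \<Rightarrow> nat \<Rightarrow> nat graph measure" where
  "random_graph D n m = (\<Pi>\<^sub>M i\<in>{1..m}. D) \<bind> (\<lambda>\<omega>. measure_pmf (union_graph n m \<omega>))"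

text \<open>The kernel in the definition of \<open>random_graph\<close> is measurable, so the monadic bind is
  meaningful and \<open>random_graph\<close> is a probability measure.\<close>

lemma finite_pmf_measure_measurable:
  fixes P :: "'a \<Rightarrow> 'b pmf"
  assumes A: "finite A" "\<And>w. set_pmf (P w) \<subseteq> A"
    and P: "\<And>x. (\<lambda>w. pmf (P w) x) \<in> borel_measurable N"
  shows "(\<lambda>w. measure (measure_pmf (P w)) T) \<in> borel_measurable N"
proof -
  have "measure (measure_pmf (P w)) T = (\<Sum>x\<in>A \<inter> T. pmf (P w) x)" for w
  proof -
    have "measure (measure_pmf (P w)) T = measure (measure_pmf (P w)) (A \<inter> T)"
      using A(2)[of w] by (intro measure_prob_cong_0) (auto simp: set_pmf_iff)
    then show ?thesis using A(1) by (simp add: measure_measure_pmf_finite)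
  qed
  then show ?thesis using P by simp
qed

lemma finite_all_pairs: "finite S \<Longrightarrow> finite (all_pairs S)"
  unfolding all_pairs_def by simp

lemma pmf_Pi_measurable:
  assumes "finite I" and P: "\<And>i x. i \<in> I \<Longrightarrow> (\<lambda>w. pmf (p w i) x) \<in> borel_measurable N"
  shows "(\<lambda>w. pmf (Pi_pmf I d (p w)) f) \<in> borel_measurable N"
  using assms by (cases "\<forall>x. x \<notin> I \<longrightarrow> f x = d") (auto simp: pmf_Pi)

lemma pmf_bernoulli_measurable: "(\<lambda>q. pmf (bernoulli_pmf q) b) \<in> borel_measurable borel"
proof -
  have "pmf (bernoulli_pmf q) b = (if b then min 1 (max 0 q) else 1 - min 1 (max 0 q))" for q
    by (simp add: bernoulli_pmf.rep_eq)
  then show ?thesis by simp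
qed

lemma bernoulli_graph_measurable:
  assumes "finite S"
  shows "(\<lambda>q. pmf (bernoulli_graph S q) G) \<in> borel_measurable borel"
proof -
  have fin: "finite (all_pairs S)" using assms by (rule finite_all_pairs)
  show ?thesis
    unfolding bernoulli_graph_def pmf_map
  proof (rule finite_pmf_measure_measurable)
    show "finite (PiE_dflt (all_pairs S) False (\<lambda>_. UNIV :: bool set))"
      using fin by (intro finite_PiE_dflt) auto
    show "set_pmf (Pi_pmf (all_pairs S) False (\<lambda>_. bernoulli_pmf w)) \<subseteq>
            PiE_dflt (all_pairs S) False (\<lambda>_. UNIV)" for w
      using fin by (auto simp: set_Pi_pmf PiE_dflt_def)
  qed (intro pmf_Pi_measurable fin pmf_bernoulli_measurable)
qed

lemma set_bernoulli_graph: "finite S \<Longrightarrow> set_pmf (bernoulli_graph S q) \<subseteq> {S} \<times> Pow (all_pairs S)"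
  by (auto simp: bernoulli_graph_def)

lemma finite_nonempty_sizes:
  "finite {S. S \<subseteq> {1..n::nat} \<and> card S = min x n}"
  "{S. S \<subseteq> {1..n::nat} \<and> card S = min x n} \<noteq> {}"
proof -
  show "finite {S. S \<subseteq> {1..n::nat} \<and> card S = min x n}" by simp
  have "{1..min x n} \<in> {S. S \<subseteq> {1..n::nat} \<and> card S = min x n}" by auto
  then show "{S. S \<subseteq> {1..n::nat} \<and> card S = min x n} \<noteq> {}" by blast
qed

lemma community_measurable:
  "(\<lambda>w. pmf (community n w) G) \<in> borel_measurable (count_space UNIV \<Otimes>\<^sub>M borel)"
proof (rule measurable_pair_measure_countable1)
  fix x :: nat
  have "pmf (community n (x, q)) G =
        (\<Sum>S | S \<subseteq> {1..n} \<and> card S = min x n. pmf (bernoulli_graph S q) G)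
          / real (card {S. S \<subseteq> {1..n} \<and> card S = min x n})" for q
    using finite_nonempty_sizes[of n x] by (simp add: community_def pmf_bind integral_pmf_of_set)
  moreover have "(\<lambda>q. pmf (bernoulli_graph S q) G) \<in> borel_measurable borel"
    if "S \<subseteq> {1..n}" for S
    by (rule bernoulli_graph_measurable[OF finite_subset[OF that finite_atLeastAtMost]])
  ultimately show "(\<lambda>q. pmf (community n (x, q)) G) \<in> borel_measurable borel"
    by (simp add: borel_measurable_sum borel_measurable_divide)
qed simp

lemma set_community: "set_pmf (community n w) \<subseteq> Pow {1..n} \<times> Pow (all_pairs {1..n})"
proof (cases w)
  case (Pair x q)
  have "set_pmf (bernoulli_graph S q) \<subseteq> Pow {1..n} \<times> Pow (all_pairs {1..n})"
    if "S \<subseteq> {1..n}" for S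
    using set_bernoulli_graph[OF finite_subset[OF that finite_atLeastAtMost], of q] that
    by (force simp: all_pairs_def)
  then show ?thesis
    unfolding Pair community_def prod.case set_bind_pmf set_pmf_of_set[OF finite_nonempty_sizes(2,1)]
    by blast
qed

lemma union_graph_measurable:
  "(\<lambda>\<omega>. measure_pmf (union_graph n m \<omega>)) \<in>
     measurable (\<Pi>\<^sub>M i\<in>{1..m}. count_space UNIV \<Otimes>\<^sub>M borel) (subprob_algebra (count_space UNIV))"
proof (rule measurable_subprob_algebra)
  fix \<omega> show "subprob_space (measure_pmf (union_graph n m \<omega>))"
    by (simp add: prob_space_imp_subprob_space measure_pmf.prob_space_axioms)
next
  fix A :: "nat graph set"
  define R where "R = PiE_dflt {1..m} ({}, {}) (\<lambda>_. Pow {1..n} \<times> Pow (all_pairs {1..n}))"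
  have "(\<lambda>\<omega>. measure (measure_pmf (union_graph n m \<omega>)) A) \<in>
      borel_measurable (\<Pi>\<^sub>M i\<in>{1..m}. count_space UNIV \<Otimes>\<^sub>M borel)"
    unfolding union_graph_def measure_map_pmf
  proof (rule finite_pmf_measure_measurable)
    show "finite R" unfolding R_def
      by (intro finite_PiE_dflt finite_cartesian_product) (simp_all add: finite_all_pairs)
    show "set_pmf (Pi_pmf {1..m} ({}, {}) (\<lambda>i. community n (w i))) \<subseteq> R" for w
    proof
      fix f assume f: "f \<in> set_pmf (Pi_pmf {1..m} ({}, {}) (\<lambda>i. community n (w i)))"
      have "f i \<in> Pow {1..n} \<times> Pow (all_pairs {1..n})" if "i \<in> {1..m}" for i
      proof -
        have "f i \<in> set_pmf (community n (w i))"
          using f that unfolding set_Pi_pmf[OF finite_atLeastAtMost] PiE_dflt_def o_def by blast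
        then show ?thesis by (rule subsetD[OF set_community])
      qed
      moreover have "f i = ({}, {})" if "i \<notin> {1..m}" for i
        using f that unfolding set_Pi_pmf[OF finite_atLeastAtMost] PiE_dflt_def by blast
      ultimately show "f \<in> R" unfolding R_def PiE_dflt_def by blast
    qed
    have comp: "(\<lambda>w. pmf (community n (w i)) y)
        \<in> borel_measurable (\<Pi>\<^sub>M i\<in>{1..m}. count_space UNIV \<Otimes>\<^sub>M borel)"
      if "i \<in> {1..m}" for i y
      by (rule measurable_compose[OF measurable_component_singleton[OF that] community_measurable])
    show "(\<lambda>w. pmf (Pi_pmf {1..m} ({}, {}) (\<lambda>i. community n (w i))) x)
        \<in> borel_measurable (\<Pi>\<^sub>M i\<in>{1..m}. count_space UNIV \<Otimes>\<^sub>M borel)" for x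
      by (rule pmf_Pi_measurable[OF finite_atLeastAtMost comp])
  qed
  then show "(\<lambda>\<omega>. emeasure (measure_pmf (union_graph n m \<omega>)) A) \<in>
      borel_measurable (\<Pi>\<^sub>M i\<in>{1..m}. count_space UNIV \<Otimes>\<^sub>M borel)"
    by (simp add: measure_pmf.emeasure_eq_measure)
qed simp

lemma random_graph:
  assumes "prob_space D" and "sets D = sets (count_space UNIV \<Otimes>\<^sub>M borel)"
  shows "prob_space (random_graph D n m)" and "sets (random_graph D n m) = UNIV"
proof -
  interpret D: prob_space D by fact
  interpret P: prob_space "\<Pi>\<^sub>M i\<in>{1..m}. D"
    by (intro prob_space_PiM assms)
  have s: "sets (\<Pi>\<^sub>M i\<in>{1..m}. D) = sets (\<Pi>\<^sub>M i\<in>{1..m}. count_space UNIV \<Otimes>\<^sub>M borel)"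
    using assms(2) by (intro sets_PiM_cong) auto
  have k: "(\<lambda>\<omega>. measure_pmf (union_graph n m \<omega>)) \<in>
      measurable (\<Pi>\<^sub>M i\<in>{1..m}. D) (subprob_algebra (count_space UNIV))"
    using union_graph_measurable measurable_cong_sets[OF s refl] by blast
  show "prob_space (random_graph D n m)"
    unfolding random_graph_def
    by (rule P.prob_space_bind[OF _ k]) (simp add: measure_pmf.prob_space_axioms)
  show "sets (random_graph D n m) = UNIV"
    unfolding random_graph_def using sets_bind[OF sets_kernel[OF k] P.not_empty] by simp
qed

definition normalized_copies ::
  "'v graph \<Rightarrow> (nat \<times> real) measure \<Rightarrow> real \<Rightarrow> (nat \<Rightarrow> real) \<Rightarrow> nat \<Rightarrow> nat \<Rightarrow> real measure" where
  "normalized_copies F D \<alpha> B n m =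
     distr (random_graph D n m) borel
       (\<lambda>G. (real (num_copies F G) - B m) / real m powr (1 / \<alpha>))"

section \<open>Stable limits of sums of independent variables\<close>

definition power_tail :: "real measure \<Rightarrow> real \<Rightarrow> real \<Rightarrow> bool" where
  "power_tail \<mu> \<alpha> a \<longleftrightarrow>
     (\<lambda>t. measure \<mu> {t<..} - a * t powr (-\<alpha>)) \<in> o[at_top](\<lambda>t. t powr (-\<alpha>))"

text \<open>The law of \<open>m\<^sup>-\<^sup>1\<^sup>/\<^sup>\<alpha> (S\<^sub>m - B\<^sub>m)\<close>, where \<open>S\<^sub>m\<close> is the sum of \<open>m\<close> independent variables
  with law \<open>\<mu>\<close>.\<close>

definition normalized_sum :: "real measure \<Rightarrow> real \<Rightarrow> (nat \<Rightarrow> real) \<Rightarrow> nat \<Rightarrow> real measure" where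
  "normalized_sum \<mu> \<alpha> B m =
     distr (\<Pi>\<^sub>M i\<in>{1..m}. \<mu>) borel (\<lambda>y. ((\<Sum>i\<in>{1..m}. y i) - B m) / real m powr (1 / \<alpha>))"

text \<open>The centering sequences. For \<open>\<alpha> = 1\<close> both usual forms are admitted: \<open>c ln m\<close>, and
  \<open>c m ln m\<close>, i.e. \<open>c ln m\<close> subtracted after the division by \<open>m\<close>. Only the second form is of
  the order of magnitude of the sum itself.\<close>

definition centering :: "real measure \<Rightarrow> real \<Rightarrow> (nat \<Rightarrow> real) \<Rightarrow> bool" where
  "centering \<mu> \<alpha> B \<longleftrightarrow>
     (\<alpha> < 1 \<longrightarrow> B = (\<lambda>m. 0)) \<and>
     (\<alpha> = 1 \<longrightarrow> (\<exists>c>0. B = (\<lambda>m. c * ln (real m)) \<or> B = (\<lambda>m. c * (real m * ln (real m))))) \<and>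
     (\<alpha> > 1 \<longrightarrow> B = (\<lambda>m. real m * (\<integral>x. x \<partial>\<mu>)))"

definition stable_distribution :: "real \<Rightarrow> real measure \<Rightarrow> bool" where
  "stable_distribution \<alpha> G \<longleftrightarrow>
     real_distribution G \<and> (\<nexists>x. G = return borel x) \<and>
     (\<forall>k\<ge>1. \<exists>d. distr (\<Pi>\<^sub>M i\<in>{1..k}. G) borel (\<lambda>y. \<Sum>i\<in>{1..k}. y i) =
                 distr G borel (\<lambda>x. real k powr (1 / \<alpha>) * x + d))"

text \<open>For \<open>\<alpha> \<noteq> 1\<close> the limit law of the generalized central limit theorem depends on \<open>a\<close> and
  \<open>\<alpha>\<close> only: it is the same for all laws \<open>\<mu>\<close> on the nonnegative reals with the given tail.
  For \<open>\<alpha> = 1\<close> no such common limit exists, so this constant is not to be used there.\<close>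

definition stable_limit :: "real \<Rightarrow> real \<Rightarrow> real measure" where
  "stable_limit \<alpha> a = (THE G. stable_distribution \<alpha> G \<and>
     (\<forall>\<mu> B. real_distribution \<mu> \<longrightarrow> measure \<mu> {..<0} = 0 \<longrightarrow> power_tail \<mu> \<alpha> a \<longrightarrow>
        centering \<mu> \<alpha> B \<longrightarrow> weak_conv_m (normalized_sum \<mu> \<alpha> B) G))"

end

theory Submission
  imports Defs "HOL-Real_Asymp.Real_Asymp"
begin

text \<open>
  Conditionally on the sizes and densities \<open>(X\<^sub>i, Q\<^sub>i)\<close>, the number of copies of \<open>F\<close> differs from
  \<open>\<Sum>\<^sub>i N\<^sup>*\<^sub>F\<^sub>,\<^sub>i\<close> by the copies that are not contained in exactly one community and by the
  fluctuations of the counts in single communities around their conditional means.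

  A copy of the first kind gives a nonconstant colouring of the edges of \<open>F\<close> by communities. Since
  \<open>F\<close> is 2-connected, one finds \<open>v\<^sub>F\<close> of its edges such that, in each colour, the \<open>s\<close>
  edges of that colour have at least \<open>s + 1\<close> endpoints; a community covers them with probability at
  most \<open>E ((X/n)\<^sup>s\<^sup>+\<^sup>1 Q\<^sup>s)\<close>, which the moment conditions bound by
  \<open>o(n\<^sup>-\<^sup>s\<^sup>-\<^sup>1 n powr (s / (\<alpha> e\<^sub>F)))\<close>. As \<open>v\<^sub>F \<le> e\<^sub>F\<close>, the expected number of such copies is
  \<open>o(n powr (1 / \<alpha>))\<close>.

  For the fluctuations, balancedness bounds the conditional variance of the count in one community by
  a multiple of \<open>1 + N\<^sup>* powr (2 - 1 / e\<^sub>F)\<close>, and after truncation of \<open>N\<^sup>*\<close> slightly above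
  \<open>m powr (1 / \<alpha>)\<close> these variances sum up to \<open>o(m powr (2 / \<alpha>))\<close>.

  For \<open>\<alpha> \<noteq> 1\<close> the limit law of the independent sums is obtained from characteristic functions: the
  characteristic exponent is an integral of a fixed kernel against the tail, which depends in the limit
  on \<open>\<alpha>\<close> and \<open>a\<close> only.
\<close>

section \<open>Tails and kernel integrals\<close>

text \<open>Why \<open>v\<close> edges, with \<open>v\<close> the number of vertices of
  \<open>F\<close>: there are about \<open>n ^ v\<close> embeddings and, for \<open>r\<close>
  colours, about \<open>m ^ r\<close> choices of communities, with \<open>m\<close> of order
  \<open>n\<close>. A colour with \<open>s\<close> edges costs a factor
  \<open>n powr (- s - 1)\<close>, up to the factor left open by the moment conditions. If the class
  sizes add up to \<open>v\<close>, these powers cancel exactly. A spanning tree would leave a spare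
  factor \<open>n\<close>; hence a spanning subgraph with one cycle is used, and the extra endpoint
  in every colour is guaranteed as soon as that cycle is not monochromatic.

  Neither count needs to have a finite mean, so the comparison is made on the cosine and sine of the
  normalized counts. These are bounded and Lipschitz: rare bad communities cost only their
  probability, and otherwise the error is controlled in conditional mean. The centering cancels in
  the difference, so the comparison holds for every \<open>B\<close> and also for
  \<open>\<alpha> = 1\<close>. There the exponent integrals of the other two cases diverge, and the
  comparison carries over whatever limit the independent sums have.\<close>

lemma set_integrable_powr_Icc:
  fixes p c :: real
  assumes "p > -1" "c \<ge> 0"
  shows "set_integrable lborel {0..c} (\<lambda>y. y powr p)"
proof -
  have "(\<lambda>y. y powr p) absolutely_integrable_on {0..c}"
    using has_integral_powr_from_0[of p c] assms
    by (intro nonnegative_absolutely_integrable_1) (auto simp: integrable_on_def)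
  then show ?thesis
    unfolding set_integrable_def by (subst (asm) integrable_completion) auto
qed

lemma set_integrable_powr_Ici:
  fixes p c :: real
  assumes "p < -1" "c > 0"
  shows "set_integrable lborel {c..} (\<lambda>y. y powr p)"
proof -
  have "(\<lambda>y. y powr p) absolutely_integrable_on {c..}"
    using has_integral_powr_to_inf[of p c] assms
    by (intro nonnegative_absolutely_integrable_1) (auto simp: integrable_on_def)
  then show ?thesis
    unfolding set_integrable_def by (subst (asm) integrable_completion) auto
qed

text \<open>Layer-cake formula: Fubini for \<open>k y\<close> on the region
  \<open>0 < y < x / r\<close>. It is stated in terms of the derivative \<open>k\<close> of the
  integrated function, so only \<open>k\<close> has to be integrable against the tail, and
  Banach-valued \<open>k\<close> lets complex exponentials pass without splitting. For
  \<open>x \<le> 0\<close> the inner interval is empty.\<close>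

lemma tail_integral_formula:
  fixes \<mu> :: "real measure" and k :: "real \<Rightarrow> 'a::{banach, second_countable_topology}"
  assumes "real_distribution \<mu>" and r: "r > 0" and [measurable]: "k \<in> borel_measurable borel"
    and int: "set_integrable lborel {0<..} (\<lambda>y. measure \<mu> {r * y<..} *\<^sub>R k y)"
  shows "integrable \<mu> (\<lambda>x. LBINT y:{0<..<x / r}. k y)"
    and "(\<integral>x. (LBINT y:{0<..<x / r}. k y) \<partial>\<mu>) = (LBINT y:{0<..}. measure \<mu> {r * y<..} *\<^sub>R k y)"
proof -
  interpret real_distribution \<mu> by fact
  interpret P: pair_sigma_finite lborel \<mu> ..
  define f where "f y x = (if 0 < y \<and> r * y < x then k y else 0)" for y x
  have [measurable]: "case_prod f \<in> borel_measurable (lborel \<Otimes>\<^sub>M \<mu>)"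
    unfolding f_def by measurable
  have ind: "f y x = indicator {r * y<..} x *\<^sub>R (indicator {0<..} y *\<^sub>R k y)" for y x
    by (auto simp: f_def indicator_def)
  have fint: "integrable \<mu> (\<lambda>x. f y x)" for y
    unfolding ind by (intro integrable_scaleR_left) (auto simp: emeasure_eq_measure)
  have feq: "(\<integral>x. f y x \<partial>\<mu>) = indicator {0<..} y *\<^sub>R (measure \<mu> {r * y<..} *\<^sub>R k y)" for y
    unfolding ind by (subst integral_scaleR_left) (auto simp: emeasure_eq_measure)
  have feq': "(\<integral>x. norm (f y x) \<partial>\<mu>) = norm (indicator {0<..} y *\<^sub>R (measure \<mu> {r * y<..} *\<^sub>R k y))" for y
  proof -
    have "(\<integral>x. norm (f y x) \<partial>\<mu>) = (\<integral>x. indicator {r * y<..} x *\<^sub>R norm (indicator {0<..} y *\<^sub>R k y) \<partial>\<mu>)"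
      by (intro Bochner_Integration.integral_cong) (auto simp: ind)
    also have "\<dots> = measure \<mu> {r * y<..} *\<^sub>R norm (indicator {0<..} y *\<^sub>R k y)"
      by (subst integral_scaleR_left) (auto simp: emeasure_eq_measure)
    finally show ?thesis by (simp add: indicator_def)
  qed
  have I: "integrable (lborel \<Otimes>\<^sub>M \<mu>) (case_prod f)"
  proof (rule P.Fubini_integrable)
    show "integrable lborel (\<lambda>y. LINT x|\<mu>. norm (case_prod f (y, x)))"
      using integrable_norm[OF int[unfolded set_integrable_def]] by (simp only: prod.case feq')
    show "AE y in lborel. integrable \<mu> (\<lambda>x. case_prod f (y, x))"
      using fint by simp
  qed simp
  have inner: "(LINT y|lborel. f y x) = (LBINT y:{0<..<x / r}. k y)" for x
    unfolding set_lebesgue_integral_def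
    by (intro Bochner_Integration.integral_cong) (use r in \<open>auto simp: f_def indicator_def field_simps\<close>)
  show "integrable \<mu> (\<lambda>x. LBINT y:{0<..<x / r}. k y)"
    using P.integrable_snd[OF I] by (simp add: inner)
  show "(\<integral>x. (LBINT y:{0<..<x / r}. k y) \<partial>\<mu>) = (LBINT y:{0<..}. measure \<mu> {r * y<..} *\<^sub>R k y)"
    using P.Fubini_integral[OF I] by (simp add: inner feq set_lebesgue_integral_def)
qed

locale heavy_tail = real_distribution \<mu> for \<mu> :: "real measure" +
  fixes \<alpha> a :: real
  assumes nonneg: "measure \<mu> {..<0} = 0"
    and tail: "power_tail \<mu> \<alpha> a"
    and \<alpha>_pos: "\<alpha> > 0" and a_pos: "a > 0"
begin

abbreviation T :: "real \<Rightarrow> real" where "T t \<equiv> measure \<mu> {t<..}"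

lemma T_measurable [measurable]: "T \<in> borel_measurable borel"
proof -
  have "antimono T" by (auto simp: antimono_def intro!: finite_measure_mono)
  then have "mono (\<lambda>x. - T x)" by (auto simp: antimono_def mono_def)
  then have "(\<lambda>x. - (- T x)) \<in> borel_measurable borel"
    by (intro borel_measurable_uminus borel_measurable_mono)
  then show ?thesis by simp
qed

lemma AE_nonneg: "AE x in \<mu>. 0 \<le> x"
proof -
  have "emeasure \<mu> {..<0} = 0" using nonneg by (simp add: emeasure_eq_measure)
  then show ?thesis
    by (intro AE_I[of _ _ "{..<0}"]) auto
qed

lemma tail_limit: "((\<lambda>t. t powr \<alpha> * T t) \<longlongrightarrow> a) at_top"
proof -
  have "((\<lambda>t. (T t - a * t powr - \<alpha>) / t powr - \<alpha>) \<longlongrightarrow> 0) at_top"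
    using tail unfolding power_tail_def by (rule smalloD_tendsto)
  then have "((\<lambda>t. (T t - a * t powr - \<alpha>) / t powr - \<alpha> + a) \<longlongrightarrow> 0 + a) at_top"
    by (intro tendsto_add) auto
  moreover have "eventually (\<lambda>t. (T t - a * t powr - \<alpha>) / t powr - \<alpha> + a = t powr \<alpha> * T t) at_top"
    using eventually_gt_at_top[of 0]
    by eventually_elim (auto simp: field_simps powr_minus)
  ultimately show ?thesis by (simp add: tendsto_cong)
qed

definition tailC where "tailC = (SOME C. C > 0 \<and> (\<forall>t>0. T t \<le> C * t powr - \<alpha>))"

text \<open>The limit of the tail gives the constant \<open>a + 1\<close> far out; closer to 0 the
  trivial bound \<open>T t \<le> 1\<close> serves, because \<open>t powr \<alpha>\<close> is bounded
  there. A bound on the whole half-line gives one majorant for all scales \<open>r\<close>.\<close>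

lemma tailC: "tailC > 0" "\<And>t. t > 0 \<Longrightarrow> T t \<le> tailC * t powr - \<alpha>"
proof -
  have "eventually (\<lambda>t. t powr \<alpha> * T t < a + 1) at_top"
    using tail_limit by (rule order_tendstoD) auto
  then obtain N where N: "\<And>t. t \<ge> N \<Longrightarrow> t powr \<alpha> * T t < a + 1"
    by (auto simp: eventually_at_top_linorder)
  define C where "C = max (a + 1) (max N 1 powr \<alpha>)"
  have "T t \<le> C * t powr - \<alpha>" if "t > 0" for t
  proof -
    have "t powr \<alpha> * T t \<le> C"
    proof (cases "t \<ge> N")
      case True then show ?thesis using N[of t] by (simp add: C_def)
    next
      case False
      have "t powr \<alpha> * T t \<le> t powr \<alpha> * 1"
        by (intro mult_left_mono) auto
      also have "\<dots> \<le> max N 1 powr \<alpha>" using False that \<alpha>_pos by (simp add: powr_mono2)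
      finally show ?thesis by (simp add: C_def)
    qed
    then show ?thesis using that by (simp add: powr_minus field_simps)
  qed
  moreover have "C > 0" using a_pos by (simp add: C_def)
  ultimately have "\<exists>C. C > 0 \<and> (\<forall>t>0. T t \<le> C * t powr - \<alpha>)" by blast
  from someI_ex[OF this] show "tailC > 0" "\<And>t. t > 0 \<Longrightarrow> T t \<le> tailC * t powr - \<alpha>"
    by (auto simp: tailC_def)
qed

lemma tail_scaled: "r > 0 \<Longrightarrow> y > 0 \<Longrightarrow> r powr \<alpha> * T (r * y) \<le> tailC * y powr - \<alpha>"
  using tailC(2)[of "r * y"] by (simp add: powr_mult powr_minus field_simps)

lemma kernel_integrable:
  fixes k :: "real \<Rightarrow> 'a::{banach, second_countable_topology}"
  assumes [measurable]: "k \<in> borel_measurable borel" and r: "r > 0"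
    and int: "set_integrable lborel {0<..} (\<lambda>y. y powr - \<alpha> *\<^sub>R k y)"
  shows "set_integrable lborel {0<..} (\<lambda>y. T (r * y) *\<^sub>R k y)"
  unfolding set_integrable_def
proof (rule Bochner_Integration.integrable_bound)
  show "integrable lborel (\<lambda>y. (tailC * r powr - \<alpha>) *\<^sub>R (indicator {0<..} y *\<^sub>R (y powr - \<alpha> *\<^sub>R k y)))"
    using int unfolding set_integrable_def by (intro integrable_scaleR_right) auto
  show "AE y in lborel. norm (indicator {0<..} y *\<^sub>R T (r * y) *\<^sub>R k y)
     \<le> norm ((tailC * r powr - \<alpha>) *\<^sub>R (indicator {0<..} y *\<^sub>R (y powr - \<alpha> *\<^sub>R k y)))"
  proof (intro AE_I2)
    fix y :: real
    show "norm (indicator {0<..} y *\<^sub>R T (r * y) *\<^sub>R k y)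
     \<le> norm ((tailC * r powr - \<alpha>) *\<^sub>R (indicator {0<..} y *\<^sub>R (y powr - \<alpha> *\<^sub>R k y)))"
      using mult_right_mono[OF tail_scaled[of r y] norm_ge_zero[of "k y"]] r tailC(1)
      by (auto simp: indicator_def powr_minus field_simps abs_mult)
  qed
qed measurable

text \<open>Dominated convergence: \<open>r powr \<alpha> * T (r * y)\<close> tends to
  \<open>a * y powr - \<alpha>\<close> and stays below \<open>tailC * y powr - \<alpha>\<close>. The
  limit retains nothing of the law except \<open>a\<close> and \<open>\<alpha>\<close>, which is the
  origin of a common limit law.\<close>

lemma kernel_limit:
  fixes k :: "real \<Rightarrow> 'a::{banach, second_countable_topology}"
  assumes [measurable]: "k \<in> borel_measurable borel"
    and int: "set_integrable lborel {0<..} (\<lambda>y. y powr - \<alpha> *\<^sub>R k y)"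
  shows "((\<lambda>r. r powr \<alpha> *\<^sub>R (\<integral>x. (LBINT y:{0<..<x / r}. k y) \<partial>\<mu>)) \<longlongrightarrow>
           a *\<^sub>R (LBINT y:{0<..}. y powr - \<alpha> *\<^sub>R k y)) at_top"
proof -
  have "((\<lambda>r. LINT y|lborel. indicator {0<..} y *\<^sub>R ((r powr \<alpha> * T (r * y)) *\<^sub>R k y)) \<longlongrightarrow>
         (LINT y|lborel. indicator {0<..} y *\<^sub>R ((a * y powr - \<alpha>) *\<^sub>R k y))) at_top"
  proof (rule integral_dominated_convergence_at_top[where w = "\<lambda>y. tailC * norm (indicator {0<..} y *\<^sub>R y powr - \<alpha> *\<^sub>R k y)"])
    show "\<forall>\<^sub>F r in at_top. AE y in lborel. norm (indicator {0<..} y *\<^sub>R (r powr \<alpha> * T (r * y)) *\<^sub>R k y)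
        \<le> tailC * norm (indicator {0<..} y *\<^sub>R y powr - \<alpha> *\<^sub>R k y)"
      using eventually_gt_at_top[of 0]
    proof eventually_elim
      case (elim r)
      have "norm (indicator {0<..} y *\<^sub>R (r powr \<alpha> * T (r * y)) *\<^sub>R k y)
        \<le> tailC * norm (indicator {0<..} y *\<^sub>R y powr - \<alpha> *\<^sub>R k y)" for y :: real
        using mult_right_mono[OF tail_scaled[of r y] norm_ge_zero[of "k y"]] elim
        by (auto simp: indicator_def mult_ac)
      then show ?case by auto
    qed
    show "AE y in lborel. ((\<lambda>r. indicator {0<..} y *\<^sub>R (r powr \<alpha> * T (r * y)) *\<^sub>R k y) \<longlongrightarrow>
          indicator {0<..} y *\<^sub>R ((a * y powr - \<alpha>) *\<^sub>R k y)) at_top"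
    proof (intro AE_I2)
      fix y :: real
      show "((\<lambda>r. indicator {0<..} y *\<^sub>R (r powr \<alpha> * T (r * y)) *\<^sub>R k y) \<longlongrightarrow>
          indicator {0<..} y *\<^sub>R ((a * y powr - \<alpha>) *\<^sub>R k y)) at_top"
      proof (cases "y > 0")
        case True
        have "filterlim (\<lambda>r. r * y) at_top at_top"
          using True by (intro filterlim_at_top_mult_tendsto_pos[OF tendsto_const]) (auto simp: filterlim_ident)
        then have "((\<lambda>r. (r * y) powr \<alpha> * T (r * y)) \<longlongrightarrow> a) at_top"
          by (rule filterlim_compose[OF tail_limit])
        then have "((\<lambda>r. y powr - \<alpha> * ((r * y) powr \<alpha> * T (r * y))) \<longlongrightarrow> y powr - \<alpha> * a) at_top"
          by (intro tendsto_intros)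
        moreover have "eventually (\<lambda>r. y powr - \<alpha> * ((r * y) powr \<alpha> * T (r * y)) = r powr \<alpha> * T (r * y)) at_top"
          using eventually_gt_at_top[of 0] 
          by eventually_elim (use True in \<open>auto simp: powr_mult powr_minus field_simps\<close>)
        ultimately have "((\<lambda>r. r powr \<alpha> * T (r * y)) \<longlongrightarrow> y powr - \<alpha> * a) at_top"
          by (simp cong: tendsto_cong)
        then show ?thesis
            by (intro tendsto_scaleR tendsto_const) (simp add: mult.commute)
      qed simp
    qed
    show "integrable lborel (\<lambda>y. tailC * norm (indicator {0<..} y *\<^sub>R y powr - \<alpha> *\<^sub>R k y))"
      using int unfolding set_integrable_def by (intro integrable_mult_right integrable_norm)
  qed measurable
  also have "(LINT y|lborel. indicator {0<..} y *\<^sub>R ((a * y powr - \<alpha>) *\<^sub>R k y))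
        = a *\<^sub>R (LBINT y:{0<..}. y powr - \<alpha> *\<^sub>R k y)"
    unfolding set_lebesgue_integral_def integral_scaleR_right[symmetric]
    by (intro Bochner_Integration.integral_cong) (auto simp: mult_ac)
  finally show ?thesis
  proof (rule Lim_transform_eventually)
    show "\<forall>\<^sub>F r in at_top. (LINT y|lborel. indicator {0<..} y *\<^sub>R ((r powr \<alpha> * T (r * y)) *\<^sub>R k y)) =
        r powr \<alpha> *\<^sub>R (\<integral>x. (LBINT y:{0<..<x / r}. k y) \<partial>\<mu>)"
      using eventually_gt_at_top[of 0]
    proof eventually_elim
      case (elim r)
      show ?case
        unfolding tail_integral_formula(2)[OF real_distribution_axioms elim assms(1) kernel_integrable[OF assms(1) elim int]]
        unfolding set_lebesgue_integral_def integral_scaleR_right[symmetric]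
        by (intro Bochner_Integration.integral_cong) (auto simp: mult_ac)
    qed
  qed
qed

end

section \<open>Antiderivatives of the kernels and the characteristic exponent\<close>

lemma LBINT_Ioo_eq_Icc:
  fixes f :: "real \<Rightarrow> 'a::{banach, second_countable_topology}"
  assumes "a \<le> b"
  shows "(LBINT y:{a<..<b}. f y) = (LBINT y:{a..b}. f y)"
  using interval_integral_Icc[OF assms, of f] interval_integral_Ioo[of a b f] assms by simp

lemma LBINT_iexp:
  assumes "0 \<le> x"
  shows "(LBINT y:{0<..<x}. \<i> * iexp y) = iexp x - 1"
proof -
  have "(LBINT y. indicator {0..x} y *\<^sub>R (\<i> * iexp y)) = iexp x - iexp 0"
    by (rule integral_FTC_Icc[OF assms])
       (auto intro!: derivative_eq_intros has_vector_derivative_real_field continuous_intros)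
  then show ?thesis
    unfolding LBINT_Ioo_eq_Icc[OF assms] unfolding set_lebesgue_integral_def by simp
qed

lemma LBINT_iexp_minus_1:
  assumes "0 \<le> x"
  shows "(LBINT y:{0<..<x}. \<i> * (iexp y - 1)) = iexp x - 1 - \<i> * x"
proof -
  have "(LBINT y. indicator {0..x} y *\<^sub>R (\<i> * (iexp y - 1))) = (iexp x - \<i> * x) - (iexp 0 - \<i> * complex_of_real 0)"
    by (rule integral_FTC_Icc[OF assms])
       (auto intro!: derivative_eq_intros has_vector_derivative_real_field continuous_intros simp: algebra_simps)
  then show ?thesis
    unfolding LBINT_Ioo_eq_Icc[OF assms] unfolding set_lebesgue_integral_def by simp
qed

lemma LBINT_powr:
  fixes g :: real
  assumes "0 \<le> x" "g > 0"
  shows "(LBINT y:{0<..<x}. g * y powr (g - 1)) = x powr g"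
proof -
  have "((\<lambda>y. y powr (g - 1)) has_integral (x powr (g - 1 + 1) / (g - 1 + 1))) {0..x}"
    using has_integral_powr_from_0[of "g - 1" x] assms by simp
  moreover have "set_integrable lborel {0..x} (\<lambda>y. y powr (g - 1))"
    using assms by (intro set_integrable_powr_Icc) auto
  ultimately have "(LBINT y:{0..x}. y powr (g - 1)) = x powr g / g"
    by (simp add: set_borel_integral_eq_integral integral_unique)
  then show ?thesis
    using assms by (simp add: LBINT_Ioo_eq_Icc[OF assms(1)])
qed

text \<open>For \<open>\<alpha> < 1\<close> the function \<open>y powr - \<alpha>\<close> is not
  integrable at infinity and the derivative of \<open>iexp\<close> has modulus 1, so the untruncated
  integral exists only in the improper sense. Cutting at \<open>R\<close> corresponds to replacing
  \<open>x\<close> by \<open>min x R\<close> in \<open>iexp x - 1\<close>.\<close>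

definition truncated_kernel :: "real \<Rightarrow> real \<Rightarrow> complex" where
  "truncated_kernel R y = (if y < R then \<i> * iexp y else 0)"

text \<open>The exponent of the stable law in the form obtained from the Levy integral of
  \<open>iexp y - 1\<close> (for \<open>\<alpha> > 1\<close> of
  \<open>iexp y - 1 - \<i> * y\<close>) against
  \<open>a * \<alpha> * y powr (- \<alpha> - 1)\<close> by one integration by parts. A closed form
  is never computed: uniqueness rests on its dependence on \<open>a\<close> and
  \<open>\<alpha>\<close> alone, nondegeneracy on the sign of its real part.\<close>

definition stable_exponent :: "real \<Rightarrow> real \<Rightarrow> complex" where
  "stable_exponent \<alpha> a = (if \<alpha> < 1
     then lim (\<lambda>N. a *\<^sub>R (LBINT y:{0<..}. y powr - \<alpha> *\<^sub>R truncated_kernel (real N) y))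
     else a *\<^sub>R (LBINT y:{0<..}. y powr - \<alpha> *\<^sub>R (\<i> * (iexp y - 1))))"

lemma truncated_kernel_measurable [measurable]: "truncated_kernel R \<in> borel_measurable borel"
  unfolding truncated_kernel_def by measurable

lemma truncated_kernel_integrable:
  assumes "\<alpha> < 1"
  shows "set_integrable lborel {0<..} (\<lambda>y. y powr - \<alpha> *\<^sub>R truncated_kernel R y)"
  unfolding set_integrable_def
proof (rule Bochner_Integration.integrable_bound)
  show "integrable lborel (\<lambda>y. indicator {0..max 0 R} y *\<^sub>R y powr - \<alpha>)"
    using set_integrable_powr_Icc[of "- \<alpha>" "max 0 R"] assms by (simp add: set_integrable_def)
  show "AE y in lborel. norm (indicator {0<..} y *\<^sub>R y powr - \<alpha> *\<^sub>R truncated_kernel R y)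
        \<le> norm (indicator {0..max 0 R} y *\<^sub>R y powr - \<alpha>)"
    by (intro AE_I2) (auto simp: truncated_kernel_def indicator_def norm_mult)
qed measurable

lemma set_integral_truncated_kernel:
  assumes "0 \<le> x" "0 \<le> R"
  shows "(LBINT y:{0<..<x}. truncated_kernel R y) = iexp (min x R) - 1"
proof -
  have "(LBINT y:{0<..<x}. truncated_kernel R y) = (LBINT y:{0<..<min x R}. \<i> * iexp y)"
    unfolding set_lebesgue_integral_def truncated_kernel_def
    by (intro Bochner_Integration.integral_cong) (auto simp: indicator_def)
  then show ?thesis using LBINT_iexp[of "min x R"] assms by simp
qed

text \<open>The modulus of \<open>iexp y - 1\<close> is at most both \<open>y\<close> and 2. The
  first bound gives \<open>y powr (1 - \<alpha>)\<close>, integrable at 0 as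
  \<open>\<alpha> < 2\<close>; the second gives \<open>y powr - \<alpha>\<close>, integrable at
  infinity as \<open>\<alpha> > 1\<close>.\<close>

lemma centred_kernel_integrable:
  assumes "1 < \<alpha>" "\<alpha> < 2"
  shows "set_integrable lborel {0<..} (\<lambda>y. y powr - \<alpha> *\<^sub>R (\<i> * (iexp y - 1)))"
  unfolding set_integrable_def
proof (rule Bochner_Integration.integrable_bound)
  show "integrable lborel (\<lambda>y. indicator {0..1} y *\<^sub>R y powr (1 - \<alpha>) + 2 * (indicator {1..} y *\<^sub>R y powr - \<alpha>))"
    using set_integrable_powr_Icc[of "1 - \<alpha>" 1] set_integrable_powr_Ici[of "- \<alpha>" 1] assms 
    by (auto simp: set_integrable_def)
  show "AE y in lborel. norm (indicator {0<..} y *\<^sub>R y powr - \<alpha> *\<^sub>R (\<i> * (iexp y - 1)))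
        \<le> norm (indicator {0..1} y *\<^sub>R y powr (1 - \<alpha>) + 2 * (indicator {1..} y *\<^sub>R y powr - \<alpha>))"
  proof (intro AE_I2)
    fix y :: real
    have 1: "norm (iexp y - 1) \<le> \<bar>y\<bar>" using iexp_approx1[of y 0] by simp
    have 2: "norm (iexp y - 1) \<le> 2" using norm_triangle_ineq4[of "iexp y" 1] by simp
    have "y powr - \<alpha> * norm (iexp y - 1) \<le> indicator {0..1} y *\<^sub>R y powr (1 - \<alpha>) + 2 * (indicator {1..} y *\<^sub>R y powr - \<alpha>)"
      if "y > 0"
    proof (cases "y < 1")
      case True
      have "y powr - \<alpha> * norm (iexp y - 1) \<le> y powr - \<alpha> * y"
        using 1 that by (intro mult_left_mono) auto
      also have "\<dots> = y powr (1 - \<alpha>)" using that by (simp add: powr_diff powr_minus field_simps)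
      finally show ?thesis using True that by (simp add: indicator_def)
    next
      case False
      have "y powr - \<alpha> * norm (iexp y - 1) \<le> y powr - \<alpha> * 2"
        using 2 by (intro mult_left_mono) auto
      also have "\<dots> \<le> indicator {0..1} y *\<^sub>R y powr (1 - \<alpha>) + 2 * (indicator {1..} y *\<^sub>R y powr - \<alpha>)"
        using False by (simp add: indicator_def)
      finally show ?thesis .
    qed
    then show "norm (indicator {0<..} y *\<^sub>R y powr - \<alpha> *\<^sub>R (\<i> * (iexp y - 1)))
        \<le> norm (indicator {0..1} y *\<^sub>R y powr (1 - \<alpha>) + 2 * (indicator {1..} y *\<^sub>R y powr - \<alpha>))"
      by (auto simp: indicator_def norm_mult)
  qed
qed measurable

context heavy_tail
begin

text \<open>Layer-cake formula with the kernel \<open>g * y powr (g - 1)\<close>. Up to 1 the tail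
  is at most 1; beyond 1 the tail bound leaves the exponent \<open>g - 1 - \<alpha>\<close>, below
  \<open>-1\<close>. Orders \<open>g\<close> just below \<open>\<alpha>\<close> later measure the
  truncated variances.\<close>

lemma powr_integrable:
  assumes g: "0 < g" "g < \<alpha>"
  shows "integrable \<mu> (\<lambda>x. x powr g)"
proof -
  have "set_integrable lborel {0<..} (\<lambda>y. T (1 * y) *\<^sub>R (g * y powr (g - 1)))"
    unfolding set_integrable_def
  proof (rule Bochner_Integration.integrable_bound)
    show "integrable lborel (\<lambda>y. g * (indicator {0..1} y *\<^sub>R y powr (g - 1)) + tailC * g * (indicator {1..} y *\<^sub>R y powr (g - 1 - \<alpha>)))"
      using set_integrable_powr_Icc[of "g - 1" 1] set_integrable_powr_Ici[of "g - 1 - \<alpha>" 1] assms 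
      by (intro Bochner_Integration.integrable_add integrable_mult_right) (auto simp: set_integrable_def)
    show "AE y in lborel. norm (indicator {0<..} y *\<^sub>R T (1 * y) *\<^sub>R (g * y powr (g - 1)))
       \<le> norm (g * (indicator {0..1} y *\<^sub>R y powr (g - 1)) + tailC * g * (indicator {1..} y *\<^sub>R y powr (g - 1 - \<alpha>)))"
    proof (intro AE_I2)
      fix y :: real
      have "T y * (g * y powr (g - 1)) \<le> g * (indicator {0..1} y *\<^sub>R y powr (g - 1)) + tailC * g * (indicator {1..} y *\<^sub>R y powr (g - 1 - \<alpha>))"
        if y: "y > 0"
      proof (cases "y < 1")
        case True
        have "T y * (g * y powr (g - 1)) \<le> 1 * (g * y powr (g - 1))"
          using g by (intro mult_right_mono) auto
        then show ?thesis using True y by (simp add: indicator_def)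
      next
        case False
        have "T y * (g * y powr (g - 1)) \<le> (tailC * y powr - \<alpha>) * (g * y powr (g - 1))"
          using g y by (intro mult_right_mono tailC(2)) auto
        also have "\<dots> = tailC * g * y powr (g - 1 - \<alpha>)"
          using powr_add[of y "- \<alpha>" "g - 1"] by (simp add: algebra_simps)
        also have "\<dots> \<le> g * (indicator {0..1} y *\<^sub>R y powr (g - 1)) + tailC * g * (indicator {1..} y *\<^sub>R y powr (g - 1 - \<alpha>))"
          using False g by (simp add: indicator_def)
        finally show ?thesis .
      qed
      then show "norm (indicator {0<..} y *\<^sub>R T (1 * y) *\<^sub>R (g * y powr (g - 1)))
       \<le> norm (g * (indicator {0..1} y *\<^sub>R y powr (g - 1)) + tailC * g * (indicator {1..} y *\<^sub>R y powr (g - 1 - \<alpha>)))"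
        using g tailC(1) by (auto simp: indicator_def abs_mult)
    qed
  qed measurable
  then have "integrable \<mu> (\<lambda>x. LBINT y:{0<..<x / 1}. g * y powr (g - 1))"
    using real_distribution_axioms by (intro tail_integral_formula(1)) auto
  moreover have "AE x in \<mu>. (LBINT y:{0<..<x / 1}. g * y powr (g - 1)) = x powr g"
    using AE_nonneg by eventually_elim (use LBINT_powr[OF _ g(1)] in simp)
  ultimately show ?thesis
    by (intro Bochner_Integration.integrable_cong_AE_imp[of \<mu> "\<lambda>x. LBINT y:{0<..<x / 1}. g * y powr (g - 1)" "\<lambda>x. x powr g"])
       (simp_all only: eq_commute, measurable)
qed

lemma mean_integrable: "1 < \<alpha> \<Longrightarrow> integrable \<mu> (\<lambda>x. x)"
  using powr_integrable[of 1] AE_nonneg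
  by (subst Bochner_Integration.integrable_cong_AE[of _ _ "\<lambda>x. x powr 1"])
     (auto elim!: eventually_mono)

lemma iexp_integrable [simp]: "integrable \<mu> (\<lambda>x. iexp (f x))" if [measurable]: "f \<in> borel_measurable borel"
  by (rule integrable_const_bound[where B = 1]) auto

text \<open>The antiderivative of the centred kernel that vanishes at 0 is
  \<open>iexp x - 1 - \<i> * x\<close>, so the kernel limit is the expansion of the characteristic
  function at \<open>1 / r\<close> beyond its linear term.\<close>

lemma char_limit_centred:
  assumes "1 < \<alpha>" "\<alpha> < 2"
  shows "((\<lambda>r. r powr \<alpha> *\<^sub>R (char \<mu> (1 / r) - 1 - \<i> * ((\<integral>x. x \<partial>\<mu>) / r))) \<longlongrightarrow> stable_exponent \<alpha> a) at_top"
proof -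
  have "((\<lambda>r. r powr \<alpha> *\<^sub>R (\<integral>x. (LBINT y:{0<..<x / r}. \<i> * (iexp y - 1)) \<partial>\<mu>)) \<longlongrightarrow> stable_exponent \<alpha> a) at_top"
    using kernel_limit[OF _ centred_kernel_integrable[OF assms]] assms
    by (simp add: stable_exponent_def)
  moreover have "\<forall>\<^sub>F r in at_top. r powr \<alpha> *\<^sub>R (\<integral>x. (LBINT y:{0<..<x / r}. \<i> * (iexp y - 1)) \<partial>\<mu>) =
     r powr \<alpha> *\<^sub>R (char \<mu> (1 / r) - 1 - \<i> * ((\<integral>x. x \<partial>\<mu>) / r))"
    using eventually_gt_at_top[of 0]
  proof eventually_elim
    case (elim r)
    have "(\<integral>x. (LBINT y:{0<..<x / r}. \<i> * (iexp y - 1)) \<partial>\<mu>) = (\<integral>x. iexp (x / r) - 1 - \<i> * complex_of_real (x / r) \<partial>\<mu>)"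
    proof (rule integral_cong_AE)
      show "(\<lambda>x. LBINT y:{0<..<x / r}. \<i> * (iexp y - 1)) \<in> borel_measurable \<mu>"
        using tail_integral_formula(1)[OF real_distribution_axioms elim _ kernel_integrable[OF _ elim centred_kernel_integrable[OF assms]]]
        by simp
      show "AE x in \<mu>. (LBINT y:{0<..<x / r}. \<i> * (iexp y - 1)) = iexp (x / r) - 1 - \<i> * complex_of_real (x / r)"
        using AE_nonneg by eventually_elim (use elim LBINT_iexp_minus_1 in auto)
    qed measurable
    also have "\<dots> = (\<integral>x. iexp (x / r) \<partial>\<mu>) - (\<integral>x. 1 + \<i> * complex_of_real (x / r) \<partial>\<mu>)"
    proof (subst Bochner_Integration.integral_diff[symmetric])
      show "integrable \<mu> (\<lambda>x. iexp (x / r))" by (rule iexp_integrable) measurable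
      show "integrable \<mu> (\<lambda>x. 1 + \<i> * complex_of_real (x / r))"
        using mean_integrable[OF assms(1)] by simp
    qed (simp only: diff_diff_eq)
    also have "(\<integral>x. 1 + \<i> * complex_of_real (x / r) \<partial>\<mu>) = 1 + \<i> * ((\<integral>x. x \<partial>\<mu>) / r)"
      using mean_integrable[OF assms(1)] prob_space by simp
    finally have "(\<integral>x. (LBINT y:{0<..<x / r}. \<i> * (iexp y - 1)) \<partial>\<mu>) = char \<mu> (1 / r) - 1 - \<i> * ((\<integral>x. x \<partial>\<mu>) / r)"
      by (simp add: char_def)
    then show ?case by simp
  qed
  ultimately show ?thesis by (rule Lim_transform_eventually)
qed

text \<open>Replacing \<open>x / r\<close> by its truncation alters \<open>iexp\<close> only where
  \<open>x > r * R\<close>, and by at most 2. After multiplication by \<open>r powr \<alpha>\<close>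
  the error is bounded uniformly in \<open>r\<close>, which permits the exchange of the limits in
  \<open>r\<close> and \<open>R\<close>.\<close>

lemma truncation_error:
  assumes r: "r > 0" and R: "R > 0"
  shows "norm (r powr \<alpha> *\<^sub>R (char \<mu> (1 / r) - 1) - r powr \<alpha> *\<^sub>R (\<integral>x. iexp (min (x / r) R) - 1 \<partial>\<mu>)) \<le> 2 * tailC * R powr - \<alpha>"
proof -
  have "char \<mu> (1 / r) - 1 - (\<integral>x. iexp (min (x / r) R) - 1 \<partial>\<mu>) = (\<integral>x. iexp (x / r) - iexp (min (x / r) R) \<partial>\<mu>)"
  proof -
    have "(\<integral>x. iexp (x / r) - iexp (min (x / r) R) \<partial>\<mu>) = (\<integral>x. iexp (x / r) \<partial>\<mu>) - (\<integral>x. iexp (min (x / r) R) \<partial>\<mu>)"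
      by (intro Bochner_Integration.integral_diff iexp_integrable) measurable
    moreover have "(\<integral>x. iexp (min (x / r) R) - 1 \<partial>\<mu>) = (\<integral>x. iexp (min (x / r) R) \<partial>\<mu>) - 1"
      using prob_space by (subst Bochner_Integration.integral_diff) auto
    ultimately show ?thesis by (simp add: char_def)
  qed
  also have "norm \<dots> \<le> (\<integral>x. norm (iexp (x / r) - iexp (min (x / r) R)) \<partial>\<mu>)"
    by (rule integral_norm_bound)
  also have "\<dots> \<le> (\<integral>x. 2 * indicator {r * R<..} x \<partial>\<mu>)"
  proof (rule integral_mono)
    fix x
    show "norm (iexp (x / r) - iexp (min (x / r) R)) \<le> 2 * indicator {r * R<..} x"
      using r norm_triangle_ineq4[of "iexp (x/r)" "iexp (min (x / r) R)"]
      by (auto simp: indicator_def min_def field_simps)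
  next
    show "integrable \<mu> (\<lambda>x. norm (iexp (x / r) - iexp (min (x / r) R)))"
      by (intro integrable_norm Bochner_Integration.integrable_diff iexp_integrable) measurable
  qed (auto simp: emeasure_eq_measure)
  also have "\<dots> = 2 * T (r * R)" by simp
  finally have "r powr \<alpha> * norm (char \<mu> (1 / r) - 1 - (\<integral>x. iexp (min (x / r) R) - 1 \<partial>\<mu>)) \<le> 2 * (r powr \<alpha> * T (r * R))"
    using mult_left_mono[of _ "2 * T (r * R)" "r powr \<alpha>"] by (simp only: powr_ge_zero mult.left_commute)
  also have "\<dots> \<le> 2 * (tailC * R powr - \<alpha>)" using tail_scaled[OF r R] by simp
  finally show ?thesis by (simp add: scaleR_diff_right[symmetric] abs_mult)
qed

text \<open>Interchange of limits: for fixed \<open>N\<close> the truncated expression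
  \<open>g N\<close> converges to \<open>J N\<close>, and \<open>h\<close> is uniformly close to
  \<open>g N\<close> for large \<open>N\<close>. Hence the \<open>J N\<close> form a Cauchy
  sequence, which also shows that the limit in \<open>stable_exponent\<close> exists.\<close>

lemma char_limit_uncentred:
  assumes "\<alpha> < 1"
  shows "((\<lambda>r. r powr \<alpha> *\<^sub>R (char \<mu> (1 / r) - 1)) \<longlongrightarrow> stable_exponent \<alpha> a) at_top"
proof -
  define J where "J N = a *\<^sub>R (LBINT y:{0<..}. y powr - \<alpha> *\<^sub>R truncated_kernel (real N) y)" for N
  define h where "h r = r powr \<alpha> *\<^sub>R (char \<mu> (1 / r) - 1)" for r
  define g where "g N r = r powr \<alpha> *\<^sub>R (\<integral>x. iexp (min (x / r) (real N)) - 1 \<partial>\<mu>)" for N r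
  have glim: "(g N \<longlongrightarrow> J N) at_top" for N
  proof -
    have "((\<lambda>r. r powr \<alpha> *\<^sub>R (\<integral>x. (LBINT y:{0<..<x / r}. truncated_kernel N y) \<partial>\<mu>)) \<longlongrightarrow> J N) at_top"
      using kernel_limit[OF _ truncated_kernel_integrable[OF assms]] by (simp add: J_def)
    moreover have "\<forall>\<^sub>F r in at_top. r powr \<alpha> *\<^sub>R (\<integral>x. (LBINT y:{0<..<x / r}. truncated_kernel N y) \<partial>\<mu>) = g N r"
      using eventually_gt_at_top[of 0]
    proof eventually_elim
      case (elim r)
      have "(\<integral>x. (LBINT y:{0<..<x / r}. truncated_kernel N y) \<partial>\<mu>) = (\<integral>x. iexp (min (x / r) (real N)) - 1 \<partial>\<mu>)"
      proof (rule integral_cong_AE)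
        show "(\<lambda>x. LBINT y:{0<..<x / r}. truncated_kernel N y) \<in> borel_measurable \<mu>"
          using tail_integral_formula(1)[OF real_distribution_axioms elim _ kernel_integrable[OF _ elim truncated_kernel_integrable[OF assms]]]
          by simp
        show "AE x in \<mu>. (LBINT y:{0<..<x / r}. truncated_kernel N y) = iexp (min (x / r) (real N)) - 1"
          using AE_nonneg by eventually_elim (use elim in \<open>intro set_integral_truncated_kernel, auto\<close>)
      qed measurable
      then show ?case by (simp add: g_def)
    qed
    ultimately show ?thesis by (rule Lim_transform_eventually)
  qed
  have err: "eventually (\<lambda>r. dist (h r) (g N r) \<le> 2 * tailC * real N powr - \<alpha>) at_top" if "N > 0" for N
    using eventually_gt_at_top[of 0] 
  proof eventually_elim
    case (elim r)
    then show ?case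
      using truncation_error[OF elim, of "real N"] that unfolding h_def g_def dist_norm of_nat_0_less_iff by blast
  qed
  have small: "((\<lambda>N. 2 * tailC * real N powr - \<alpha>) \<longlongrightarrow> 0) sequentially"
    using tendsto_neg_powr[OF _ filterlim_real_sequentially, of "- \<alpha>"] \<alpha>_pos
    by (intro tendsto_mult_right_zero) auto
  have "Cauchy J"
  proof (rule metric_CauchyI)
    fix e :: real assume e: "e > 0"
    have "eventually (\<lambda>N. N > 0 \<and> 2 * tailC * real N powr - \<alpha> < e / 4) sequentially"
      using order_tendstoD(2)[OF small, of "e / 4"] e eventually_gt_at_top[of 0] by (auto intro: eventually_conj)
    then obtain N0 where N0: "\<And>N. N \<ge> N0 \<Longrightarrow> N > 0 \<and> 2 * tailC * real N powr - \<alpha> < e / 4"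
      by (auto simp: eventually_sequentially)
    have ev: "eventually (\<lambda>r. dist (g N r) (J N) < e / 4) at_top" for N
      using tendstoD[OF glim, of "e / 4"] e by simp
    have "dist (J p) (J q) < e" if "p \<ge> N0" "q \<ge> N0" for p q
    proof -
      \<comment> \<open>The distance does not involve \<open>r\<close>, which only serves to find a
        common point where \<open>g p\<close>, \<open>h\<close> and \<open>g q\<close> can be
        compared; each of the four steps from \<open>J p\<close> to \<open>J q\<close> costs less
        than \<open>e / 4\<close>.\<close>
      have "eventually (\<lambda>r. dist (J p) (J q) < e) (at_top :: real filter)"
        using err[OF conjunct1[OF N0[OF that(1)]]] err[OF conjunct1[OF N0[OF that(2)]]] ev[of p] ev[of q]
      proof eventually_elim
        case (elim r)
        then show ?case
          using conjunct2[OF N0[OF that(1)]] conjunct2[OF N0[OF that(2)]]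
            dist_triangle[of "J p" "J q" "g p r"] dist_triangle[of "g p r" "J q" "h r"] dist_triangle[of "h r" "J q" "g q r"]
          unfolding dist_commute[of "g p r" "h r"] dist_commute[of "J p" "g p r"] by linarith
      qed
      then show ?thesis by simp
    qed
    then show "\<exists>M. \<forall>m\<ge>M. \<forall>n\<ge>M. dist (J m) (J n) < e" by blast
  qed
  then have J: "J \<longlonglongrightarrow> stable_exponent \<alpha> a"
    unfolding Cauchy_convergent_iff convergent_LIMSEQ_iff
    using assms by (simp only: stable_exponent_def J_def[abs_def] if_True)
  have "(h \<longlongrightarrow> stable_exponent \<alpha> a) at_top"
  proof (rule tendstoI)
    fix e :: real assume e: "e > 0"
    have "eventually (\<lambda>N. N > 0 \<and> 2 * tailC * real N powr - \<alpha> < e / 4 \<and> dist (J N) (stable_exponent \<alpha> a) < e / 4) sequentially"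
      using order_tendstoD(2)[OF small, of "e / 4"] e eventually_gt_at_top[of 0] tendstoD[OF J, of "e/4"]
      by (auto intro: eventually_conj)
    then obtain N where N: "N > 0" "2 * tailC * real N powr - \<alpha> < e / 4" "dist (J N) (stable_exponent \<alpha> a) < e / 4"
      by (auto simp: eventually_sequentially)
    have "eventually (\<lambda>r. dist (g N r) (J N) < e / 4) at_top"
      using tendstoD[OF glim[of N], of "e/4"] e by simp
    then show "\<forall>\<^sub>F r in at_top. dist (h r) (stable_exponent \<alpha> a) < e"
      using err[OF N(1)]
    proof eventually_elim
      case (elim r)
      then show ?case
        using N dist_triangle[of "h r" "stable_exponent \<alpha> a" "g N r"] dist_triangle[of "g N r" "stable_exponent \<alpha> a" "J N"] e
        by linarith
    qed
  qed
  then show ?thesis by (simp add: h_def[abs_def])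
qed

end

section \<open>Characteristic functions and tightness\<close>

lemma LBINT_one_minus_cos:
  fixes x u :: real
  assumes "u > 0" "x \<noteq> 0"
  shows "(LBINT t:{0..u}. 1 - cos (t * x)) = u - sin (u * x) / x"
proof -
  have "(LBINT t. (1 - cos (t * x)) * indicator {0..u} t) = (u - sin (u * x) / x) - (0 - sin (0 * x) / x)"
    by (rule integral_FTC_Icc_real)
       (use assms in \<open>auto intro!: derivative_eq_intros continuous_intros simp: field_simps\<close>)
  then show ?thesis by (simp add: set_lebesgue_integral_def mult.commute)
qed

text \<open>Averaging \<open>1 - Re (char M t)\<close> over \<open>0 \<le> t \<le> u\<close> gives
  the mean of a nonnegative function of \<open>x\<close>. For \<open>x \<noteq> 0\<close> it equals
  \<open>u - sin (u * x) / x\<close>, which is at least \<open>u / 2\<close> once the modulus of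
  \<open>x\<close> reaches \<open>2 / u\<close>.\<close>

lemma tail_bound_char:
  fixes M :: "real measure" and u c :: real
  assumes "real_distribution M" and u: "u > 0"
    and c: "\<And>t. 0 \<le> t \<Longrightarrow> t \<le> u \<Longrightarrow> norm (1 - char M t) \<le> c"
  shows "measure M {x. \<bar>x\<bar> \<ge> 2 / u} \<le> 2 * c"
proof -
  interpret real_distribution M by fact
  interpret P: pair_sigma_finite M lborel ..
  define f :: "real \<Rightarrow> real \<Rightarrow> real" where "f x t = indicator {0..u} t * (1 - cos (t * x))" for x t
  have [measurable]: "case_prod f \<in> borel_measurable (M \<Otimes>\<^sub>M lborel)"
    unfolding f_def by measurable
  have fb: "\<bar>f x t\<bar> \<le> 2 * indicator {0..u} t" "0 \<le> f x t" for x t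
    using cos_ge_minus_one[of "t * x"] cos_le_one[of "t * x"] by (auto simp: f_def indicator_def abs_le_iff)
  have int: "integrable (M \<Otimes>\<^sub>M lborel) (case_prod f)"
  proof (rule integrableI_bounded_set[where A = "UNIV \<times> {0..u}" and B = 2])
    show "emeasure (M \<Otimes>\<^sub>M lborel) (UNIV \<times> {0..u}) < \<infinity>"
      using u by (simp add: lborel.emeasure_pair_measure_Times emeasure_eq_measure ennreal_mult_less_top)
    show "AE p in M \<Otimes>\<^sub>M lborel. p \<notin> UNIV \<times> {0..u} \<longrightarrow> case_prod f p = 0"
      by (intro AE_I2) (auto simp: f_def indicator_def split: if_splits)
    show "AE p in M \<Otimes>\<^sub>M lborel. p \<in> UNIV \<times> {0..u} \<longrightarrow> norm (case_prod f p) \<le> 2"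
      using order_trans[OF fb(1)] by (intro AE_I2) (auto simp: indicator_def split: if_splits)
  qed auto
  define g where "g x = (LINT t|lborel. f x t)" for x
  have g: "integrable M g"
    unfolding g_def by (rule P.integrable_fst[OF int])
  have g_nonneg: "0 \<le> g x" for x
    unfolding g_def using fb by (intro Bochner_Integration.integral_nonneg) auto
  have g_eq: "g x = u - sin (u * x) / x" if "x \<noteq> 0" for x
    using LBINT_one_minus_cos[OF u that] by (simp add: g_def f_def set_lebesgue_integral_def)
  have "u / 2 * measure M {x. \<bar>x\<bar> \<ge> 2 / u} = (\<integral>x. (u / 2) * indicator {x. \<bar>x\<bar> \<ge> 2 / u} x \<partial>M)"
    by simp
  also have "\<dots> \<le> (\<integral>x. g x \<partial>M)"
  proof (rule integral_mono[OF _ g])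
    fix x
    show "(u / 2) * indicator {x. \<bar>x\<bar> \<ge> 2 / u} x \<le> g x"
    proof (cases "\<bar>x\<bar> \<ge> 2 / u")
      case True
      then have "x \<noteq> 0" using u by auto
      have "\<bar>sin (u * x) / x\<bar> \<le> 1 / \<bar>x\<bar>"
        using \<open>x \<noteq> 0\<close> by (simp add: divide_simps)
      also have "\<dots> \<le> u / 2" using True u \<open>x \<noteq> 0\<close> by (simp add: field_simps)
      finally have "sin (u * x) / x \<le> u / 2" using abs_ge_self order_trans by blast
      then show ?thesis using g_eq[OF \<open>x \<noteq> 0\<close>] True by simp
    next
      case False
      then show ?thesis using g_nonneg[of x] by simp
    qed
  qed (auto simp: emeasure_eq_measure)
  also have "\<dots> = (LINT t|lborel. (LINT x|M. f x t))"
    unfolding g_def by (rule P.Fubini_integral[OF int, symmetric])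
  also have "\<dots> = (LINT t|lborel. indicator {0..u} t * (1 - Re (char M t)))"
  proof (rule Bochner_Integration.integral_cong[OF refl])
    fix t
    have int1: "complex_integrable M (\<lambda>x. iexp (t * x))"
      by (rule integrable_const_bound[where B = 1]) auto
    have "(LINT x|M. 1 - cos (t * x)) = (LINT x|M. Re (1 - iexp (t * x)))"
      by (simp add: Re_exp)
    also have "\<dots> = Re (LINT x|M. 1 - iexp (t * x))"
      by (intro integral_Re Bochner_Integration.integrable_diff int1) auto
    also have "(LINT x|M. 1 - iexp (t * x)) = 1 - char M t"
      using prob_space int1 unfolding char_def by (subst Bochner_Integration.integral_diff) auto
    finally show "(LINT x|M. f x t) = indicator {0..u} t * (1 - Re (char M t))"
      by (simp add: f_def)
  qed
  also have "\<dots> \<le> (LINT t|lborel. indicator {0..u} t * c)"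
  proof -
    have ind: "integrable lborel (indicator {0..u} :: real \<Rightarrow> real)"
      by (rule integrable_real_indicator) (auto simp: emeasure_lborel_Icc_eq)
    show ?thesis
  proof (rule integral_mono)
    show "integrable lborel (\<lambda>t. indicator {0..u} t * (1 - Re (char M t)))"
    proof (rule Bochner_Integration.integrable_bound)
      show "integrable lborel (\<lambda>t. indicator {0..u} t * (2 :: real))" using ind by simp
      show "AE t in lborel. norm (indicator {0..u} t * (1 - Re (char M t))) \<le> norm (indicator {0..u} t * (2 :: real))"
      proof (intro AE_I2)
        fix t
        have "\<bar>Re (char M t)\<bar> \<le> 1" using order_trans[OF abs_Re_le_cmod cmod_char_le_1] .
        then show "norm (indicator {0..u} t * (1 - Re (char M t))) \<le> norm (indicator {0..u} t * (2 :: real))"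
          by (auto simp: indicator_def)
      qed
    qed measurable
    fix t show "indicator {0..u} t * (1 - Re (char M t)) \<le> indicator {0..u} t * c"
      using c[of t] abs_Re_le_cmod[of "1 - char M t"] by (auto simp: indicator_def)
  qed (use ind in simp)
  qed
  also have "\<dots> = u * c" using u by simp
  finally show ?thesis using u by (simp add: field_simps)
qed

lemma tight_char_bound:
  fixes M :: "nat \<Rightarrow> real measure" and \<alpha> C :: real
  assumes M: "\<And>n. real_distribution (M n)" and \<alpha>: "\<alpha> > 0"
    and bound: "\<And>n t. 0 \<le> t \<Longrightarrow> t \<le> 1 \<Longrightarrow> norm (1 - char (M n) t) \<le> C * t powr \<alpha>"
  shows "tight M"
  unfolding tight_def
proof (intro conjI allI impI M)
  fix \<epsilon> :: real assume \<epsilon>: "\<epsilon> > 0"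
  have C: "C \<ge> 0" using order_trans[OF norm_ge_zero bound[of 1 0]] by simp
  \<comment> \<open>Chosen so that \<open>2 * (C * u powr \<alpha>) < \<epsilon>\<close>;
    \<open>C + 1\<close> covers the case \<open>C = 0\<close>, and the cap at 1 keeps
    \<open>u\<close> in the range of the assumed bound.\<close>
  define u where "u = min 1 ((\<epsilon> / (4 * (C + 1))) powr (1 / \<alpha>))"
  have u: "0 < u" "u \<le> 1" using \<epsilon> C by (auto simp: u_def)
  have "u powr \<alpha> \<le> ((\<epsilon> / (4 * (C + 1))) powr (1 / \<alpha>)) powr \<alpha>"
    using u \<alpha> by (intro powr_mono2) (auto simp: u_def)
  then have u\<alpha>: "u powr \<alpha> \<le> \<epsilon> / (4 * (C + 1))" using \<alpha> \<epsilon> C by (simp add: powr_powr)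
  have "2 * (C * u powr \<alpha>) \<le> 2 * (C * (\<epsilon> / (4 * (C + 1))))"
    using u\<alpha> C by (intro mult_left_mono) auto
  also have "\<dots> < \<epsilon>" using \<epsilon> C by (simp add: field_simps add_pos_nonneg)
  finally have small: "2 * (C * u powr \<alpha>) < \<epsilon>" .
  have "1 - \<epsilon> < measure (M n) {- (2 / u)<..2 / u}" for n
  proof -
    interpret real_distribution "M n" by (rule M)
    have "measure (M n) {x. \<bar>x\<bar> \<ge> 2 / u} \<le> 2 * (C * u powr \<alpha>)"
    proof (rule tail_bound_char[OF M u(1)])
      fix t assume t: "0 \<le> t" "t \<le> u"
      have "norm (1 - char (M n) t) \<le> C * t powr \<alpha>" using t u by (intro bound) auto
      also have "\<dots> \<le> C * u powr \<alpha>" using t C \<alpha> by (intro mult_left_mono powr_mono2) auto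
      finally show "norm (1 - char (M n) t) \<le> C * u powr \<alpha>" .
    qed
    moreover have "1 - measure (M n) {x. \<bar>x\<bar> \<ge> 2 / u} = measure (M n) (space (M n) - {x. \<bar>x\<bar> \<ge> 2 / u})"
      by (intro prob_compl[symmetric]) auto
    moreover have "\<dots> \<le> measure (M n) {- (2 / u)<..2 / u}"
      by (intro finite_measure_mono) auto
    ultimately show ?thesis using small by linarith
  qed
  moreover have "- (2 / u) < 2 / u" using u by simp
  ultimately show "\<exists>a b. a < b \<and> (\<forall>n. 1 - \<epsilon> < measure (M n) {a<..b})" by blast
qed

lemma char_affine:
  fixes G :: "real measure"
  assumes "sets G = sets borel"
  shows "char (distr G borel (\<lambda>x. c * x + d)) t = iexp (t * d) * char G (c * t)"
proof -
  note [measurable_cong] = assms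
  have "char (distr G borel (\<lambda>x. c * x + d)) t = (CLINT x|G. iexp (t * (c * x + d)))"
    unfolding char_def by (subst integral_distr) auto
  also have "(\<lambda>x. iexp (t * (c * x + d))) = (\<lambda>x. iexp (t * d) * iexp (c * t * x))"
    by (auto simp: fun_eq_iff algebra_simps exp_add)
  finally show ?thesis unfolding char_def by simp
qed

lemma char_sum_PiM_distr:
  assumes "prob_space D" and I: "finite I" and [measurable]: "X \<in> borel_measurable D"
  shows "char (distr (\<Pi>\<^sub>M i\<in>I. D) borel (\<lambda>y. \<Sum>i\<in>I. X (y i))) t = char (distr D borel X) t ^ card I"
proof -
  interpret prob_space D by fact
  interpret P: product_sigma_finite "\<lambda>i. D" ..
  have "char (distr (\<Pi>\<^sub>M i\<in>I. D) borel (\<lambda>y. \<Sum>i\<in>I. X (y i))) t = (CLINT y|(\<Pi>\<^sub>M i\<in>I. D). iexp (t * (\<Sum>i\<in>I. X (y i))))"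
    unfolding char_def by (subst integral_distr) auto
  also have "(\<lambda>y. iexp (t * (\<Sum>i\<in>I. X (y i)))) = (\<lambda>y. \<Prod>i\<in>I. iexp (t * X (y i)))"
    using I by (simp add: fun_eq_iff sum_distrib_left exp_sum)
  also have "(CLINT y|(\<Pi>\<^sub>M i\<in>I. D). (\<Prod>i\<in>I. iexp (t * X (y i)))) = (\<Prod>i\<in>I. (CLINT x|D. iexp (t * X x)))"
    using I by (intro P.product_integral_prod) (auto intro!: integrable_const_bound[where B = 1])
  also have "(CLINT x|D. iexp (t * X x)) = char (distr D borel X) t"
    unfolding char_def by (subst integral_distr) auto
  finally show ?thesis by simp
qed

lemma char_sum_PiM:
  fixes \<mu> :: "real measure"
  assumes "real_distribution \<mu>" "finite I"
  shows "char (distr (\<Pi>\<^sub>M i\<in>I. \<mu>) borel (\<lambda>y. \<Sum>i\<in>I. y i)) t = char \<mu> t ^ card I"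
proof -
  interpret real_distribution \<mu> by fact
  have "distr \<mu> borel (\<lambda>x. x) = \<mu>" by (rule distr_id2) simp
  then show ?thesis
    using char_sum_PiM_distr[OF prob_space_axioms assms(2), of "\<lambda>x. x"] by simp
qed

lemma normalized_sum_measurable:
  fixes \<mu> :: "real measure"
  assumes "real_distribution \<mu>"
  shows "(\<lambda>y. \<Sum>i\<in>I. y i) \<in> borel_measurable (\<Pi>\<^sub>M i\<in>I. \<mu>)"
proof -
  interpret real_distribution \<mu> by fact
  have "(\<lambda>y. y i) \<in> borel_measurable (\<Pi>\<^sub>M i\<in>I. \<mu>)" if "i \<in> I" for i
    using measurable_component_singleton[OF that, of "\<lambda>_. \<mu>"]
    by (subst (asm) measurable_cong_sets[OF refl events_eq_borel])
  then show ?thesis by measurable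
qed

lemma normalized_sum_altdef:
  assumes "real_distribution \<mu>"
  shows "normalized_sum \<mu> \<alpha> B m =
    distr (distr (\<Pi>\<^sub>M i\<in>{1..m}. \<mu>) borel (\<lambda>y. \<Sum>i\<in>{1..m}. y i)) borel
      (\<lambda>x. (1 / real m powr (1 / \<alpha>)) * x + - B m / real m powr (1 / \<alpha>))"
  unfolding normalized_sum_def
  by (subst distr_distr) (auto simp: o_def diff_divide_distrib normalized_sum_measurable[OF assms])

lemma real_distribution_normalized_sum:
  assumes "real_distribution \<mu>"
  shows "real_distribution (normalized_sum \<mu> \<alpha> B m)"
proof -
  interpret \<mu>: real_distribution \<mu> by fact
  interpret prob_space "\<Pi>\<^sub>M i\<in>{1..m}. \<mu>" by (intro prob_space_PiM \<mu>.prob_space_axioms)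
  show ?thesis unfolding normalized_sum_def
    using normalized_sum_measurable[OF assms, of "{1..m}"]
    by (intro real_distribution_distr) auto
qed

lemma char_normalized_sum:
  assumes "real_distribution \<mu>"
  shows "char (normalized_sum \<mu> \<alpha> B m) t =
    iexp (- (t * B m / real m powr (1 / \<alpha>))) * char \<mu> (t / real m powr (1 / \<alpha>)) ^ m"
  unfolding normalized_sum_altdef[OF assms]
  by (subst char_affine, simp, subst char_sum_PiM[OF assms]) auto

text \<open>Without a complex logarithm: \<open>c m\<close> and \<open>exp (w m)\<close> both lie in
  the closed unit disc (\<open>Re (w m) \<le> 0\<close> as the modulus of \<open>c m\<close> is at
  most 1), so their \<open>m\<close>-th powers differ by at most \<open>m\<close> times their
  distance, which is the modulus of \<open>m * w m * q (w m)\<close>. Here \<open>q\<close> is the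
  remainder of \<open>exp\<close> relative to \<open>w\<close>, continuous at 0 with value
  0.\<close>

lemma power_tendsto_exp:
  fixes c :: "nat \<Rightarrow> complex"
  assumes lim: "(\<lambda>m. of_nat m * (c m - 1)) \<longlonglongrightarrow> z" and c: "\<And>m. norm (c m) \<le> 1"
  shows "(\<lambda>m. c m ^ m) \<longlonglongrightarrow> exp z"
proof -
  define w where "w m = c m - 1" for m
  define q where "q w = (if w = 0 then 0 else (exp w - 1 - w) / w)" for w :: complex
  have "((\<lambda>h. (exp (0 + h) - exp 0) / h :: complex) \<longlongrightarrow> 1) (at 0)"
    using DERIV_exp[of "0::complex"] unfolding DERIV_def by simp
  then have "((\<lambda>h. (exp (0 + h) - exp 0) / h - 1 :: complex) \<longlongrightarrow> 1 - 1) (at 0)"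
    by (intro tendsto_intros)
  then have "(q \<longlongrightarrow> 0) (at 0)"
    by (rule Lim_transform_eventually[OF tendsto_eq_rhs])
       (auto simp: q_def eventually_at_filter field_simps)
  then have "isCont q 0" by (simp add: isCont_def q_def)
  moreover have "w \<longlonglongrightarrow> 0"
  proof -
    have "(\<lambda>m. inverse (of_nat m) * (of_nat m * w m)) \<longlonglongrightarrow> 0 * z"
      using lim unfolding w_def by (intro tendsto_mult lim_inverse_n) 
    moreover have "eventually (\<lambda>m. inverse (of_nat m) * (of_nat m * w m) = w m) sequentially"
      using eventually_gt_at_top[of 0] by eventually_elim (auto simp: field_simps)
    ultimately show ?thesis by (simp add: tendsto_cong)
  qed
  ultimately have "(\<lambda>m. q (w m)) \<longlonglongrightarrow> q 0" by (rule isCont_tendsto_compose)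
  then have "(\<lambda>m. (of_nat m * w m) * q (w m)) \<longlonglongrightarrow> z * 0"
    using lim unfolding w_def[symmetric] by (intro tendsto_mult) (auto simp: q_def)
  then have "(\<lambda>m. norm (of_nat m * w m * q (w m))) \<longlonglongrightarrow> 0"
    by (simp add: tendsto_norm_zero_iff)
  then have "(\<lambda>m. c m ^ m - exp (of_nat m * w m)) \<longlonglongrightarrow> 0"
  proof (rule Lim_null_comparison[rotated], intro always_eventually allI)
    fix m
    have "norm (c m ^ m - exp (w m) ^ m) \<le> real m * norm (c m - exp (w m))"
    proof (rule norm_power_diff[OF c])
      have "Re (w m) \<le> 0" using complex_Re_le_cmod[of "c m"] c[of m] by (simp add: w_def)
      then show "norm (exp (w m)) \<le> 1" by simp
    qed
    also have "c m - exp (w m) = - (w m * q (w m))"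
      by (simp add: w_def q_def)
    finally show "norm (c m ^ m - exp (of_nat m * w m)) \<le> norm (of_nat m * w m * q (w m))"
      by (simp add: norm_mult exp_of_nat_mult mult.assoc)
  qed
  moreover have "(\<lambda>m. exp (of_nat m * w m)) \<longlonglongrightarrow> exp z"
    using lim unfolding w_def by (intro tendsto_intros)
  ultimately have "(\<lambda>m. (c m ^ m - exp (of_nat m * w m)) + exp (of_nat m * w m)) \<longlonglongrightarrow> 0 + exp z"
    by (rule tendsto_add)
  then show ?thesis by simp
qed

section \<open>The stable limit law\<close>

text \<open>Expansions in \<open>1 / r\<close> with \<open>r > 0\<close> reach positive arguments
  only; the negative ones follow from the hermitian symmetry of characteristic functions, hence the
  conjugate.\<close>

definition stable_char :: "real \<Rightarrow> real \<Rightarrow> real \<Rightarrow> complex" where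
  "stable_char \<alpha> a t = (let z = exp (\<bar>t\<bar> powr \<alpha> *\<^sub>R stable_exponent \<alpha> a) in if t \<ge> 0 then z else cnj z)"

context heavy_tail
begin

definition centre :: real where "centre = (if \<alpha> > 1 then \<integral>x. x \<partial>\<mu> else 0)"

lemma char_minus: "char \<mu> (- t) = cnj (char \<mu> t)"
proof -
  have "cnj (CLINT x|\<mu>. iexp (t * x)) = (CLINT x|\<mu>. cnj (iexp (t * x)))"
    by (rule integral_bounded_linear[OF bounded_linear_cnj, symmetric]) (rule iexp_integrable, measurable)
  then show ?thesis by (simp add: char_def exp_cnj)
qed

text \<open>Here the centering is a rotation of the characteristic function rather than a subtracted
  linear term, the form it takes inside an \<open>m\<close>-th power. The two differ by a term of
  order \<open>r powr -2\<close>, negligible against \<open>r powr - \<alpha>\<close> as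
  \<open>\<alpha> < 2\<close>.\<close>

lemma char_limit:
  assumes "\<alpha> \<noteq> 1" "\<alpha> < 2"
  shows "((\<lambda>r. r powr \<alpha> *\<^sub>R (char \<mu> (1 / r) * iexp (- (centre / r)) - 1)) \<longlongrightarrow> stable_exponent \<alpha> a) at_top"
proof (cases "\<alpha> < 1")
  case True
  then show ?thesis using char_limit_uncentred by (simp add: centre_def)
next
  case False
  then have \<alpha>: "1 < \<alpha>" using assms by simp
  define z where "z r = centre / r" for r
  define h where "h r = r powr \<alpha> *\<^sub>R (char \<mu> (1 / r) - 1 - \<i> * z r)" for r
  have "(h \<longlongrightarrow> stable_exponent \<alpha> a) at_top"
    using char_limit_centred[OF \<alpha> assms(2)] \<alpha> by (simp add: h_def[abs_def] z_def centre_def)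
  moreover have z0: "(z \<longlongrightarrow> 0) at_top"
    unfolding z_def[abs_def] by (rule tendsto_divide_0[OF tendsto_const filterlim_at_top_imp_at_infinity[OF filterlim_ident]])
  ultimately have "((\<lambda>r. h r * iexp (- z r)) \<longlongrightarrow> stable_exponent \<alpha> a * iexp (- 0)) at_top"
    by (intro tendsto_intros)
  moreover have "((\<lambda>r. r powr \<alpha> *\<^sub>R ((1 + \<i> * z r) * iexp (- z r) - 1)) \<longlongrightarrow> 0) at_top"
  proof (rule Lim_null_comparison)
    show "eventually (\<lambda>r. norm (r powr \<alpha> *\<^sub>R ((1 + \<i> * z r) * iexp (- z r) - 1)) \<le> centre\<^sup>2 / 2 * r powr (\<alpha> - 2)) at_top"
      using eventually_gt_at_top[of 0]
    proof eventually_elim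
      case (elim r)
      have "(1 + \<i> * z r) * iexp (- z r) - 1 = - ((iexp (z r) - (1 + \<i> * z r)) * iexp (- z r))"
        by (simp add: algebra_simps flip: exp_add)
      then have "norm ((1 + \<i> * z r) * iexp (- z r) - 1) = norm (iexp (z r) - (1 + \<i> * z r))"
        by (simp only: norm_minus_cancel norm_mult norm_exp_i_times mult_1_right)
      also have "\<dots> \<le> (z r)\<^sup>2 / 2"
        using iexp_approx1[of "z r" 1] by (simp add: numeral_2_eq_2)
      finally have "r powr \<alpha> * norm ((1 + \<i> * z r) * iexp (- z r) - 1) \<le> r powr \<alpha> * ((z r)\<^sup>2 / 2)"
        by (intro mult_left_mono) auto
      also have "\<dots> = centre\<^sup>2 / 2 * r powr (\<alpha> - 2)"
        using elim by (simp add: z_def powr_diff powr_numeral power_divide field_simps)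
      finally show ?case by simp
    qed
    show "((\<lambda>r. centre\<^sup>2 / 2 * r powr (\<alpha> - 2)) \<longlongrightarrow> 0) at_top"
      using assms(2) by (intro tendsto_mult_right_zero tendsto_neg_powr filterlim_ident) auto
  qed
  ultimately have "((\<lambda>r. h r * iexp (- z r) + r powr \<alpha> *\<^sub>R ((1 + \<i> * z r) * iexp (- z r) - 1)) \<longlongrightarrow> stable_exponent \<alpha> a * iexp (- 0) + 0) at_top"
    by (rule tendsto_add)
  moreover have "h r * iexp (- z r) + r powr \<alpha> *\<^sub>R ((1 + \<i> * z r) * iexp (- z r) - 1) =
      r powr \<alpha> *\<^sub>R (char \<mu> (1 / r) * iexp (- z r) - 1)" for r
    by (simp add: h_def algebra_simps scaleR_conv_of_real)
  ultimately show ?thesis by (simp add: z_def)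
qed

text \<open>The sign is read off without evaluating the integral: on
  \<open>r < x \<le> r * 2\<close> the function \<open>1 - cos (x / r)\<close> is at least
  \<open>1 - cos 1\<close>, and the mass of this interval times \<open>r powr \<alpha>\<close> tends
  to \<open>a * (1 - 2 powr - \<alpha>)\<close>. The sign shows that the limit law is not a point
  mass.\<close>

lemma Re_stable_exponent:
  assumes "\<alpha> \<noteq> 1" "\<alpha> < 2"
  shows "Re (stable_exponent \<alpha> a) < 0"
proof -
  define c where "c = (1 - cos 1 :: real)"
  have c: "c > 0"
    using cos_monotone_0_pi[of 0 1] pi_gt3 by (simp add: c_def)
  \<comment> \<open>As \<open>w\<close> is real, the linear term is imaginary and drops out of the
    real part, which treats the centred and the uncentred case at once.\<close>
  have up: "Re (r powr \<alpha> *\<^sub>R (char \<mu> (1 / r) - 1 - \<i> * (w / r))) \<le> - (c * (r powr \<alpha> * T r - r powr \<alpha> * T (r * 2)))"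
    if r: "r > 0" for r w :: real
  proof -
    have int_cos: "integrable \<mu> (\<lambda>x. cos (x / r))"
      by (rule integrable_const_bound[where B = 1]) auto
    have "Re (char \<mu> (1 / r) - 1 - \<i> * (w / r)) = Re (CLINT x|\<mu>. iexp (1 / r * x)) - 1"
      by (simp add: char_def)
    also have "Re (CLINT x|\<mu>. iexp (1 / r * x)) = (\<integral>x. cos (x / r) \<partial>\<mu>)"
      by (subst integral_Re[symmetric]) (rule iexp_integrable, measurable, simp add: Re_exp)
    also have "\<dots> - 1 = - (\<integral>x. 1 - cos (x / r) \<partial>\<mu>)"
      using prob_space int_cos by (subst Bochner_Integration.integral_diff) auto
    also have "\<dots> \<le> - (\<integral>x. c * indicator {r<..r * 2} x \<partial>\<mu>)"
    proof (intro le_imp_neg_le integral_mono)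
      fix x
      show "c * indicator {r<..r * 2} x \<le> 1 - cos (x / r)"
      proof (cases "x \<in> {r<..r * 2}")
        case True
        then have "cos (x / r) \<le> cos 1"
        proof (intro cos_monotone_0_pi_le)
          have "x / r \<le> 2" using True r by (simp add: field_simps)
          then show "x / r \<le> pi" using pi_gt3 by linarith
        qed (use True r in \<open>auto simp: field_simps\<close>)
        then show ?thesis using True by (simp add: c_def)
      qed auto
    qed (use int_cos in \<open>auto simp: emeasure_eq_measure\<close>)
    also have "(\<integral>x. c * indicator {r<..r * 2} x \<partial>\<mu>) = c * measure \<mu> ({r<..} - {r * 2<..})"
    proof -
      have "{r<..r * 2} = {r<..} - {r * 2<..}" by auto
      then show ?thesis by simp
    qed
    also have "measure \<mu> ({r<..} - {r * 2<..}) = T r - T (r * 2)"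
      using r by (intro finite_measure_Diff) auto
    finally have "r powr \<alpha> * Re (char \<mu> (1 / r) - 1 - \<i> * (w / r)) \<le> r powr \<alpha> * - (c * (T r - T (r * 2)))"
      by (intro mult_left_mono) auto
    then show ?thesis by (simp add: algebra_simps)
  qed
  have "((\<lambda>r. r powr \<alpha> *\<^sub>R (char \<mu> (1 / r) - 1 - \<i> * (centre / r))) \<longlongrightarrow> stable_exponent \<alpha> a) at_top"
    using char_limit_centred char_limit_uncentred assms by (cases "\<alpha> < 1") (auto simp: centre_def)
  then have lim1: "((\<lambda>r. Re (r powr \<alpha> *\<^sub>R (char \<mu> (1 / r) - 1 - \<i> * (centre / r)))) \<longlongrightarrow> Re (stable_exponent \<alpha> a)) at_top"
    by (rule tendsto_Re)
  have lim2: "((\<lambda>r. - (c * (r powr \<alpha> * T r - r powr \<alpha> * T (r * 2)))) \<longlongrightarrow> - (c * (a - 2 powr - \<alpha> * a))) at_top"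
  proof (intro tendsto_minus tendsto_mult[OF tendsto_const] tendsto_diff tail_limit)
    have "((\<lambda>r. 2 powr - \<alpha> * ((r * 2) powr \<alpha> * T (r * 2))) \<longlongrightarrow> 2 powr - \<alpha> * a) at_top"
      by (intro tendsto_intros filterlim_compose[OF tail_limit]
            filterlim_at_top_mult_tendsto_pos[OF tendsto_const]) (auto simp: filterlim_ident)
    moreover have "eventually (\<lambda>r. 2 powr - \<alpha> * ((r * 2) powr \<alpha> * T (r * 2)) = r powr \<alpha> * T (r * 2)) at_top"
      using eventually_gt_at_top[of 0] by eventually_elim (simp add: powr_mult powr_minus)
    ultimately show "((\<lambda>r. r powr \<alpha> * T (r * 2)) \<longlongrightarrow> 2 powr - \<alpha> * a) at_top"
      by (rule Lim_transform_eventually)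
  qed
  have "Re (stable_exponent \<alpha> a) \<le> - (c * (a - 2 powr - \<alpha> * a))"
    by (rule tendsto_le[OF trivial_limit_at_top_linorder lim2 lim1])
       (rule eventually_mono[OF eventually_gt_at_top[of 0] up])
  also have "\<dots> < 0"
  proof -
    have "2 powr - \<alpha> < (1 :: real)" using \<alpha>_pos by (simp add: powr_minus field_simps)
    then show ?thesis using c a_pos by (simp add: field_simps)
  qed
  finally show ?thesis .
qed

text \<open>For \<open>u\<close> near 0 this follows from \<open>char_limit\<close>; for
  \<open>u\<close> bounded away from 0 the left side is at most 2 and \<open>u powr \<alpha>\<close>
  is bounded below. Tightness requires such a bound on a whole interval.\<close>

lemma char_bound:
  assumes "\<alpha> \<noteq> 1" "\<alpha> < 2"
  obtains C where "C \<ge> 0" "\<And>u. 0 \<le> u \<Longrightarrow> u \<le> 1 \<Longrightarrow> norm (char \<mu> u * iexp (- (centre * u)) - 1) \<le> C * u powr \<alpha>"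
proof -
  define d where "d u = norm (char \<mu> u * iexp (- (centre * u)) - 1)" for u
  define L where "L = norm (stable_exponent \<alpha> a) + 1"
  have d2: "d u \<le> 2" for u
    using norm_triangle_ineq4[of "char \<mu> u * iexp (- (centre * u))" 1] cmod_char_le_1[of u]
    by (simp add: d_def norm_mult)
  have "eventually (\<lambda>r. norm (r powr \<alpha> *\<^sub>R (char \<mu> (1 / r) * iexp (- (centre / r)) - 1)) < L) at_top"
    using tendsto_norm[OF char_limit[OF assms]] by (rule order_tendstoD) (simp add: L_def)
  then obtain R where R: "\<And>r. r \<ge> R \<Longrightarrow> norm (r powr \<alpha> *\<^sub>R (char \<mu> (1 / r) * iexp (- (centre / r)) - 1)) < L"
    by (auto simp: eventually_at_top_linorder)
  have dR: "r powr \<alpha> * d (1 / r) < L" if "r \<ge> R" for r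
    using R[OF that] by (simp add: d_def)
  define C where "C = max L (2 * max R 1 powr \<alpha>)"
  have "d u \<le> C * u powr \<alpha>" if u: "0 < u" "u \<le> 1" for u
  proof (cases "1 / u \<ge> R")
    case True
    have "(1 / u) powr \<alpha> * d u \<le> L" using dR[OF True] by simp
    then have "d u \<le> L * u powr \<alpha>" using u by (simp add: powr_divide field_simps)
    also have "\<dots> \<le> C * u powr \<alpha>" by (intro mult_right_mono) (auto simp: C_def)
    finally show ?thesis .
  next
    case False
    then have "1 \<le> R * u" using u by (simp add: field_simps)
    also have "\<dots> \<le> max R 1 * u" using u by (intro mult_right_mono) auto
    finally have "1 \<le> max R 1 * u" .
    then have "1 \<le> (max R 1 * u) powr \<alpha>" using \<alpha>_pos by (simp add: ge_one_powr_ge_zero)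
    also have "\<dots> = max R 1 powr \<alpha> * u powr \<alpha>" using u by (simp add: powr_mult)
    finally have "2 \<le> (2 * max R 1 powr \<alpha>) * u powr \<alpha>" by simp
    also have "\<dots> \<le> C * u powr \<alpha>" by (intro mult_right_mono) (auto simp: C_def)
    finally show ?thesis using d2[of u] by simp
  qed
  moreover have "d 0 \<le> C * 0 powr \<alpha>" using char_zero by (simp add: d_def)
  moreover have "C \<ge> 0" by (simp add: C_def L_def le_max_iff_disj)
  ultimately show ?thesis using that[of C] unfolding d_def by (metis order_le_less)
qed

lemma centering_eq:
  assumes "centering \<mu> \<alpha> B" "\<alpha> \<noteq> 1"
  shows "B m = real m * centre"
  using assms by (auto simp: centering_def centre_def not_less)

lemma char_normalized_sum':
  assumes "centering \<mu> \<alpha> B" "\<alpha> \<noteq> 1"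
  shows "char (normalized_sum \<mu> \<alpha> B m) t =
    (char \<mu> (t / real m powr (1 / \<alpha>)) * iexp (- (centre * (t / real m powr (1 / \<alpha>))))) ^ m"
  unfolding char_normalized_sum[OF real_distribution_axioms] centering_eq[OF assms] power_mult_distrib
  by (simp add: exp_of_nat_mult[symmetric] algebra_simps)

lemma char_normalized_sum_tendsto:
  assumes \<alpha>: "\<alpha> \<noteq> 1" "\<alpha> < 2" and B: "centering \<mu> \<alpha> B"
  shows "(\<lambda>m. char (normalized_sum \<mu> \<alpha> B m) t) \<longlonglongrightarrow> stable_char \<alpha> a t"
proof -
  have pos: "(\<lambda>m. char (normalized_sum \<mu> \<alpha> B m) t) \<longlonglongrightarrow> stable_char \<alpha> a t" if t: "t > 0" for t
  proof -
    \<comment> \<open>This choice makes \<open>1 / r m\<close> the argument of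
      \<open>char \<mu>\<close> in the normalized sum and satisfies
      \<open>t powr \<alpha> * r m powr \<alpha> = m\<close>, which turns the scale limit into a
      limit of \<open>m * (c m - 1)\<close>.\<close>
    define r where "r m = real m powr (1 / \<alpha>) / t" for m
    define c where "c m = char \<mu> (1 / r m) * iexp (- (centre / r m))" for m
    have "filterlim (\<lambda>m. real m powr (1 / \<alpha>)) at_top sequentially"
      using \<alpha>_pos by real_asymp
    then have "filterlim r at_top sequentially"
      unfolding r_def[abs_def] divide_inverse mult.commute[of _ "inverse t"] using t
      by (intro filterlim_tendsto_pos_mult_at_top[OF tendsto_const]) auto
    then have "(\<lambda>m. t powr \<alpha> *\<^sub>R (r m powr \<alpha> *\<^sub>R (c m - 1))) \<longlonglongrightarrow> t powr \<alpha> *\<^sub>R stable_exponent \<alpha> a"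
      unfolding c_def by (intro tendsto_intros filterlim_compose[OF char_limit[OF \<alpha>]])
    moreover have "t powr \<alpha> *\<^sub>R (r m powr \<alpha> *\<^sub>R (c m - 1)) = of_nat m * (c m - 1)" for m
    proof -
      have "t powr \<alpha> * r m powr \<alpha> = real m"
        using t \<alpha>_pos by (simp add: r_def powr_divide powr_powr)
      then show ?thesis by (simp add: scaleR_conv_of_real flip: of_real_mult mult.assoc)
    qed
    ultimately have "(\<lambda>m. of_nat m * (c m - 1)) \<longlonglongrightarrow> t powr \<alpha> *\<^sub>R stable_exponent \<alpha> a" by simp
    then have "(\<lambda>m. c m ^ m) \<longlonglongrightarrow> exp (t powr \<alpha> *\<^sub>R stable_exponent \<alpha> a)"
      by (rule power_tendsto_exp) (simp add: c_def norm_mult cmod_char_le_1)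
    moreover have "c m ^ m = char (normalized_sum \<mu> \<alpha> B m) t" for m
      using t unfolding char_normalized_sum'[OF B \<alpha>(1)] by (simp add: c_def r_def)
    ultimately show ?thesis using t by (simp add: stable_char_def)
  qed
  consider "t > 0" | "t = 0" | "t < 0" by linarith
  then show ?thesis
  proof cases
    case 2
    then show ?thesis
      by (simp add: char_normalized_sum'[OF B \<alpha>(1)] char_zero stable_char_def)
  next
    case 3
    have "(\<lambda>m. cnj (char (normalized_sum \<mu> \<alpha> B m) (- t))) \<longlonglongrightarrow> cnj (stable_char \<alpha> a (- t))"
      using 3 by (intro tendsto_cnj pos) auto
    moreover have "cnj (char (normalized_sum \<mu> \<alpha> B m) (- t)) = char (normalized_sum \<mu> \<alpha> B m) t" for m
      unfolding char_normalized_sum'[OF B \<alpha>(1)] using char_minus[of "t / real m powr (1 / \<alpha>)"]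
      by (simp add: exp_cnj)
    moreover have "cnj (stable_char \<alpha> a (- t)) = stable_char \<alpha> a t"
      using 3 by (simp add: stable_char_def)
    ultimately show ?thesis by simp
  qed (rule pos)
qed

text \<open>The factor \<open>m\<close> from the \<open>m\<close>-th power is absorbed by the
  normalization: \<open>m * u powr \<alpha> = t powr \<alpha>\<close>. The empty sum
  \<open>m = 0\<close> is treated apart, as its norming constant is 0.\<close>

lemma tight_normalized_sum:
  assumes \<alpha>: "\<alpha> \<noteq> 1" "\<alpha> < 2" and B: "centering \<mu> \<alpha> B"
  shows "tight (normalized_sum \<mu> \<alpha> B)"
proof -
  obtain C where C: "C \<ge> 0" "\<And>u. 0 \<le> u \<Longrightarrow> u \<le> 1 \<Longrightarrow> norm (char \<mu> u * iexp (- (centre * u)) - 1) \<le> C * u powr \<alpha>"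
    using char_bound[OF \<alpha>] by blast
  show ?thesis
  proof (rule tight_char_bound[OF real_distribution_normalized_sum[OF real_distribution_axioms] \<alpha>_pos])
    fix m t assume t: "0 \<le> t" "t \<le> (1::real)"
    define u where "u = t / real m powr (1 / \<alpha>)"
    define c where "c = char \<mu> u * iexp (- (centre * u))"
    show "norm (1 - char (normalized_sum \<mu> \<alpha> B m) t) \<le> C * t powr \<alpha>"
    proof (cases "m = 0")
      case True
      then show ?thesis using C(1) by (simp add: char_normalized_sum'[OF B \<alpha>(1)])
    next
      case False
      have "1 \<le> real m powr (1 / \<alpha>)" using False \<alpha>_pos by (intro ge_one_powr_ge_zero) auto
      then have "t \<le> real m powr (1 / \<alpha>)" using t by linarith
      then have u: "0 \<le> u" "u \<le> 1" using t False by (auto simp: u_def)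
      have "norm (1 - c ^ m) = norm (c ^ m - 1 ^ m)" by (simp add: norm_minus_commute)
      also have "\<dots> \<le> real m * norm (c - 1)"
        by (rule norm_power_diff) (auto simp: c_def norm_mult cmod_char_le_1)
      also have "\<dots> \<le> real m * (C * u powr \<alpha>)"
        unfolding c_def using C(2)[OF u] by (intro mult_left_mono) auto
      also have "\<dots> = C * t powr \<alpha>"
        using False t \<alpha>_pos by (simp add: u_def powr_divide powr_powr)
      finally show ?thesis
        unfolding char_normalized_sum'[OF B \<alpha>(1)] c_def u_def .
    qed
  qed
qed

text \<open>Pointwise limits of characteristic functions need not be characteristic functions.
  Tightness yields a weakly convergent subsequence, and its limit must have the known limit
  function.\<close>

lemma stable_char_realized:
  assumes \<alpha>: "\<alpha> \<noteq> 1" "\<alpha> < 2" and B: "centering \<mu> \<alpha> B"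
  obtains G where "real_distribution G" "\<And>t. char G t = stable_char \<alpha> a t"
proof -
  have rd: "real_distribution (normalized_sum \<mu> \<alpha> B m)" for m
    by (rule real_distribution_normalized_sum[OF real_distribution_axioms])
  obtain s G where s: "strict_mono (s :: nat \<Rightarrow> nat)" and G: "real_distribution G"
    and conv: "weak_conv_m (normalized_sum \<mu> \<alpha> B \<circ> id \<circ> s) G"
    using tight_imp_convergent_subsubsequence[OF tight_normalized_sum[OF assms], of id] by (auto simp: strict_mono_def)
  have "char G t = stable_char \<alpha> a t" for t
  proof (rule LIMSEQ_unique)
    show "(\<lambda>k. char ((normalized_sum \<mu> \<alpha> B \<circ> id \<circ> s) k) t) \<longlonglongrightarrow> char G t"
      by (rule levy_continuity1[OF _ G conv]) (simp add: rd)
    show "(\<lambda>k. char ((normalized_sum \<mu> \<alpha> B \<circ> id \<circ> s) k) t) \<longlonglongrightarrow> stable_char \<alpha> a t"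
      using LIMSEQ_subseq_LIMSEQ[OF char_normalized_sum_tendsto[OF assms, of t] s] by (simp add: o_def)
  qed
  with G show ?thesis using that by blast
qed

text \<open>By homogeneity of the exponent, the \<open>k\<close>-th power of
  \<open>stable_char\<close> at \<open>t\<close> is its value at
  \<open>k powr (1 / \<alpha>) * t\<close>, so the shift can be \<open>d = 0\<close>. A point mass
  is excluded because the modulus at 1 is below 1.\<close>

lemma stable_distributionI:
  assumes \<alpha>: "\<alpha> \<noteq> 1" "\<alpha> < 2" and G: "real_distribution G" "\<And>t. char G t = stable_char \<alpha> a t"
  shows "stable_distribution \<alpha> G"
  unfolding stable_distribution_def
proof (intro conjI allI impI)
  show "real_distribution G" by fact
  interpret G: real_distribution G by fact
  show "\<nexists>x. G = return borel x"
  proof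
    assume "\<exists>x. G = return borel x"
    then obtain x where x: "G = return borel x" by blast
    have "char G 1 = iexp x"
      unfolding x char_def by (subst integral_return) auto
    then have "norm (char G 1) = 1" by simp
    moreover have "norm (char G 1) < 1"
      using Re_stable_exponent[OF \<alpha>] by (simp add: G(2) stable_char_def)
    ultimately show False by simp
  qed
  fix k :: nat assume k: "k \<ge> 1"
  have rd1: "real_distribution (distr (\<Pi>\<^sub>M i\<in>{1..k}. G) borel (\<lambda>y. \<Sum>i\<in>{1..k}. y i))"
  proof -
    have "prob_space (\<Pi>\<^sub>M i\<in>{1..k}. G)" by (intro prob_space_PiM G.prob_space_axioms)
    then show ?thesis
      using normalized_sum_measurable[OF G(1), of "{1..k}"] by (intro prob_space.real_distribution_distr) auto
  qed
  have rd2: "real_distribution (distr G borel (\<lambda>x. real k powr (1 / \<alpha>) * x + 0))"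
    by (intro G.real_distribution_distr) auto
  have "distr (\<Pi>\<^sub>M i\<in>{1..k}. G) borel (\<lambda>y. \<Sum>i\<in>{1..k}. y i) = distr G borel (\<lambda>x. real k powr (1 / \<alpha>) * x + 0)"
  proof (rule Levy_uniqueness[OF rd1 rd2], rule ext)
    fix t
    have "char (distr (\<Pi>\<^sub>M i\<in>{1..k}. G) borel (\<lambda>y. \<Sum>i\<in>{1..k}. y i)) t = stable_char \<alpha> a t ^ k"
      by (subst char_sum_PiM[OF G(1)]) (auto simp: G(2))
    also have "\<dots> = stable_char \<alpha> a (real k powr (1 / \<alpha>) * t)"
      using k \<alpha>_pos
      by (auto simp: stable_char_def Let_def abs_mult powr_mult powr_powr zero_le_mult_iff 
          scaleR_conv_of_real mult_ac exp_cnj simp flip: exp_of_nat_mult complex_cnj_power)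
    also have "\<dots> = char (distr G borel (\<lambda>x. real k powr (1 / \<alpha>) * x + 0)) t"
      by (subst char_affine) (auto simp: G(2))
    finally show "char (distr (\<Pi>\<^sub>M i\<in>{1..k}. G) borel (\<lambda>y. \<Sum>i\<in>{1..k}. y i)) t =
      char (distr G borel (\<lambda>x. real k powr (1 / \<alpha>) * x + 0)) t" .
  qed
  then show "\<exists>d. distr (\<Pi>\<^sub>M i\<in>{1..k}. G) borel (\<lambda>y. \<Sum>i\<in>{1..k}. y i) =
      distr G borel (\<lambda>x. real k powr (1 / \<alpha>) * x + d)" by blast
qed

end

text \<open>The function \<open>stable_char\<close> does not mention the law, so one
  \<open>G\<close> serves all laws with this tail. Uniqueness in the definite description comes from
  the given \<open>\<mu>\<close>: any competitor must be the weak limit of the same normalized sums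
  of \<open>\<mu>\<close>.\<close>

theorem stable_limit_correct:
  assumes ht: "heavy_tail \<mu> \<alpha> a" and \<alpha>: "\<alpha> \<noteq> 1" "\<alpha> < 2" and B: "centering \<mu> \<alpha> B"
  shows "real_distribution (stable_limit \<alpha> a)" and "weak_conv_m (normalized_sum \<mu> \<alpha> B) (stable_limit \<alpha> a)"
proof -
  interpret heavy_tail \<mu> \<alpha> a by fact
  obtain G where G: "real_distribution G" "\<And>t. char G t = stable_char \<alpha> a t"
    using stable_char_realized[OF \<alpha> B] by blast
  have conv: "weak_conv_m (normalized_sum \<mu>' \<alpha> B') G"
    if "heavy_tail \<mu>' \<alpha> a" "centering \<mu>' \<alpha> B'" for \<mu>' B'
  proof -
    interpret m: heavy_tail \<mu>' \<alpha> a by fact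
    show ?thesis
      using m.char_normalized_sum_tendsto[OF \<alpha> that(2)]
      by (intro levy_continuity real_distribution_normalized_sum m.real_distribution_axioms G(1)) (simp add: G(2))
  qed
  have "stable_limit \<alpha> a = G"
    unfolding stable_limit_def
  proof (rule the_equality)
    show "stable_distribution \<alpha> G \<and>
     (\<forall>\<mu> B. real_distribution \<mu> \<longrightarrow> measure \<mu> {..<0} = 0 \<longrightarrow> power_tail \<mu> \<alpha> a \<longrightarrow>
        centering \<mu> \<alpha> B \<longrightarrow> weak_conv_m (normalized_sum \<mu> \<alpha> B) G)"
      using stable_distributionI[OF \<alpha> G] conv a_pos \<alpha>_pos
      by (auto simp: heavy_tail_def heavy_tail_axioms_def)
  next
    fix G' assume G': "stable_distribution \<alpha> G' \<and>
     (\<forall>\<mu> B. real_distribution \<mu> \<longrightarrow> measure \<mu> {..<0} = 0 \<longrightarrow> power_tail \<mu> \<alpha> a \<longrightarrow>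
        centering \<mu> \<alpha> B \<longrightarrow> weak_conv_m (normalized_sum \<mu> \<alpha> B) G')"
    then have rd: "real_distribution G'" by (simp add: stable_distribution_def)
    have c: "weak_conv_m (normalized_sum \<mu> \<alpha> B) G'"
      using G' real_distribution_axioms nonneg tail B by blast
    have "char G' t = char G t" for t
      using levy_continuity1[OF real_distribution_normalized_sum[OF real_distribution_axioms] rd c]
        levy_continuity1[OF real_distribution_normalized_sum[OF real_distribution_axioms] G(1) conv[OF ht B]]
      by (rule LIMSEQ_unique)
    then show "G' = G" by (intro Levy_uniqueness[OF rd G(1)]) (auto simp: fun_eq_iff)
  qed
  then show "real_distribution (stable_limit \<alpha> a)" "weak_conv_m (normalized_sum \<mu> \<alpha> B) (stable_limit \<alpha> a)"
    using G(1) conv[OF ht B] by auto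
qed

section \<open>Edge systems of two-connected graphs\<close>

lemma simple_graph_edgeD:
  assumes "simple_graph F" "g \<in> edges F"
  shows "g \<subseteq> verts F" "card g = 2" "finite g"
proof -
  have "g \<in> all_pairs (verts F)" using assms by (auto simp: simple_graph_def)
  then show "g \<subseteq> verts F" "card g = 2" by (auto simp: all_pairs_def)
  then show "finite g" using card.infinite by fastforce
qed

lemma simple_graph_edgeE:
  assumes "simple_graph F" "g \<in> edges F" "x \<in> g"
  obtains y where "g = {x, y}" "x \<noteq> y" "y \<in> verts F" "x \<in> verts F"
proof -
  obtain y where "g = {x, y}" "x \<noteq> y"
    using simple_graph_edgeD(2)[OF assms(1,2)] assms(3) by (auto simp: card_2_iff)
  then show ?thesis using that simple_graph_edgeD(1)[OF assms(1,2)] by auto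
qed

lemma finite_edges: "simple_graph F \<Longrightarrow> finite (edges F)"
  unfolding simple_graph_def by (metis finite_all_pairs finite_subset)

lemma two_connected_no_isolated:
  assumes "simple_graph F" "two_connected F" "card (verts F) \<ge> 2" "u \<in> verts F"
  obtains w where "{u, w} \<in> edges F" "w \<noteq> u" "w \<in> verts F"
proof -
  have "\<exists>v\<in>verts F. v \<noteq> u"
  proof (rule ccontr)
    assume "\<not> ?thesis"
    then have "verts F = {u}" using assms(4) by blast
    then show False using assms(3) by simp
  qed
  then obtain v where v: "v \<in> verts F" "v \<noteq> u" by blast
  then have "(u, v) \<in> {(x, y). {x, y} \<in> edges F}\<^sup>*"
    using assms unfolding two_connected_def connected_graph_def by blast
  then obtain w where w: "{u, w} \<in> edges F"
    by (cases rule: converse_rtranclE) (use v(2) in auto)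
  then have "w \<in> verts F" "w \<noteq> u" using simple_graph_edgeD[OF assms(1) w] by auto
  then show ?thesis using that w by blast
qed

text \<open>If all edges at each vertex had the same colour, the colour of \<open>e1\<close> would
  spread along a path from an endpoint of \<open>e1\<close> to one of \<open>e2\<close>.\<close>

lemma bichromatic_vertex:
  assumes F: "simple_graph F" "connected_graph F"
    and e: "e1 \<in> edges F" "e2 \<in> edges F" "col e1 \<noteq> col e2"
  obtains x y z where "{x, y} \<in> edges F" "{x, z} \<in> edges F" "col {x, y} \<noteq> col {x, z}" "x \<noteq> y" "x \<noteq> z"
proof -
  have "\<exists>x g h. g \<in> edges F \<and> h \<in> edges F \<and> x \<in> g \<and> x \<in> h \<and> col g \<noteq> col h"
  proof (rule ccontr)
    assume "\<not> ?thesis"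
    then have mono: "col g = col h" if "g \<in> edges F" "h \<in> edges F" "x \<in> g" "x \<in> h" for x g h
      using that by blast
    have "e1 \<noteq> {}" "e2 \<noteq> {}"
      using simple_graph_edgeD(2)[OF F(1) e(1)] simple_graph_edgeD(2)[OF F(1) e(2)] by auto
    then obtain u v where uv: "u \<in> e1" "v \<in> e2" by blast
    then have "u \<in> verts F" "v \<in> verts F" using simple_graph_edgeD(1) F e by blast+
    then have "(u, v) \<in> {(x, y). {x, y} \<in> edges F}\<^sup>*"
      using F(2) unfolding connected_graph_def by blast
    then have "\<forall>h\<in>edges F. v \<in> h \<longrightarrow> col h = col e1"
    proof induction
      case base
      show ?case using mono[OF _ e(1) _ uv(1)] by blast
    next
      case (step y z)
      then have yz: "{y, z} \<in> edges F" by simp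
      then have "col {y, z} = col e1" using step.IH by simp
      then show ?case using mono[OF _ yz, of _ z] by auto
    qed
    then show False using uv e by auto
  qed
  then obtain x g h where gh: "g \<in> edges F" "h \<in> edges F" "x \<in> g" "x \<in> h" "col g \<noteq> col h" by blast
  obtain y where y: "g = {x, y}" "x \<noteq> y" using simple_graph_edgeE[OF F(1) gh(1,3)] .
  obtain z where z: "h = {x, z}" "x \<noteq> z" using simple_graph_edgeE[OF F(1) gh(2,4)] .
  note y z
  then show ?thesis using that gh by blast
qed

text \<open>The edge system is indexed by the vertices: \<open>e u\<close> is the edge assigned to \<open>u\<close>, and \<open>c u\<close>
  is its colour.\<close>

definition spread :: "'v set \<Rightarrow> ('v \<Rightarrow> 'v set) \<Rightarrow> ('v \<Rightarrow> 'c) \<Rightarrow> bool" where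
  "spread V e c \<longleftrightarrow> (\<forall>j\<in>c ` V. card {u \<in> V. c u = j} < card (\<Union>u\<in>{u \<in> V. c u = j}. e u))"

text \<open>The edges \<open>{u, f u}\<close> form a spanning subgraph whose only cycle passes through a vertex
  \<open>x\<close> incident to edges \<open>{x, y}\<close>, \<open>{x, z}\<close> of two colours. Since \<open>F - x\<close> is connected,
  \<open>f\<close> can be chosen to move every vertex of \<open>F - x\<close> towards \<open>z\<close>. A colour class with as many
  edges as endpoints would be closed under \<open>f\<close> and hence contain the whole cycle.\<close>

lemma two_connected_spread:
  assumes F: "simple_graph F" "two_connected F"
    and col: "e1 \<in> edges F" "e2 \<in> edges F" "col e1 \<noteq> col e2"
  obtains e where "e \<in> verts F \<rightarrow>\<^sub>E edges F" "inj_on e (verts F)" "spread (verts F) e (\<lambda>u. col (e u))"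
    "\<exists>u\<in>verts F. \<exists>w\<in>verts F. col (e u) \<noteq> col (e w)"
proof -
  let ?V = "verts F"
  have fin: "finite ?V" using F by (simp add: simple_graph_def)
  obtain x y z where xy: "{x, y} \<in> edges F" "{x, z} \<in> edges F" "col {x, y} \<noteq> col {x, z}" "x \<noteq> y" "x \<noteq> z"
    using bichromatic_vertex[OF F(1) _ col] F(2) by (auto simp: two_connected_def)
  have V: "x \<in> ?V" "y \<in> ?V" "z \<in> ?V" using simple_graph_edgeD(1)[OF F(1)] xy by auto
  have yz: "y \<noteq> z" using xy by auto
  define R where "R = {(u, v). {u, v} \<in> edges (remove_vertex F x)}"
  have R: "(u, v) \<in> R \<longleftrightarrow> {u, v} \<in> edges F \<and> u \<noteq> x \<and> v \<noteq> x" for u v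
    by (auto simp: R_def remove_vertex_def)
  have reach: "(u, z) \<in> R\<^sup>*" if "u \<in> ?V" "u \<noteq> x" for u
    using F(2) V that xy(5) unfolding two_connected_def connected_graph_def R_def
    by (auto simp: remove_vertex_def)
  define d where "d u = (LEAST k. (u, z) \<in> R ^^ k)" for u
  have step: "\<exists>v. (u, v) \<in> R \<and> d v < d u" if "u \<in> ?V" "u \<noteq> x" "u \<noteq> z" for u
  proof -
    have "(u, z) \<in> R ^^ d u"
      unfolding d_def using rtrancl_imp_relpow[OF reach[OF that(1,2)]] by (rule LeastI_ex)
    moreover from this have "d u \<noteq> 0" using that(3) by (metis relpow_0_E)
    ultimately obtain k v where "d u = Suc k" "(u, v) \<in> R" "(v, z) \<in> R ^^ k"
      by (metis not0_implies_Suc relpow_Suc_D2)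
    moreover from this have "d v \<le> k" unfolding d_def[of v] by (intro Least_le)
    ultimately show ?thesis by auto
  qed
  \<comment> \<open>The cycle runs from \<open>x\<close> to \<open>y\<close>, then with decreasing
    distance \<open>d\<close> to \<open>z\<close>, and from \<open>z\<close> back to
    \<open>x\<close>. Its two edges at \<open>x\<close> are those of different colours.\<close>
  define f where "f u = (if u = x then y else if u = z then x else SOME v. (u, v) \<in> R \<and> d v < d u)" for u
  define e where "e = (\<lambda>u\<in>?V. {u, f u})"
  have f: "(u, f u) \<in> R" "d (f u) < d u" if "u \<in> ?V" "u \<noteq> x" "u \<noteq> z" for u
    using someI_ex[OF step[OF that]] that by (auto simp: f_def)
  have fx: "f x = y" "f z = x" using xy by (auto simp: f_def)
  have edge: "{u, f u} \<in> edges F" if "u \<in> ?V" for u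
    using f[OF that] R xy fx by (cases "u = x"; cases "u = z") (auto simp: insert_commute)
  have fV: "f u \<in> ?V" if "u \<in> ?V" for u
    using simple_graph_edgeD(1)[OF F(1) edge[OF that]] by simp
  \<comment> \<open>Only \<open>z\<close> is sent to \<open>x\<close>. Together with
    \<open>y \<noteq> z\<close> and the decrease of \<open>d\<close> this prevents \<open>f\<close>
    from swapping two vertices, so no edge is assigned twice.\<close>
  have fne: "f u \<noteq> x" if "u \<in> ?V" "u \<noteq> z" for u
    using f[OF that(1) _ that(2)] R fx xy by (cases "u = x") auto
  have inj: "inj_on e ?V"
  proof (rule inj_onI)
    fix u w assume uw: "u \<in> ?V" "w \<in> ?V" "e u = e w"
    show "u = w"
    proof (rule ccontr)
      assume "u \<noteq> w"
      then have "f u = w" "f w = u" using uw by (auto simp: e_def doubleton_eq_iff)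
      then have "u \<noteq> x" "w \<noteq> x" "u \<noteq> z" "w \<noteq> z"
        using fne[OF uw(1)] fne[OF uw(2)] fx yz xy by auto
      then have "d w < d u" "d u < d w"
        using f(2)[OF uw(1)] f(2)[OF uw(2)] \<open>f u = w\<close> \<open>f w = u\<close> by auto
      then show False by simp
    qed
  qed
  have "spread ?V e (\<lambda>u. col (e u))"
    unfolding spread_def
  proof
    fix j assume "j \<in> (\<lambda>u. col (e u)) ` ?V"
    define U where "U = {u \<in> ?V. col (e u) = j}"
    obtain u0 where u0: "u0 \<in> U" using \<open>j \<in> _\<close> by (auto simp: U_def)
    have UV: "U \<subseteq> ?V" by (auto simp: U_def)
    have sub: "U \<subseteq> (\<Union>u\<in>U. e u)" using UV by (auto simp: e_def)
    have finW: "finite (\<Union>u\<in>U. e u)"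
      using fin UV by (intro finite_UN_I) (auto simp: e_def intro: finite_subset)
    have "U \<noteq> (\<Union>u\<in>U. e u)"
    proof
      assume eq: "U = (\<Union>u\<in>U. e u)"
      have closed: "f u \<in> U" if "u \<in> U" for u
        using that UV by (subst eq) (auto simp: e_def intro!: bexI[of _ u])
      \<comment> \<open>Iterating \<open>f\<close> from a vertex other than \<open>x\<close>
        decreases \<open>d\<close>, avoids \<open>x\<close> and can only end at
        \<open>z\<close>.\<close>
      have zU: "z \<in> U" if "u \<in> U" "u \<noteq> x" for u
        using that
      proof (induction "d u" arbitrary: u rule: less_induct)
        case less
        show ?case
        proof (cases "u = z")
          case False
          then show ?thesis
            using less(1)[OF _ closed[OF less(2)]] f(2)[of u] fne[of u] less(2,3) UV by blast
        qed (use less in simp)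
      qed
      have "z \<in> U" using zU[OF u0] zU[OF closed[OF u0]] fx xy(4) by (cases "u0 = x") auto
      moreover from this have "x \<in> U" using closed[of z] fx by simp
      ultimately have "col {z, x} = col {x, y}" using fx by (auto simp: U_def e_def)
      then show False using xy(3) by (simp add: insert_commute)
    qed
    then show "card {u \<in> ?V. col (e u) = j} < card (\<Union>u\<in>{u \<in> ?V. col (e u) = j}. e u)"
      using sub finW unfolding U_def[symmetric] by (intro psubset_card_mono) auto
  qed
  moreover have "e \<in> ?V \<rightarrow>\<^sub>E edges F" using edge by (auto simp: e_def)
  moreover have "\<exists>u\<in>?V. \<exists>w\<in>?V. col (e u) \<noteq> col (e w)"
    using V xy(3) fx by (intro bexI[of _ x] bexI[of _ z]) (auto simp: e_def insert_commute)
  ultimately show ?thesis using inj that by blast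
qed

lemma two_connected_two_edges:
  assumes "simple_graph F" "two_connected F" "card (verts F) \<ge> 3"
  obtains e1 e2 where "e1 \<in> edges F" "e2 \<in> edges F" "e1 \<noteq> e2"
proof -
  have "verts F \<noteq> {}" using assms(3) by auto
  then obtain u where u: "u \<in> verts F" by blast
  obtain w where w: "{u, w} \<in> edges F" "w \<in> verts F"
    using two_connected_no_isolated[OF assms(1,2) _ u] assms(3) by (metis Suc_leD numeral_3_eq_3 numeral_2_eq_2)
  have "card {u, w} < card (verts F)" using assms(3) by (simp add: card_insert_if)
  then obtain v where v: "v \<in> verts F" "v \<notin> {u, w}"
    by (metis card_mono finite.intros(1) finite_insert not_less subsetI)
  obtain t where "{v, t} \<in> edges F"
    using two_connected_no_isolated[OF assms(1,2) _ v(1)] assms(3) by (metis Suc_leD numeral_3_eq_3 numeral_2_eq_2)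
  then show ?thesis using that w v by blast
qed

text \<open>The spread construction assigns distinct edges to the vertices; the colouring
  \<open>id\<close> is admissible because there are two edges.\<close>

lemma verts_le_edges:
  assumes "simple_graph F" "two_connected F" "card (verts F) \<ge> 3"
  shows "card (verts F) \<le> card (edges F)"
proof -
  obtain e1 e2 where e: "e1 \<in> edges F" "e2 \<in> edges F" "e1 \<noteq> e2" using two_connected_two_edges[OF assms] .
  obtain f where "f \<in> verts F \<rightarrow>\<^sub>E edges F" "inj_on f (verts F)"
    using two_connected_spread[OF assms(1,2) e(1,2), of id] e(3) by auto
  then show ?thesis using finite_edges[OF assms(1)] by (intro card_inj_on_le[of f]) auto
qed

lemma edges_pos:
  assumes "simple_graph F" "two_connected F" "card (verts F) \<ge> 3"
  shows "card (edges F) \<ge> 3" "edges F \<noteq> {}"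
  using verts_le_edges[OF assms] assms(3) by auto

section \<open>Copies in a union of graphs\<close>

lemma spread_cong:
  assumes "\<And>u. u \<in> V \<Longrightarrow> c u = c' u"
  shows "spread V e c \<longleftrightarrow> spread V e c'"
proof -
  have "{u \<in> V. c u = j} = {u \<in> V. c' u = j}" for j using assms by auto
  moreover have "c ` V = c' ` V" using assms by (intro image_cong) auto
  ultimately show ?thesis by (simp add: spread_def)
qed

lemma spread_if:
  assumes "spread V e (\<lambda>u. P u)" "i \<noteq> j"
  shows "spread V e (\<lambda>u. if P u then i else j)"
proof -
  have "\<And>k. {u \<in> V. (if P u then i else j) = k} = (if k = i then {u \<in> V. P u = True} else if k = j then {u \<in> V. P u = False} else {})"
    using assms(2) by auto
  then show ?thesis using assms unfolding spread_def by (auto simp: image_iff)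
qed

locale two_connected_graph =
  fixes F :: "'v graph"
  assumes simple: "simple_graph F" and two_conn: "two_connected F" and card3: "card (verts F) \<ge> 3"
begin

abbreviation V :: "'v set" where "V \<equiv> verts F"
abbreviation E :: "'v set set" where "E \<equiv> edges F"

lemma finV [simp]: "finite V" using simple by (simp add: simple_graph_def)
lemma finE [simp]: "finite E" using simple by (rule finite_edges)

lemma V_eq_Union_E: "V = \<Union>E"
proof
  show "V \<subseteq> \<Union>E"
  proof
    fix u assume u: "u \<in> V"
    obtain w where "{u, w} \<in> E"
      using two_connected_no_isolated[OF simple two_conn _ u] card3 by (metis Suc_leD numeral_3_eq_3 numeral_2_eq_2)
    then show "u \<in> \<Union>E" by blast
  qed
  show "\<Union>E \<subseteq> V" using simple_graph_edgeD(1)[OF simple] by blast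
qed

definition embeddings :: "'w set \<Rightarrow> ('v \<Rightarrow> 'w) set" where
  "embeddings S = {f \<in> V \<rightarrow>\<^sub>E S. inj_on f V}"

definition embedded :: "('v \<Rightarrow> 'w) \<Rightarrow> 'w graph" where
  "embedded f = (f ` V, (`) f ` E)"

definition copies_in :: "'w set \<Rightarrow> 'w graph set" where
  "copies_in S = {H. subgraph H (S, all_pairs S) \<and> graph_iso F H}"

lemma finite_embeddings [simp]: "finite S \<Longrightarrow> finite (embeddings S)"
  unfolding embeddings_def by (rule finite_subset[of _ "V \<rightarrow>\<^sub>E S"]) (auto intro: finite_PiE)

lemma card_edge_image: "g \<in> E \<Longrightarrow> inj_on f V \<Longrightarrow> card (f ` g) = 2"
  using simple_graph_edgeD[OF simple] by (metis card_image inj_on_subset)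

lemma copies_in_eq: "copies_in S = embedded ` embeddings S" if [simp]: "finite S"
proof (intro set_eqI iffI)
  fix H assume "H \<in> copies_in S"
  then obtain f where f: "bij_betw f V (verts H)" "edges H = (`) f ` E" "verts H \<subseteq> S"
    by (auto simp: copies_in_def graph_iso_def subgraph_def)
  have im: "restrict f V ` g = f ` g" if "g \<in> E" for g
    using simple_graph_edgeD(1)[OF simple that] by (intro image_cong) auto
  have "restrict f V \<in> embeddings S"
    using f by (auto simp: embeddings_def bij_betw_def)
  moreover have "embedded (restrict f V) = H"
    using f im by (auto simp: embedded_def bij_betw_def prod_eq_iff image_iff)
  ultimately show "H \<in> embedded ` embeddings S" by blast
next
  fix H assume "H \<in> embedded ` embeddings S"
  then obtain f where f: "f \<in> V \<rightarrow>\<^sub>E S" "inj_on f V" and H: "H = embedded f"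
    by (auto simp: embeddings_def)
  have pair: "f ` g \<in> all_pairs (f ` V)" if "g \<in> E" for g
    using card_edge_image[OF that f(2)] simple_graph_edgeD(1)[OF simple that] by (auto simp: all_pairs_def)
  moreover have "all_pairs (f ` V) \<subseteq> all_pairs S" using f by (auto simp: all_pairs_def)
  ultimately show "H \<in> copies_in S"
    using f unfolding H copies_in_def subgraph_def simple_graph_def graph_iso_def embedded_def
    by (auto intro!: exI[of _ f] simp: bij_betw_def)
qed

lemma finite_copies_in [simp]: "finite S \<Longrightarrow> finite (copies_in S)"
  by (simp add: copies_in_eq)

text \<open>Containment of a copy reduces to containment of its edges, since \<open>F\<close> has no
  isolated vertex and the vertices of a copy are the union of its edges. The count thus depends on
  the edge set only, as required for unions of edge sets.\<close>

lemma num_copies_eq: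
  assumes "finite S" "verts G \<subseteq> S" "edges G \<subseteq> all_pairs (verts G)"
  shows "num_copies F G = card {H \<in> copies_in S. edges H \<subseteq> edges G}"
proof -
  have "{H. subgraph H G \<and> graph_iso F H} = {H \<in> copies_in S. edges H \<subseteq> edges G}"
  proof (intro set_eqI iffI)
    fix H assume H: "H \<in> {H. subgraph H G \<and> graph_iso F H}"
    then have "edges H \<subseteq> all_pairs S"
      using assms by (fastforce simp: subgraph_def all_pairs_def)
    then show "H \<in> {H \<in> copies_in S. edges H \<subseteq> edges G}"
      using H assms(2) by (auto simp: copies_in_def subgraph_def)
  next
    fix H assume "H \<in> {H \<in> copies_in S. edges H \<subseteq> edges G}"
    then have H: "H \<in> copies_in S" "edges H \<subseteq> edges G" by auto
    then obtain f where "H = embedded f" using copies_in_eq[OF assms(1)] by blast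
    then have "verts H = \<Union>(edges H)"
      by (simp add: embedded_def) (subst V_eq_Union_E, auto)
    also have "\<dots> \<subseteq> verts G" using H(2) assms(3) by (fastforce simp: all_pairs_def)
    finally show "H \<in> {H. subgraph H G \<and> graph_iso F H}"
      using H by (auto simp: copies_in_def subgraph_def)
  qed
  then show ?thesis by (simp add: num_copies_def)
qed

lemma num_copies_eq_sum:
  assumes "finite S" "verts G \<subseteq> S" "edges G \<subseteq> all_pairs (verts G)"
  shows "real (num_copies F G) = (\<Sum>H\<in>copies_in S. of_bool (edges H \<subseteq> edges G))"
  using assms by (simp add: num_copies_eq[OF assms] sum.If_cases of_bool_def Int_def)

text \<open>Witnesses for a union bound. They are indexed by the vertices, so the class sizes of
  \<open>c\<close> add up to the number of vertices; injectivity of \<open>e\<close> makes the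
  chosen edges distinct, so each costs its own factor of the density.\<close>

definition spread_systems :: "'i set \<Rightarrow> (('v \<Rightarrow> 'v set) \<times> ('v \<Rightarrow> 'i)) set" where
  "spread_systems I = {(e, c). e \<in> V \<rightarrow>\<^sub>E E \<and> inj_on e V \<and> c \<in> V \<rightarrow>\<^sub>E I \<and> spread V e c}"

definition spread_hits :: "('i \<Rightarrow> 'w set set) \<Rightarrow> 'i set \<Rightarrow> ('v \<Rightarrow> 'w) \<Rightarrow> (('v \<Rightarrow> 'v set) \<times> ('v \<Rightarrow> 'i)) set" where
  "spread_hits C I f = {(e, c) \<in> spread_systems I. \<forall>u\<in>V. f ` e u \<in> C (c u)}"

lemma finite_spread_systems [simp]:
  assumes "finite I"
  shows "finite (spread_systems I)"
  by (rule finite_subset[of _ "(V \<rightarrow>\<^sub>E E) \<times> (V \<rightarrow>\<^sub>E I)"])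
     (auto simp: spread_systems_def assms intro!: finite_PiE)

lemma finite_spread_hits [simp]: "finite I \<Longrightarrow> finite (spread_hits C I f)"
  by (rule finite_subset[of _ "spread_systems I"]) (auto simp: spread_hits_def)

text \<open>Each edge is coloured by some index whose set contains its image; two colours occur
  because no single set contains all images.\<close>

lemma spread_hits_nonempty:
  assumes cov: "(`) f ` E \<subseteq> (\<Union>i\<in>I. C i)" and no: "\<And>i. i \<in> I \<Longrightarrow> \<not> (`) f ` E \<subseteq> C i"
  shows "spread_hits C I f \<noteq> {}"
proof -
  define col where "col g = (SOME i. i \<in> I \<and> f ` g \<in> C i)" for g
  have col: "col g \<in> I" "f ` g \<in> C (col g)" if "g \<in> E" for g
  proof -
    have "\<exists>i. i \<in> I \<and> f ` g \<in> C i" using cov that by blast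
    from someI_ex[OF this] show "col g \<in> I" "f ` g \<in> C (col g)" by (auto simp: col_def)
  qed
  obtain e1 where e1: "e1 \<in> E" using edges_pos(2)[OF simple two_conn card3] by blast
  have "\<exists>e2\<in>E. col e2 \<noteq> col e1"
  proof (rule ccontr)
    assume "\<not> ?thesis"
    then have "(`) f ` E \<subseteq> C (col e1)" using col(2) by (metis image_subsetI)
    then show False using no col(1)[OF e1] by blast
  qed
  then obtain e2 where "e2 \<in> E" "col e1 \<noteq> col e2" by metis
  note e2 = this
  obtain e where e: "e \<in> V \<rightarrow>\<^sub>E E" "inj_on e V" "spread V e (\<lambda>u. col (e u))"
    by (rule two_connected_spread[of F e1 e2 col, OF simple two_conn e1 e2])
  define c where "c = (\<lambda>u\<in>V. col (e u))"
  have "spread V e c" using e(3) by (subst spread_cong[of V c "\<lambda>u. col (e u)"]) (auto simp: c_def)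
  moreover have "c \<in> V \<rightarrow>\<^sub>E I" using col(1) e(1) by (auto simp: c_def)
  moreover have "\<forall>u\<in>V. f ` e u \<in> C (c u)" using col(2) e(1) by (auto simp: c_def)
  ultimately have "(e, c) \<in> spread_hits C I f" using e by (simp add: spread_hits_def spread_systems_def)
  then show ?thesis by blast
qed

text \<open>Fix one index \<open>i0\<close> whose set contains the copy. For every other such index
  \<open>i\<close>, one edge \<open>e1\<close> gets colour \<open>i0\<close> and the rest colour
  \<open>i\<close>. A single system \<open>e\<close> is spread for this two-colouring whatever
  \<open>i\<close> is, and distinct \<open>i\<close> give distinct colourings since the colour
  \<open>i\<close> occurs.\<close>

lemma spread_hits_overlaps:
  assumes "finite I"
  shows "card {i \<in> I. (`) f ` E \<subseteq> C i} \<le> Suc (card (spread_hits C I f))"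
proof (cases "{i \<in> I. (`) f ` E \<subseteq> C i} = {}")
  case False
  define R where "R = {i \<in> I. (`) f ` E \<subseteq> C i}"
  obtain i0 where i0: "i0 \<in> R" using False by (auto simp: R_def)
  obtain e1 e2 where e12: "e1 \<in> E" "e2 \<in> E" "e1 \<noteq> e2" using two_connected_two_edges[OF simple two_conn card3] .
  have neq: "(e1 = e1) \<noteq> (e2 = e1)" using e12(3) by simp
  obtain e
    where e: "e \<in> V \<rightarrow>\<^sub>E E" "inj_on e V" "spread V e (\<lambda>u. e u = e1)"
      and ex: "\<exists>u\<in>V. \<exists>w\<in>V. (e u = e1) \<noteq> (e w = e1)"
    by (rule two_connected_spread[OF simple two_conn e12(1,2), of "\<lambda>g. g = e1", OF neq])
  define c where "c i = (\<lambda>u\<in>V. if e u = e1 then i0 else i)" for i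
  have "(e, c i) \<in> spread_hits C I f" if i: "i \<in> R - {i0}" for i
  proof -
    have "spread V e (c i)"
      using spread_if[OF e(3), of i0 i] i by (subst spread_cong[of V "c i" "\<lambda>u. if e u = e1 then i0 else i"]) (auto simp: c_def)
    moreover have "c i \<in> V \<rightarrow>\<^sub>E I" using i i0 by (auto simp: c_def R_def)
    moreover have "\<forall>u\<in>V. f ` e u \<in> C (c i u)" using i i0 e(1) by (auto simp: c_def R_def)
    ultimately show ?thesis using e by (simp add: spread_hits_def spread_systems_def)
  qed
  then have "(\<lambda>i. (e, c i)) ` (R - {i0}) \<subseteq> spread_hits C I f" by blast
  moreover have "inj_on (\<lambda>i. (e, c i)) (R - {i0})"
  proof (rule inj_onI)
    fix i j assume "(e, c i) = (e, c j)"
    then have "c i = c j" by simp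
    obtain w where "w \<in> V" "e w \<noteq> e1" using ex by blast
    then show "i = j" using fun_cong[OF \<open>c i = c j\<close>, of w] by (simp add: c_def)
  qed
  ultimately have "card (R - {i0}) \<le> card (spread_hits C I f)"
    using assms by (intro card_inj_on_le[of "\<lambda>i. (e, c i)"]) auto
  then show ?thesis using i0 assms unfolding R_def[symmetric] by (simp add: R_def card_Diff_singleton)
next
  case True
  show ?thesis unfolding True by simp
qed

text \<open>A copy contained in no single \<open>C i\<close> is witnessed by at least one spread system, a copy
  contained in \<open>r\<close> of them by at least \<open>r - 1\<close>.\<close>

lemma spread_hits_bound:
  assumes "finite I"
  shows "\<bar>of_bool ((`) f ` E \<subseteq> (\<Union>i\<in>I. C i)) - (\<Sum>i\<in>I. of_bool ((`) f ` E \<subseteq> C i))\<bar> \<le> real (card (spread_hits C I f))"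
proof -
  define R where "R = {i \<in> I. (`) f ` E \<subseteq> C i}"
  have R: "(\<Sum>i\<in>I. of_bool ((`) f ` E \<subseteq> C i)) = real (card R)"
    using assms by (simp add: R_def of_bool_def sum.If_cases Int_def)
  show ?thesis
  proof (cases "R = {}")
    case True
    show ?thesis
    proof (cases "(`) f ` E \<subseteq> (\<Union>i\<in>I. C i)")
      case t: True
      have "spread_hits C I f \<noteq> {}" using True by (intro spread_hits_nonempty[OF t]) (auto simp: R_def)
      then have "card (spread_hits C I f) \<ge> 1" using assms by (simp add: Suc_le_eq card_gt_0_iff)
      then show ?thesis using t True R by simp
    qed (use True R in auto)
  next
    case False
    then obtain i where "i \<in> I" "(`) f ` E \<subseteq> C i" by (auto simp: R_def)
    then have t: "(`) f ` E \<subseteq> (\<Union>i\<in>I. C i)" by blast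
    have "card R \<ge> 1" using False assms by (simp add: R_def Suc_le_eq card_gt_0_iff)
    then show ?thesis using spread_hits_overlaps[OF assms, of f C] t R by (simp add: R_def)
  qed
qed

text \<open>Each copy is charged to one chosen embedding; enlarging the sum to all embeddings adds
  only nonnegative terms and leaves a sum that is easy to average.\<close>

lemma num_copies_union:
  fixes C :: "'i \<Rightarrow> 'w graph"
  assumes S: "finite S" and I: "finite I"
    and C: "\<And>i. i \<in> I \<Longrightarrow> verts (C i) \<subseteq> S" "\<And>i. i \<in> I \<Longrightarrow> edges (C i) \<subseteq> all_pairs (verts (C i))"
  shows "\<bar>real (num_copies F (S, \<Union>i\<in>I. edges (C i))) - (\<Sum>i\<in>I. real (num_copies F (C i)))\<bar>
     \<le> (\<Sum>f\<in>embeddings S. real (card (spread_hits (\<lambda>i. edges (C i)) I f)))"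
proof -
  define h where "h f = real (card (spread_hits (\<lambda>i. edges (C i)) I f))" for f
  define g where "g H = (SOME f. f \<in> embeddings S \<and> embedded f = H)" for H
  have g: "g H \<in> embeddings S" "embedded (g H) = H" if "H \<in> copies_in S" for H
  proof -
    have "\<exists>f. f \<in> embeddings S \<and> embedded f = H"
      using that unfolding copies_in_eq[OF S] by blast
    from someI_ex[OF this] show "g H \<in> embeddings S" "embedded (g H) = H" by (auto simp: g_def)
  qed
  have inj: "inj_on g (copies_in S)"
    by (rule inj_on_inverseI[where g = embedded]) (rule g(2))
  have "real (num_copies F (S, \<Union>i\<in>I. edges (C i))) - (\<Sum>i\<in>I. real (num_copies F (C i))) =
    (\<Sum>H\<in>copies_in S. of_bool (edges H \<subseteq> (\<Union>i\<in>I. edges (C i))) - (\<Sum>i\<in>I. of_bool (edges H \<subseteq> edges (C i))))"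
  proof -
    have "real (num_copies F (S, \<Union>i\<in>I. edges (C i))) = (\<Sum>H\<in>copies_in S. of_bool (edges H \<subseteq> (\<Union>i\<in>I. edges (C i))))"
    proof (subst num_copies_eq_sum[OF S])
      show "edges (S, \<Union>i\<in>I. edges (C i)) \<subseteq> all_pairs (verts (S, \<Union>i\<in>I. edges (C i)))"
        using C by (fastforce simp: all_pairs_def)
    qed auto
    moreover have "(\<Sum>i\<in>I. real (num_copies F (C i))) = (\<Sum>i\<in>I. \<Sum>H\<in>copies_in S. of_bool (edges H \<subseteq> edges (C i)))"
      using C by (intro sum.cong refl num_copies_eq_sum[OF S]) auto
    moreover have "\<dots> = (\<Sum>H\<in>copies_in S. \<Sum>i\<in>I. of_bool (edges H \<subseteq> edges (C i)))"
      by (rule sum.swap)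
    ultimately show ?thesis by (simp only: sum_subtractf)
  qed
  also have "\<bar>\<dots>\<bar> \<le> (\<Sum>H\<in>copies_in S. h (g H))"
  proof (rule order_trans[OF sum_abs sum_mono])
    fix H assume "H \<in> copies_in S"
    then have "edges H = (`) (g H) ` E" using g(2) by (metis embedded_def snd_conv)
    then show "\<bar>of_bool (edges H \<subseteq> (\<Union>i\<in>I. edges (C i))) - (\<Sum>i\<in>I. of_bool (edges H \<subseteq> edges (C i)))\<bar> \<le> h (g H)"
      using spread_hits_bound[OF I, of "g H" "\<lambda>i. edges (C i)"] by (simp add: h_def)
  qed
  also have "\<dots> = (\<Sum>f\<in>g ` copies_in S. h f)"
    by (simp add: sum.reindex[OF inj])
  also have "\<dots> \<le> (\<Sum>f\<in>embeddings S. h f)"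
    using g(1) S by (intro sum_mono2) (auto simp: h_def)
  finally show ?thesis by (simp add: h_def)
qed

end

section \<open>Edge probabilities\<close>

lemma all_pairs_mono: "A \<subseteq> B \<Longrightarrow> all_pairs A \<subseteq> all_pairs B"
  by (auto simp: all_pairs_def)

text \<open>Cleared of denominators: the proportion of \<open>x\<close>-subsets of an
  \<open>n\<close>-set that contain \<open>w\<close> given points is the product of
  \<open>(x - i) / (n - i)\<close> over \<open>i < w\<close>, and each factor is at most
  \<open>x / n\<close> as \<open>x \<le> n\<close>.\<close>

lemma binomial_ratio_bound:
  fixes n x w :: nat
  assumes "w \<le> x" "x \<le> n"
  shows "((n - w) choose (x - w)) * n ^ w \<le> (n choose x) * x ^ w"
  using assms(1)
proof (induction w)
  case (Suc w)
  define k where "k = n - Suc w"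
  define l where "l = x - Suc w"
  have kl: "n - w = Suc k" "x - w = Suc l" using Suc.prems assms(2) by (auto simp: k_def l_def)
  have abs: "Suc k * (k choose l) = (Suc k choose Suc l) * Suc l"
    by (rule Suc_times_binomial_eq)
  have le: "Suc l * n \<le> x * Suc k"
  proof -
    have n: "n = Suc k + w" and x: "x = Suc l + w" using kl Suc.prems assms(2) by auto
    have "l \<le> k" using n x assms(2) by simp
    then have "Suc l * w \<le> w * Suc k" by (simp add: mult.commute)
    then show ?thesis by (subst n, subst x) (simp add: algebra_simps)
  qed
  have IH: "(Suc k choose Suc l) * n ^ w \<le> (n choose x) * x ^ w"
    using Suc.IH Suc.prems by (simp only: kl)
  have "Suc k * ((k choose l) * n ^ Suc w) = ((Suc k choose Suc l) * n ^ w) * (Suc l * n)"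
    by (simp only: mult.assoc[symmetric] abs power_Suc) (simp only: mult_ac)
  also have "\<dots> \<le> ((n choose x) * x ^ w) * (x * Suc k)"
    by (rule mult_le_mono[OF IH le])
  also have "\<dots> = Suc k * ((n choose x) * x ^ Suc w)" by (simp only: power_Suc mult_ac)
  finally have "(k choose l) * n ^ Suc w \<le> (n choose x) * x ^ Suc w"
    using mult_le_cancel1[of "Suc k"] by simp
  then show ?case by (simp add: k_def l_def)
qed simp

lemma card_supersets:
  assumes "finite A" "W \<subseteq> A" "card W \<le> x"
  shows "card {S. W \<subseteq> S \<and> S \<subseteq> A \<and> card S = x} = (card A - card W) choose (x - card W)"
proof -
  have finW: "finite W" using assms finite_subset by blast
  have "bij_betw (\<lambda>S. S \<union> W) {B. B \<subseteq> A - W \<and> card B = x - card W} {S. W \<subseteq> S \<and> S \<subseteq> A \<and> card S = x}"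
  proof (rule bij_betw_byWitness[where f' = "\<lambda>S. S - W"])
    show "(\<lambda>S. S \<union> W) ` {B. B \<subseteq> A - W \<and> card B = x - card W} \<subseteq> {S. W \<subseteq> S \<and> S \<subseteq> A \<and> card S = x}"
    proof safe
      fix B assume "B \<subseteq> A - W" "card B = x - card W"
      then show "card (B \<union> W) = x"
        using assms finW finite_subset[of B A] by (subst card_Un_disjoint) auto
    qed (use assms in auto)
    show "(\<lambda>S. S - W) ` {S. W \<subseteq> S \<and> S \<subseteq> A \<and> card S = x} \<subseteq> {B. B \<subseteq> A - W \<and> card B = x - card W}"
      using finW by (auto simp: card_Diff_subset)
  qed auto
  then have "card {S. W \<subseteq> S \<and> S \<subseteq> A \<and> card S = x} = card {B. B \<subseteq> A - W \<and> card B = x - card W}"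
    by (simp add: bij_betw_same_card)
  also have "\<dots> = (card A - card W) choose (x - card W)"
    using assms finW by (simp add: n_subsets card_Diff_subset)
  finally show ?thesis .
qed

lemma prob_bernoulli_graph_edges:
  assumes S: "finite S" and q: "0 \<le> q" "q \<le> 1" and T: "T \<subseteq> all_pairs S"
  shows "measure (measure_pmf (bernoulli_graph S q)) {G. T \<subseteq> edges G} = q ^ card T"
proof -
  let ?P = "Pi_pmf (all_pairs S) False (\<lambda>_. bernoulli_pmf q)"
  have fin: "finite (all_pairs S)" using S by (rule finite_all_pairs)
  have "measure (measure_pmf (bernoulli_graph S q)) {G. T \<subseteq> edges G}
      = measure ?P {f. T \<subseteq> {e \<in> all_pairs S. f e}}"
    by (simp add: bernoulli_graph_def vimage_def)
  also have "{f. T \<subseteq> {e \<in> all_pairs S. f e}} = Pi (all_pairs S) (\<lambda>e. if e \<in> T then {True} else UNIV)"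
    using T by (auto simp: Pi_def)
  also have "measure ?P \<dots> = (\<Prod>e\<in>all_pairs S. if e \<in> T then q else 1)"
    using q by (subst measure_Pi_pmf_Pi[OF fin]) (intro prod.cong, auto simp: measure_pmf_single)
  also have "\<dots> = q ^ card T"
    using fin T by (simp add: prod.If_cases Int_absorb1)
  finally show ?thesis .
qed

lemma prob_bernoulli_graph_edges_le:
  assumes S: "finite S" and q: "0 \<le> q" "q \<le> 1" and T: "\<And>g. g \<in> T \<Longrightarrow> card g = 2"
  shows "measure (measure_pmf (bernoulli_graph S q)) {G. T \<subseteq> edges G} \<le> (if \<Union>T \<subseteq> S then q ^ card T else 0)"
proof (cases "\<Union>T \<subseteq> S")
  case True
  then have "T \<subseteq> all_pairs S" using T by (auto simp: all_pairs_def)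
  then show ?thesis using prob_bernoulli_graph_edges[OF S q] True by simp
next
  case False
  then have "\<not> T \<subseteq> all_pairs S" by (auto simp: all_pairs_def)
  have "\<not> T \<subseteq> edges G" if "G \<in> set_pmf (bernoulli_graph S q)" for G
  proof
    assume "T \<subseteq> edges G"
    moreover have "edges G \<subseteq> all_pairs S" using subsetD[OF set_bernoulli_graph[OF S] that] by auto
    ultimately show False using \<open>\<not> T \<subseteq> all_pairs S\<close> by blast
  qed
  then have "measure (measure_pmf (bernoulli_graph S q)) {G. T \<subseteq> edges G} = 0"
    by (subst measure_pmf_zero_iff) auto
  then show ?thesis using False by simp
qed

lemma expectation_community:
  fixes h :: "nat graph \<Rightarrow> real"
  assumes "x \<le> n"
  shows "measure_pmf.expectation (community n (x, q)) h =
    (\<Sum>S | S \<subseteq> {1..n} \<and> card S = x. measure_pmf.expectation (bernoulli_graph S q) h) / real (n choose x)"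
proof -
  let ?A = "{S. S \<subseteq> {1..n} \<and> card S = x}"
  have A: "finite ?A" "?A \<noteq> {}" "card ?A = n choose x"
    using finite_nonempty_sizes[of n x] assms n_subsets[of "{1..n}" x] by (auto simp: min_def)
  have "measure_pmf.expectation (community n (x, q)) h =
      measure_pmf.expectation (pmf_of_set ?A \<bind> (\<lambda>S. bernoulli_graph S q)) h"
    using assms by (simp add: community_def min_def)
  also have "\<dots> = (\<Sum>S\<in>?A. pmf (pmf_of_set ?A) S *\<^sub>R measure_pmf.expectation (bernoulli_graph S q) h)"
  proof (rule pmf_expectation_bind[OF A(1)])
    show "finite (set_pmf (bernoulli_graph S q))" if "S \<in> ?A" for S
    proof (rule finite_subset[OF set_bernoulli_graph])
      show "finite S" using that finite_subset by auto
      then show "finite ({S} \<times> Pow (all_pairs S))" by (simp add: finite_all_pairs)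
    qed
  qed (use A in auto)
  also have "\<dots> = (\<Sum>S\<in>?A. measure_pmf.expectation (bernoulli_graph S q) h) / real (n choose x)"
    using A by (simp add: sum_divide_distrib)
  finally show ?thesis .
qed

text \<open>The community must contain all endpoints, after which the edges are independent. If
  there are more endpoints than \<open>x\<close>, the binomial bound does not apply, but the event
  is impossible.\<close>

lemma prob_community_edges_le:
  assumes x: "x \<le> n" "n > 0" and q: "0 \<le> q" "q \<le> 1"
    and T: "\<And>g. g \<in> T \<Longrightarrow> card g = 2" "\<Union>T \<subseteq> {1..n}"
  shows "measure (measure_pmf (community n (x, q))) {G. T \<subseteq> edges G} \<le> (real x / real n) ^ card (\<Union>T) * q ^ card T"
proof -
  let ?A = "{S. S \<subseteq> {1..n} \<and> card S = x}"
  let ?w = "card (\<Union>T)"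
  have finA: "finite ?A" by simp
  have "measure (measure_pmf (community n (x, q))) {G. T \<subseteq> edges G} =
     measure_pmf.expectation (community n (x, q)) (indicator {G. T \<subseteq> edges G})"
    by simp
  also have "\<dots> = (\<Sum>S\<in>?A. measure (measure_pmf (bernoulli_graph S q)) {G. T \<subseteq> edges G}) / real (n choose x)"
    by (subst expectation_community[OF x(1)]) simp
  also have "\<dots> \<le> (\<Sum>S\<in>?A. if \<Union>T \<subseteq> S then q ^ card T else 0) / real (n choose x)"
    by (intro divide_right_mono sum_mono prob_bernoulli_graph_edges_le q T) (auto intro: finite_subset)
  also have "\<dots> = real (card {S. \<Union>T \<subseteq> S \<and> S \<subseteq> {1..n} \<and> card S = x}) * q ^ card T / real (n choose x)"
  proof -
    have "{S \<in> ?A. \<Union>T \<subseteq> S} = {S. \<Union>T \<subseteq> S \<and> S \<subseteq> {1..n} \<and> card S = x}" by auto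
    then show ?thesis using finA by (simp add: sum.If_cases Int_def)
  qed
  also have "\<dots> \<le> (real x / real n) ^ ?w * q ^ card T"
  proof (cases "?w \<le> x")
    case True
    have "real (((n - ?w) choose (x - ?w)) * n ^ ?w) \<le> real ((n choose x) * x ^ ?w)"
      using binomial_ratio_bound[OF True x(1)] of_nat_le_iff by blast
    then have "real ((n - ?w) choose (x - ?w)) / real (n choose x) \<le> (real x / real n) ^ ?w"
      using x by (simp add: power_divide field_simps)
    then have "real ((n - ?w) choose (x - ?w)) / real (n choose x) * q ^ card T \<le> (real x / real n) ^ ?w * q ^ card T"
      using q by (intro mult_right_mono) auto
    then show ?thesis using card_supersets[OF _ T(2) True] by simp
  next
    case False
    have "{S. \<Union>T \<subseteq> S \<and> S \<subseteq> {1..n} \<and> card S = x} = {}"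
    proof (rule ccontr)
      assume "\<not> ?thesis"
      then obtain S where S: "\<Union>T \<subseteq> S" "S \<subseteq> {1..n}" "card S = x" by blast
      then have "?w \<le> card S" by (intro card_mono) (auto intro: finite_subset)
      then show False using S False by simp
    qed
    then show ?thesis using q by (simp only: card.empty of_nat_0 mult_zero_left div_0) simp
  qed
  finally show ?thesis .
qed

context two_connected_graph
begin

definition class_size :: "('v \<Rightarrow> 'i) \<Rightarrow> 'i \<Rightarrow> nat" where
  "class_size c j = card {u \<in> V. c u = j}"

text \<open>The exponent \<open>Suc (class_size c j)\<close> is the number of endpoints guaranteed
  by spreading. It may replace the actual number because \<open>x / n \<le> 1\<close>, and it makes
  the bound independent of the edges \<open>e\<close>.\<close>

definition spread_prob :: "nat \<Rightarrow> (nat \<Rightarrow> nat \<times> real) \<Rightarrow> ('v \<Rightarrow> nat) \<Rightarrow> real" where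
  "spread_prob n \<omega> c =
     (\<Prod>j\<in>c ` V. (real (fst (\<omega> j)) / real n) ^ Suc (class_size c j) * snd (\<omega> j) ^ class_size c j)"

definition mean_copies :: "nat \<times> real \<Rightarrow> real" where "mean_copies w = Nstar F (fst w) (snd w)"

text \<open>The communities are independent, so the event splits over the colours. Injectivity of
  \<open>e\<close> and \<open>f\<close> ensures that a class of \<open>s\<close> vertices asks for
  exactly \<open>s\<close> distinct edges.\<close>

lemma prob_spread_hit_le:
  fixes \<omega> :: "nat \<Rightarrow> nat \<times> real"
  assumes I: "finite I" and n: "n > 0"
    and \<omega>: "\<And>i. i \<in> I \<Longrightarrow> fst (\<omega> i) \<le> n \<and> 0 \<le> snd (\<omega> i) \<and> snd (\<omega> i) \<le> 1"
    and ec: "(e, c) \<in> spread_systems I" and f: "f \<in> embeddings {1..n}"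
  shows "measure (measure_pmf (Pi_pmf I d (\<lambda>i. community n (\<omega> i)))) {C. \<forall>u\<in>V. f ` e u \<in> edges (C (c u))}
     \<le> spread_prob n \<omega> c"
proof -
  define U where "U j = {u \<in> V. c u = j}" for j
  define T where "T j = (\<lambda>u. f ` e u) ` U j" for j
  have e: "e u \<in> E" if "u \<in> V" for u using ec that by (auto simp: spread_systems_def)
  have eV: "e u \<subseteq> V" if "u \<in> V" for u using simple_graph_edgeD(1)[OF simple e[OF that]] .
  have cI: "c ` V \<subseteq> I" using ec by (auto simp: spread_systems_def)
  have finj: "inj_on f V" "f ` V \<subseteq> {1..n}" using f by (auto simp: embeddings_def)
  have "{C. \<forall>u\<in>V. f ` e u \<in> edges (C (c u))} = Pi I (\<lambda>j. {G. T j \<subseteq> edges G})"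
    using cI by (fastforce simp: Pi_def T_def U_def)
  then have "measure (measure_pmf (Pi_pmf I d (\<lambda>i. community n (\<omega> i)))) {C. \<forall>u\<in>V. f ` e u \<in> edges (C (c u))}
      = (\<Prod>j\<in>I. measure (measure_pmf (community n (\<omega> j))) {G. T j \<subseteq> edges G})"
    using measure_Pi_pmf_Pi[OF I] by simp
  also have "\<dots> = (\<Prod>j\<in>c ` V. measure (measure_pmf (community n (\<omega> j))) {G. T j \<subseteq> edges G})"
  proof (rule prod.mono_neutral_right[OF I cI], rule ballI)
    fix j assume "j \<in> I - c ` V"
    then have "T j = {}" by (auto simp: T_def U_def)
    then show "measure (measure_pmf (community n (\<omega> j))) {G. T j \<subseteq> edges G} = 1" by simp
  qed
  also have "\<dots> \<le> (\<Prod>j\<in>c ` V. (real (fst (\<omega> j)) / real n) ^ Suc (card (U j)) * snd (\<omega> j) ^ card (U j))"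
  proof (rule prod_mono, intro conjI)
    fix j assume j: "j \<in> c ` V"
    obtain x q where xq: "\<omega> j = (x, q)" by fastforce
    have \<omega>j: "x \<le> n" "0 \<le> q" "q \<le> 1" using \<omega>[of j] j cI xq by auto
    have "inj_on (\<lambda>u. f ` e u) (U j)"
    proof (rule inj_onI)
      fix u w assume uw: "u \<in> U j" "w \<in> U j" "f ` e u = f ` e w"
      then have "e u = e w" using inj_on_image_eq_iff[OF finj(1)] eV by (auto simp: U_def)
      then show "u = w" using ec uw by (auto simp: spread_systems_def U_def inj_on_def)
    qed
    then have cT: "card (T j) = card (U j)" by (simp add: T_def card_image)
    have "\<Union>(T j) = f ` (\<Union>u\<in>U j. e u)" by (auto simp: T_def)
    moreover have "inj_on f (\<Union>u\<in>U j. e u)" using eV by (intro inj_on_subset[OF finj(1)]) (auto simp: U_def)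
    ultimately have "card (\<Union>(T j)) = card (\<Union>u\<in>U j. e u)" by (simp add: card_image)
    then have cUT: "Suc (card (U j)) \<le> card (\<Union>(T j))"
      using ec j by (auto simp: spread_systems_def spread_def U_def)
    have "measure (measure_pmf (community n (\<omega> j))) {G. T j \<subseteq> edges G} \<le> (real x / real n) ^ card (\<Union>(T j)) * q ^ card (T j)"
      unfolding xq
    proof (rule prob_community_edges_le[OF \<omega>j(1) n \<omega>j(2,3)])
      show "card g = 2" if "g \<in> T j" for g
        using that card_edge_image[OF e finj(1)] by (auto simp: T_def U_def)
      show "\<Union>(T j) \<subseteq> {1..n}" using eV finj(2) by (fastforce simp: T_def U_def)
    qed
    also have "\<dots> \<le> (real x / real n) ^ Suc (card (U j)) * q ^ card (U j)"
      using \<omega>j n cUT unfolding cT by (intro mult_right_mono power_decreasing) auto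
    finally show "measure (measure_pmf (community n (\<omega> j))) {G. T j \<subseteq> edges G}
        \<le> (real (fst (\<omega> j)) / real n) ^ Suc (card (U j)) * snd (\<omega> j) ^ card (U j)"
      by (simp add: xq)
  qed simp
  finally show ?thesis by (simp add: U_def spread_prob_def class_size_def)
qed

end

section \<open>Moments of the number of copies\<close>

context two_connected_graph
begin

lemma verts_copy: "H \<in> copies_in S \<Longrightarrow> finite S \<Longrightarrow> card (verts H) = card V"
  by (auto simp: copies_in_eq embedded_def embeddings_def card_image)

lemma edges_copy:
  assumes "H \<in> copies_in S" "finite S"
  shows "card (edges H) = card E" "finite (edges H)" "edges H \<subseteq> all_pairs S"
proof -
  obtain f where f: "f \<in> embeddings S" "H = embedded f"
    using assms by (auto simp: copies_in_eq)
  have "inj_on ((`) f) E"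
    using f simple_graph_edgeD(1)[OF simple]
    by (intro inj_on_image[THEN inj_on_subset, of f E] ) (auto simp: embeddings_def V_eq_Union_E[symmetric])
  then show "card (edges H) = card E" using f by (simp add: embedded_def card_image)
  show "finite (edges H)" using f by (simp add: embedded_def)
  show "edges H \<subseteq> all_pairs S" using assms by (simp add: copies_in_def subgraph_def)
qed

lemma card_copies_le:
  assumes g: "inj_on g A" "g ` A \<subseteq> B" and fin: "finite A" "finite B"
  shows "card (copies_in A) \<le> card (copies_in B)"
proof (rule card_inj_on_le)
  let ?h = "\<lambda>H. (g ` verts H, (`) g ` edges H)"
  have sub: "verts H \<subseteq> A" "edges H \<subseteq> Pow A" if "H \<in> copies_in A" for H
    using that by (auto simp: copies_in_def subgraph_def all_pairs_def)
  show "inj_on ?h (copies_in A)"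
  proof (rule inj_onI)
    fix H H' assume H: "H \<in> copies_in A" "H' \<in> copies_in A" "?h H = ?h H'"
    have "verts H = verts H'"
      using inj_on_image_eq_iff[OF g(1) sub(1)[OF H(1)] sub(1)[OF H(2)]] H(3) by simp
    moreover have "inj_on ((`) g) (Pow A)" using g(1) by (rule inj_on_image_Pow)
    from inj_on_image_eq_iff[OF this sub(2)[OF H(1)] sub(2)[OF H(2)]] have "edges H = edges H'"
      using H(3) by simp
    ultimately show "H = H'" by (simp add: prod_eq_iff)
  qed
  show "?h ` copies_in A \<subseteq> copies_in B"
  proof
    fix K assume "K \<in> ?h ` copies_in A"
    then obtain H where H: "H \<in> copies_in A" "K = ?h H" by blast
    then obtain f where f: "f \<in> embeddings A" "H = embedded f" using copies_in_eq[OF fin(1)] by blast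
    have fA: "f ` V \<subseteq> A" "inj_on f V" using f(1) by (auto simp: embeddings_def)
    define f' where "f' = (\<lambda>u\<in>V. g (f u))"
    have "inj_on (g \<circ> f) V" by (rule comp_inj_on[OF fA(2) inj_on_subset[OF g(1) fA(1)]])
    then have "inj_on f' V" by (subst inj_on_cong[of V f' "g \<circ> f"]) (simp_all add: f'_def)
    moreover have "f' \<in> V \<rightarrow>\<^sub>E B" using fA g(2) by (auto simp: f'_def)
    ultimately have "f' \<in> embeddings B" by (simp add: embeddings_def)
    moreover have "K = embedded f'"
    proof -
      have im: "g ` f ` U = f' ` U" if "U \<subseteq> V" for U
        unfolding image_image using that by (intro image_cong) (auto simp: f'_def)
      have "(`) g ` (`) f ` E = (`) f' ` E"
        unfolding image_image[of "(`) g"] using simple_graph_edgeD(1)[OF simple] by (intro image_cong im refl)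
      then show ?thesis using H f im[of V] by (simp add: embedded_def)
    qed
    ultimately show "K \<in> copies_in B" using copies_in_eq[OF fin(2)] by blast
  qed
qed (use fin in simp)

lemma card_copies_cong:
  assumes "card A = card B" "finite A" "finite B"
  shows "card (copies_in A) = card (copies_in B)"
proof -
  obtain g where g: "bij_betw g A B" using assms finite_same_card_bij by blast
  show ?thesis
    using card_copies_le[of g A B] card_copies_le[of "inv_into A g" B A] g bij_betw_inv_into[OF g] assms
    by (simp add: bij_betw_def le_antisym)
qed

definition base_copies :: nat where
  "base_copies = num_copies F (complete_graph (card V))"

lemma num_copies_complete: "num_copies F (complete_graph x) = card (copies_in {1..x})"
  unfolding complete_graph_def by (subst num_copies_eq[of "{1..x}"]) (auto simp: copies_in_def subgraph_def intro!: arg_cong[where f = card])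

lemma base_copies_pos: "base_copies \<ge> 1"
proof -
  obtain g where g: "bij_betw g V {1..card V}"
    using finite_same_card_bij[of V "{1..card V}"] by auto
  then have "restrict g V \<in> embeddings {1..card V}"
    by (auto simp: embeddings_def bij_betw_def inj_on_def)
  then have "copies_in {1..card V} \<noteq> {}" using copies_in_eq[of "{1..card V}"] by auto
  then show ?thesis by (simp add: base_copies_def num_copies_complete Suc_le_eq card_gt_0_iff)
qed

lemma card_copies_in:
  assumes S: "finite S"
  shows "card (copies_in S) = base_copies * (card S choose card V)"
proof -
  let ?W = "{W. W \<subseteq> S \<and> card W = card V}"
  have fW: "finite W" if "W \<in> ?W" for W using that S finite_subset by auto
  have v: "verts H = W" if "H \<in> copies_in W" "W \<in> ?W" for H W
    using verts_copy[OF that(1) fW[OF that(2)]] that fW[OF that(2)]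
    by (intro card_subset_eq) (auto simp: copies_in_def subgraph_def)
  have "copies_in S = (\<Union>W\<in>?W. copies_in W)"
  proof (intro equalityI subsetI)
    fix H assume H: "H \<in> copies_in S"
    then have "verts H \<in> ?W" using verts_copy[OF H S] by (auto simp: copies_in_def subgraph_def)
    moreover have "H \<in> copies_in (verts H)"
      using H by (auto simp: copies_in_def subgraph_def simple_graph_def)
    ultimately show "H \<in> (\<Union>W\<in>?W. copies_in W)" by blast
  next
    fix H assume "H \<in> (\<Union>W\<in>?W. copies_in W)"
    then show "H \<in> copies_in S"
      using all_pairs_mono by (fastforce simp: copies_in_def subgraph_def)
  qed
  moreover have "card (\<Union>W\<in>?W. copies_in W) = (\<Sum>W\<in>?W. card (copies_in W))"
  proof (rule card_UN_disjoint)
    show "\<forall>A\<in>?W. \<forall>B\<in>?W. A \<noteq> B \<longrightarrow> copies_in A \<inter> copies_in B = {}" using v by blast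
    show "finite ?W" using S by simp
    show "\<forall>A\<in>?W. finite (copies_in A)" using fW by simp
  qed
  moreover have "(\<Sum>W\<in>?W. card (copies_in W)) = (\<Sum>W\<in>?W. base_copies)"
  proof (rule sum.cong[OF refl])
    fix W assume W: "W \<in> ?W"
    then have "card W = card {1..card V}" by simp
    from card_copies_cong[OF this fW[OF W]] show "card (copies_in W) = base_copies"
      by (simp add: base_copies_def num_copies_complete)
  qed
  ultimately have "card (copies_in S) = (\<Sum>W\<in>?W. base_copies)" by (simp only:)
  then show ?thesis using n_subsets[OF S, of "card V"] by simp
qed

lemma Nstar_eq: "card S = x \<Longrightarrow> finite S \<Longrightarrow> Nstar F x q = real (card (copies_in S)) * q ^ card E"
  by (simp add: card_copies_in Nstar_def base_copies_def)

lemma num_copies_bernoulli: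
  assumes "finite S" "G \<in> set_pmf (bernoulli_graph S q)"
  shows "real (num_copies F G) = (\<Sum>H\<in>copies_in S. indicator {G. edges H \<subseteq> edges G} G)"
proof -
  have "G \<in> {S} \<times> Pow (all_pairs S)" using set_bernoulli_graph[OF assms(1)] assms(2) by blast
  then show ?thesis
    using assms(1) by (subst num_copies_eq_sum[of S]) (auto simp: indicator_def intro!: sum.cong)
qed

lemma integrable_bernoulli_graph:
  fixes h :: "'w graph \<Rightarrow> real"
  shows "finite S \<Longrightarrow> integrable (measure_pmf (bernoulli_graph S q)) h"
  by (intro integrable_measure_pmf_finite finite_subset[OF set_bernoulli_graph]) (auto simp: finite_all_pairs)

lemma expectation_num_copies_bernoulli:
  assumes S: "finite S" and q: "0 \<le> q" "q \<le> 1"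
  shows "measure_pmf.expectation (bernoulli_graph S q) (\<lambda>G. real (num_copies F G)) = real (card (copies_in S)) * q ^ card E"
proof -
  have "measure_pmf.expectation (bernoulli_graph S q) (\<lambda>G. real (num_copies F G)) =
      measure_pmf.expectation (bernoulli_graph S q) (\<lambda>G. \<Sum>H\<in>copies_in S. indicator {G. edges H \<subseteq> edges G} G)"
    using num_copies_bernoulli[OF S] by (intro integral_cong_AE) (auto simp: AE_measure_pmf_iff)
  also have "\<dots> = (\<Sum>H\<in>copies_in S. measure (measure_pmf (bernoulli_graph S q)) {G. edges H \<subseteq> edges G})"
    using S by (subst Bochner_Integration.integral_sum) (auto intro: integrable_bernoulli_graph)
  also have "\<dots> = (\<Sum>H\<in>copies_in S. q ^ card E)"
  proof (intro sum.cong refl)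
    fix H assume H: "H \<in> copies_in S"
    show "measure (measure_pmf (bernoulli_graph S q)) {G. edges H \<subseteq> edges G} = q ^ card E"
      using prob_bernoulli_graph_edges[OF S q edges_copy(3)[OF H S]] edges_copy(1)[OF H S] by simp
  qed
  finally show ?thesis by simp
qed

text \<open>Expanding the square gives all pairs of copies. For edge-disjoint pairs the covariance
  vanishes; for the others the product of the means is dropped, being nonnegative.\<close>

lemma variance_num_copies_bernoulli:
  assumes S: "finite S" and q: "0 \<le> q" "q \<le> 1"
  shows "measure_pmf.expectation (bernoulli_graph S q) (\<lambda>G. (real (num_copies F G) - real (card (copies_in S)) * q ^ card E)\<^sup>2)
     \<le> (\<Sum>H\<in>copies_in S. \<Sum>K\<in>copies_in S. if edges H \<inter> edges K = {} then 0 else q ^ card (edges H \<union> edges K))"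
proof -
  let ?B = "measure_pmf (bernoulli_graph S q)"
  let ?N = "\<lambda>G. real (num_copies F G)"
  define mm where "mm = real (card (copies_in S)) * q ^ card E"
  note int = integrable_bernoulli_graph[OF S, of q]
  have "(\<integral>G. (?N G)\<^sup>2 \<partial>?B) = (\<integral>G. (\<Sum>H\<in>copies_in S. \<Sum>K\<in>copies_in S. indicator {G. edges H \<union> edges K \<subseteq> edges G} G) \<partial>?B)"
  proof (intro integral_cong_AE)
    show "AE G in ?B. (?N G)\<^sup>2 = (\<Sum>H\<in>copies_in S. \<Sum>K\<in>copies_in S. indicator {G. edges H \<union> edges K \<subseteq> edges G} G)"
      unfolding AE_measure_pmf_iff
    proof
      fix G assume G: "G \<in> set_pmf (bernoulli_graph S q)"
      show "(?N G)\<^sup>2 = (\<Sum>H\<in>copies_in S. \<Sum>K\<in>copies_in S. indicator {G. edges H \<union> edges K \<subseteq> edges G} G)"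
        unfolding num_copies_bernoulli[OF S G] power2_eq_square sum_product
        by (intro sum.cong refl) (auto simp: indicator_def)
    qed
  qed auto
  also have "\<dots> = (\<Sum>H\<in>copies_in S. \<Sum>K\<in>copies_in S. measure ?B {G. edges H \<union> edges K \<subseteq> edges G})"
    by (subst Bochner_Integration.integral_sum[OF int], rule sum.cong[OF refl],
        subst Bochner_Integration.integral_sum[OF int]) simp
  also have "\<dots> = (\<Sum>H\<in>copies_in S. \<Sum>K\<in>copies_in S. q ^ card (edges H \<union> edges K))"
    using edges_copy(3)[OF _ S] by (intro sum.cong refl prob_bernoulli_graph_edges[OF S q] Un_least)
  finally have second: "(\<integral>G. (?N G)\<^sup>2 \<partial>?B) = (\<Sum>H\<in>copies_in S. \<Sum>K\<in>copies_in S. q ^ card (edges H \<union> edges K))" .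
  have "(\<integral>G. (?N G - mm)\<^sup>2 \<partial>?B) = (\<integral>G. (?N G)\<^sup>2 - 2 * mm * ?N G + mm\<^sup>2 \<partial>?B)"
    by (intro Bochner_Integration.integral_cong refl) (simp add: power2_eq_square algebra_simps)
  also have "\<dots> = (\<integral>G. (?N G)\<^sup>2 \<partial>?B) - 2 * mm * (\<integral>G. ?N G \<partial>?B) + mm\<^sup>2"
    using int by simp
  also have "(\<integral>G. ?N G \<partial>?B) = mm" unfolding mm_def by (rule expectation_num_copies_bernoulli[OF S q])
  also have "(\<integral>G. (?N G)\<^sup>2 \<partial>?B) - 2 * mm * mm + mm\<^sup>2 = (\<Sum>H\<in>copies_in S. \<Sum>K\<in>copies_in S. q ^ card (edges H \<union> edges K)) - mm\<^sup>2"
    unfolding second by (simp add: power2_eq_square)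
  also have "mm\<^sup>2 = (\<Sum>H\<in>copies_in S. \<Sum>K\<in>copies_in S. q ^ (card E + card E))"
    by (simp add: mm_def power2_eq_square power_add)
  also have "(\<Sum>H\<in>copies_in S. \<Sum>K\<in>copies_in S. q ^ card (edges H \<union> edges K)) - (\<Sum>H\<in>copies_in S. \<Sum>K\<in>copies_in S. q ^ (card E + card E))
    = (\<Sum>H\<in>copies_in S. \<Sum>K\<in>copies_in S. q ^ card (edges H \<union> edges K) - q ^ (card E + card E))"
    by (simp only: sum_subtractf)
  also have "\<dots> \<le> (\<Sum>H\<in>copies_in S. \<Sum>K\<in>copies_in S. if edges H \<inter> edges K = {} then 0 else q ^ card (edges H \<union> edges K))"
  proof (intro sum_mono)
    fix H K assume HK: "H \<in> copies_in S" "K \<in> copies_in S"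
    have "card (edges H \<union> edges K) = card E + card E" if "edges H \<inter> edges K = {}"
      using card_Un_disjoint[OF edges_copy(2)[OF HK(1) S] edges_copy(2)[OF HK(2) S] that]
        edges_copy(1)[OF HK(1) S] edges_copy(1)[OF HK(2) S] by simp
    then show "q ^ card (edges H \<union> edges K) - q ^ (card E + card E)
      \<le> (if edges H \<inter> edges K = {} then 0 else q ^ card (edges H \<union> edges K))"
      using q by simp
  qed
  finally show ?thesis unfolding mm_def .
qed

end

section \<open>Variance of the number of copies of a balanced graph\<close>

locale balanced_graph = two_connected_graph F for F :: "'v graph" +
  assumes bal: "balanced F"
begin

lemma balanced_subgraph:
  assumes H: "subgraph H F" "card (edges H) \<ge> 1"
  shows "card (edges H) * card V \<le> card E * card (verts H)"
proof -
  let ?R = "{real (card (edges H)) / real (card (verts H)) | H. subgraph H F \<and> card (edges H) \<ge> 1}"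
  have "?R \<subseteq> (\<lambda>H. real (card (edges H)) / real (card (verts H))) ` (Pow V \<times> Pow E)"
  proof -
    have "H \<in> Pow V \<times> Pow E" if "subgraph H F" for H
      using that by (cases H) (auto simp: subgraph_def)
    then show ?thesis by blast
  qed
  then have fin: "finite ?R" by (rule finite_subset) simp
  have "real (card (edges H)) / real (card (verts H)) \<in> ?R" using H by blast
  then have "real (card (edges H)) / real (card (verts H)) \<le> real (card E) / real (card V)"
    using bal fin unfolding balanced_def by simp
  moreover have "card (verts H) > 0"
  proof -
    obtain g where g: "g \<in> edges H" using H(2) by fastforce
    have "simple_graph H" using H(1) by (simp add: subgraph_def)
    then have "g \<subseteq> verts H" "g \<noteq> {}" "finite (verts H)"
      using simple_graph_edgeD[OF _ g] by (auto simp: simple_graph_def)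
    then show ?thesis by (auto simp: card_gt_0_iff)
  qed
  moreover have "card V > 0" using card3 by simp
  ultimately have "real (card (edges H) * card V) \<le> real (card E * card (verts H))"
    by (simp add: divide_simps mult_ac)
  then show ?thesis by (simp only: of_nat_le_iff)
qed

text \<open>Pulled back along \<open>f'\<close>, the common edges form a subgraph of
  \<open>F\<close> on the vertices that \<open>f'\<close> sends into the first copy. Balancedness
  bounds its edge density by that of \<open>F\<close>.\<close>

lemma overlap_bound:
  assumes f: "f \<in> embeddings S" "f' \<in> embeddings S" and S: "finite S"
    and k: "k = card (edges (embedded f) \<inter> edges (embedded f'))" "k \<ge> 1"
  shows "k * card V \<le> card E * card {u \<in> V. f' u \<in> f ` V}"
proof -
  define H where "H = ({u \<in> V. f' u \<in> f ` V}, {g \<in> E. f' ` g \<in> (`) f ` E})"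
  have inj: "inj_on f' V" using f by (auto simp: embeddings_def)
  have injE: "inj_on ((`) f') E"
    by (rule inj_on_subset[OF inj_on_image_Pow[OF inj]]) (use simple_graph_edgeD(1)[OF simple] in blast)
  have "edges (embedded f) \<inter> edges (embedded f') = (`) f' ` edges H"
    unfolding embedded_def H_def snd_conv by blast
  moreover have "inj_on ((`) f') (edges H)" by (rule inj_on_subset[OF injE]) (auto simp: H_def)
  ultimately have kH: "k = card (edges H)" using k(1) by (simp add: card_image)
  have "g \<in> all_pairs (verts H)" if g: "g \<in> edges H" for g
  proof -
    have gE: "g \<in> E" "f' ` g \<in> (`) f ` E" using g by (auto simp: H_def)
    then obtain h where "h \<in> E" "f' ` g = f ` h" by blast
    then have "f' ` g \<subseteq> f ` V" using simple_graph_edgeD(1)[OF simple] by blast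
    then show ?thesis
      using simple_graph_edgeD(1,2)[OF simple gE(1)] by (auto simp: all_pairs_def H_def)
  qed
  then have "subgraph H F"
    by (auto simp: subgraph_def simple_graph_def H_def)
  from balanced_subgraph[OF this] show ?thesis using kH k(2) by (simp add: H_def)
qed

text \<open>With \<open>t = k / e\<close> the left side is
  \<open>x powr (v * t) * \<Phi> powr (2 - t)\<close>, where \<open>\<Phi> = x ^ v * q ^ e\<close>.
  The third condition on \<open>k\<close> says \<open>v * t \<le> w\<close>. Since
  \<open>k \<ge> 1\<close>, \<open>t\<close> is at least \<open>1 / e\<close>, so
  \<open>\<Phi> powr (2 - t)\<close> is at most \<open>\<Phi> powr (2 - 1 / e)\<close> for
  \<open>\<Phi> \<ge> 1\<close> and at most 1 otherwise. This is the origin of the exponent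
  \<open>2 - 1 / e\<close>.\<close>

lemma pair_term_bound:
  fixes x q :: real and k w :: nat
  assumes x: "x \<ge> 1" and q: "0 < q" "q \<le> 1" and k: "1 \<le> k" "k \<le> card E" "k * card V \<le> card E * w"
  shows "x ^ (2 * card V) * q ^ (2 * card E - k) \<le> x ^ w * (1 + (x ^ card V * q ^ card E) powr (2 - 1 / card E))"
proof -
  define v where "v = real (card V)"
  define e where "e = real (card E)"
  define t where "t = k / e"
  define \<Phi> where "\<Phi> = x ^ card V * q ^ card E"
  have e: "e > 0" using edges_pos(1)[OF simple two_conn card3] by (simp add: e_def)
  have t: "1 / e \<le> t" "t \<le> 1" using k e by (auto simp: t_def e_def field_simps)
  have "real k * v \<le> e * real w" using k(3) unfolding v_def e_def by (simp only: of_nat_mult[symmetric] of_nat_le_iff)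
  then have vt: "v * t \<le> w" using e by (simp add: t_def field_simps)
  have \<Phi>: "\<Phi> > 0" using x q by (simp add: \<Phi>_def)
  have \<Phi>': "\<Phi> = x powr v * q powr e" using x q by (simp add: \<Phi>_def v_def e_def powr_realpow)
  have "x ^ (2 * card V) = x powr (2 * v)" using x by (simp add: v_def powr_realpow[symmetric])
  also have "\<dots> = x powr (v * (2 - t)) * x powr (v * t)" by (simp add: powr_add[symmetric] algebra_simps)
  also have "\<dots> \<le> x powr (v * (2 - t)) * x powr w"
    using x vt by (intro mult_left_mono powr_mono) auto
  also have "\<dots> = x powr (v * (2 - t)) * x ^ w" using x by (simp add: powr_realpow)
  finally have 1: "x ^ (2 * card V) \<le> x powr (v * (2 - t)) * x ^ w" .
  have "q ^ (2 * card E - k) = q powr (2 * e - k)"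
    using q k(2) by (simp add: e_def powr_realpow[symmetric] of_nat_diff)
  also have "2 * e - k = e * (2 - t)" using e by (simp add: t_def algebra_simps)
  finally have 2: "q ^ (2 * card E - k) = q powr (e * (2 - t))" .
  have "x ^ (2 * card V) * q ^ (2 * card E - k) \<le> (x powr (v * (2 - t)) * x ^ w) * q powr (e * (2 - t))"
    unfolding 2 by (intro mult_right_mono 1) auto
  also have "\<dots> = x ^ w * \<Phi> powr (2 - t)"
    using x q by (simp add: \<Phi>' powr_mult powr_powr mult_ac)
  also have "\<Phi> powr (2 - t) \<le> 1 + \<Phi> powr (2 - 1 / e)"
  proof (cases "\<Phi> \<ge> 1")
    case True
    then have "\<Phi> powr (2 - t) \<le> \<Phi> powr (2 - 1 / e)" using t by (intro powr_mono) auto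
    then show ?thesis by simp
  next
    case False
    then have "\<Phi> powr (2 - t) \<le> 1 powr (2 - t)" using \<Phi> t by (intro powr_mono2) auto
    then show ?thesis by (simp add: add_increasing2)
  qed
  finally show ?thesis using x by (simp add: \<Phi>_def e_def mult_left_mono)
qed

text \<open>Dropping injectivity of \<open>f'\<close> makes the weight a product over the vertices
  of \<open>F\<close>. Each factor sums to at most \<open>(v + 1) * x\<close>: the \<open>v\<close>
  points of the first copy contribute \<open>x\<close> each, the at most \<open>x\<close> others
  contribute 1 each.\<close>

lemma sum_overlap_weights:
  assumes S: "finite S" "card S = x" and f: "f \<in> embeddings S"
  shows "(\<Sum>f'\<in>embeddings S. real x ^ card {u \<in> V. f' u \<in> f ` V}) \<le> ((real (card V) + 1) * real x) ^ card V"
proof -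
  have "(\<Sum>f'\<in>embeddings S. real x ^ card {u \<in> V. f' u \<in> f ` V}) \<le> (\<Sum>f'\<in>V \<rightarrow>\<^sub>E S. real x ^ card {u \<in> V. f' u \<in> f ` V})"
    using S by (intro sum_mono2 finite_PiE) (auto simp: embeddings_def)
  also have "\<dots> = (\<Sum>f'\<in>V \<rightarrow>\<^sub>E S. \<Prod>u\<in>V. if f' u \<in> f ` V then real x else 1)"
    by (intro sum.cong refl) (simp add: prod.If_cases Int_def)
  also have "\<dots> = (\<Prod>u\<in>V. \<Sum>s\<in>S. if s \<in> f ` V then real x else 1)"
    using S by (subst prod_sum_PiE) auto
  also have "\<dots> = (\<Sum>s\<in>S. if s \<in> f ` V then real x else 1) ^ card V" by simp
  also have "\<dots> \<le> ((real (card V) + 1) * real x) ^ card V"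
  proof (rule power_mono)
    have "S \<inter> f ` V = f ` V" using f by (auto simp: embeddings_def)
    moreover have "card (f ` V) = card V" using f by (auto simp: embeddings_def card_image)
    moreover have "card (S - f ` V) \<le> x" using S by (metis card_mono Diff_subset)
    moreover have "S \<inter> - f ` V = S - f ` V" by auto
    ultimately show "(\<Sum>s\<in>S. if s \<in> f ` V then real x else 1) \<le> (real (card V) + 1) * real x"
      using S by (simp add: sum.If_cases algebra_simps)
  qed (auto intro: sum_nonneg)
  finally show ?thesis .
qed

text \<open>Copies with \<open>k\<close> common edges have at least \<open>k v\<^sub>F / e\<^sub>F\<close> common vertices, as \<open>F\<close> is balanced.
  The weights \<open>x ^ w\<close> for \<open>w\<close> common vertices factorize over the vertices of \<open>F\<close>.\<close>

lemma pair_sum_bound: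
  fixes S :: "'w set" and q :: real
  assumes S: "finite S" "card S = x" and x: "x \<ge> 1" and q: "0 < q" "q \<le> 1"
  shows "(\<Sum>H\<in>copies_in S. \<Sum>K\<in>copies_in S. if edges H \<inter> edges K = {} then 0 else q ^ card (edges H \<union> edges K))
     \<le> (real (card V) + 1) ^ card V * (1 + (real x ^ card V * q ^ card E) powr (2 - 1 / card E))"
proof -
  define P where "P = 1 + (real x ^ card V * q ^ card E) powr (2 - 1 / card E)"
  define g where "g H K = (if edges H \<inter> edges K = {} then 0 else q ^ card (edges H \<union> edges K))" for H K :: "'w graph"
  have g0: "0 \<le> g H K" for H K using q by (simp add: g_def)
  have P: "P > 0" by (simp add: P_def add_pos_nonneg)
  have pair: "g (embedded f) (embedded f') \<le> real x ^ card {u \<in> V. f' u \<in> f ` V} * P / real x ^ (2 * card V)"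
    if f: "f \<in> embeddings S" "f' \<in> embeddings S" for f f'
  proof (cases "edges (embedded f) \<inter> edges (embedded f') = {}")
    case True
    then show ?thesis using P by (simp add: g_def)
  next
    case False
    define A where "A = edges (embedded f)"
    define B where "B = edges (embedded f')"
    have c: "embedded f \<in> copies_in S" "embedded f' \<in> copies_in S" using f copies_in_eq[OF S(1)] by auto
    have AB: "finite A" "finite B" "card A = card E" "card B = card E"
      using edges_copy[OF c(1) S(1)] edges_copy[OF c(2) S(1)] by (auto simp: A_def B_def)
    define k where "k = card (A \<inter> B)"
    have k1: "1 \<le> k" using False AB by (simp add: k_def A_def B_def Suc_le_eq card_gt_0_iff)
    have k2: "k \<le> card E" unfolding k_def AB(3)[symmetric] by (intro card_mono AB) auto
    have un: "card (A \<union> B) = 2 * card E - k" using card_Un_Int[OF AB(1,2)] AB by (simp add: k_def)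
    have k3: "k * card V \<le> card E * card {u \<in> V. f' u \<in> f ` V}"
      by (rule overlap_bound[OF f S(1)]) (use k1 in \<open>simp_all add: k_def A_def B_def\<close>)
    have "real x ^ (2 * card V) * q ^ card (A \<union> B) \<le> real x ^ card {u \<in> V. f' u \<in> f ` V} * P"
      unfolding un P_def using x by (intro pair_term_bound q k1 k2 k3) auto
    then show ?thesis using False x by (simp add: g_def A_def B_def field_simps)
  qed
  have "(\<Sum>H\<in>copies_in S. \<Sum>K\<in>copies_in S. g H K) \<le> (\<Sum>H\<in>copies_in S. \<Sum>f'\<in>embeddings S. g H (embedded f'))"
    unfolding copies_in_eq[OF S(1)] using S g0
    by (intro sum_mono order_trans[OF sum_image_le]) auto
  also have "\<dots> \<le> (\<Sum>f\<in>embeddings S. \<Sum>f'\<in>embeddings S. g (embedded f) (embedded f'))"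
    unfolding copies_in_eq[OF S(1)] using S g0
    by (intro order_trans[OF sum_image_le] sum_nonneg g0) (auto intro!: sum_nonneg)
  also have "\<dots> \<le> (\<Sum>f\<in>embeddings S. \<Sum>f'\<in>embeddings S. real x ^ card {u \<in> V. f' u \<in> f ` V} * P / real x ^ (2 * card V))"
    by (intro sum_mono pair)
  also have "\<dots> = (\<Sum>f\<in>embeddings S. (\<Sum>f'\<in>embeddings S. real x ^ card {u \<in> V. f' u \<in> f ` V}) * (P / real x ^ (2 * card V)))"
    by (simp only: sum_distrib_right sum_divide_distrib times_divide_eq_right)
  also have "\<dots> \<le> (\<Sum>f\<in>embeddings S. ((real (card V) + 1) * real x) ^ card V * (P / real x ^ (2 * card V)))"
    using P by (intro sum_mono mult_right_mono sum_overlap_weights S) auto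
  also have "\<dots> = real (card (embeddings S)) * (((real (card V) + 1) * real x) ^ card V * (P / real x ^ (2 * card V)))"
    by simp
  also have "\<dots> \<le> real x ^ card V * (((real (card V) + 1) * real x) ^ card V * (P / real x ^ (2 * card V)))"
  proof (rule mult_right_mono)
    have "card (embeddings S) \<le> card (V \<rightarrow>\<^sub>E S)"
      using S by (intro card_mono finite_PiE) (auto simp: embeddings_def)
    then have "card (embeddings S) \<le> x ^ card V" using S by (simp add: card_PiE)
    then show "real (card (embeddings S)) \<le> real x ^ card V" by (simp flip: of_nat_power)
  qed (use P in auto)
  also have "\<dots> = (real (card V) + 1) ^ card V * P"
  proof -
    have "real x ^ (2 * card V) = real x ^ card V * real x ^ card V" by (simp add: mult_2 power_add)
    moreover have "x \<noteq> 0" using x by simp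
    ultimately show ?thesis unfolding power_mult_distrib by simp
  qed
  finally show ?thesis by (simp add: g_def P_def)
qed

text \<open>The first factor comes from summing overlaps. The second compares
  \<open>x ^ v * q ^ e\<close> with \<open>Nstar\<close>, by
  \<open>x choose v \<ge> (x / v) ^ v\<close>, with 2 as an upper bound for the exponent
  \<open>2 - 1 / e\<close>.\<close>

definition var_const :: real where
  "var_const = (real (card V) + 1) ^ card V * (real (card V) ^ card V) powr 2"

lemma var_const_pos: "var_const > 0"
proof -
  have "real (card V) > 0" using card3 by linarith
  then show ?thesis unfolding var_const_def by (intro mult_pos_pos zero_less_power) (auto intro: add_pos_pos)
qed

lemma variance_bernoulli_le:
  assumes S: "finite S" "card S = x" and q: "0 \<le> q" "q \<le> 1"
  shows "measure_pmf.expectation (bernoulli_graph S q) (\<lambda>G. (real (num_copies F G) - Nstar F x q)\<^sup>2)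
     \<le> var_const * (1 + Nstar F x q powr (2 - 1 / card E))"
proof -
  define \<beta> where "\<beta> = 2 - 1 / real (card E)"
  have \<beta>: "0 \<le> \<beta>" "\<beta> \<le> 2" using edges_pos(1)[OF simple two_conn card3] by (auto simp: \<beta>_def field_simps)
  let ?D = "\<Sum>H\<in>copies_in S. \<Sum>K\<in>copies_in S. if edges H \<inter> edges K = {} then 0 else q ^ card (edges H \<union> edges K)"
  have le: "measure_pmf.expectation (bernoulli_graph S q) (\<lambda>G. (real (num_copies F G) - Nstar F x q)\<^sup>2) \<le> ?D"
    unfolding Nstar_eq[OF S(2,1)] by (rule variance_num_copies_bernoulli[OF S(1) q])
  have "?D \<le> var_const * (1 + Nstar F x q powr \<beta>)"
  proof (cases "x < card V \<or> q = 0")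
    case True
    \<comment> \<open>In both degenerate cases the double sum is empty or zero: there is no copy at
      all, or every term carries a positive power of \<open>q = 0\<close>.\<close>
    have "?D = 0"
      using True
    proof
      assume "x < card V"
      then have "card (copies_in S) = 0" using S by (simp add: card_copies_in)
      then have "copies_in S = {}" using S by simp
      then show ?thesis by (simp only: sum.empty)
    next
      assume q0: "q = 0"
      have "card (edges H \<union> edges K) \<noteq> 0" if "H \<in> copies_in S" "K \<in> copies_in S" for H K
      proof -
        have "edges H \<noteq> {}"
          using edges_copy(1)[OF that(1) S(1)] edges_pos(1)[OF simple two_conn card3] by auto
        then show ?thesis using edges_copy(2)[OF that(1) S(1)] edges_copy(2)[OF that(2) S(1)] by simp
      qed
      then show ?thesis using q0 by (intro sum.neutral ballI) simp
    qed
    then show ?thesis using var_const_pos by simp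
  next
    case False
    then have x: "card V \<le> x" "1 \<le> x" and q0: "q > 0" using card3 q by auto
    define \<Phi> where "\<Phi> = real x ^ card V * q ^ card E"
    have \<Phi>: "0 \<le> \<Phi>" using q by (simp add: \<Phi>_def)
    have "\<Phi> = real (card V) ^ card V * ((real x / real (card V)) ^ card V * q ^ card E)"
    proof -
      have "V \<noteq> {}" using card3 by (metis card.empty not_numeral_le_zero)
      then show ?thesis by (simp add: \<Phi>_def power_divide)
    qed
    also have "\<dots> \<le> real (card V) ^ card V * Nstar F x q"
    proof (rule mult_left_mono)
      have "(real x / real (card V)) ^ card V \<le> real (x choose card V)"
        using binomial_ge_n_over_k_pow_k[of "card V" x, where 'a = real] x(1) by simp
      also have "\<dots> \<le> real base_copies * real (x choose card V)"
        using base_copies_pos mult_right_mono[of 1 "real base_copies" "real (x choose card V)"] by simp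
      finally show "(real x / real (card V)) ^ card V * q ^ card E \<le> Nstar F x q"
        unfolding Nstar_def base_copies_def[symmetric] using q by (intro mult_right_mono) auto
    qed simp
    finally have "\<Phi> powr \<beta> \<le> (real (card V) ^ card V * Nstar F x q) powr \<beta>"
      using \<Phi> \<beta> by (intro powr_mono2) auto
    also have "\<dots> = (real (card V) ^ card V) powr \<beta> * Nstar F x q powr \<beta>"
      by (rule powr_mult)
    also have "\<dots> \<le> (real (card V) ^ card V) powr 2 * Nstar F x q powr \<beta>"
      using \<beta> card3 by (intro mult_right_mono powr_mono) auto
    finally have P: "1 + \<Phi> powr \<beta> \<le> (real (card V) ^ card V) powr 2 * (1 + Nstar F x q powr \<beta>)"
      using card3 ge_one_powr_ge_zero[of "real (card V) ^ card V" 2] by (simp add: distrib_left add_mono)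
    have "?D \<le> (real (card V) + 1) ^ card V * (1 + \<Phi> powr \<beta>)"
      unfolding \<Phi>_def \<beta>_def by (rule pair_sum_bound[OF S x(2) q0 q(2)])
    also have "\<dots> \<le> (real (card V) + 1) ^ card V * ((real (card V) ^ card V) powr 2 * (1 + Nstar F x q powr \<beta>))"
      by (intro mult_left_mono P) auto
    finally show ?thesis by (simp add: var_const_def)
  qed
  with le show ?thesis unfolding \<beta>_def by linarith
qed

lemma expectation_community_copies:
  assumes "x \<le> n" "0 \<le> q" "q \<le> 1"
  shows "measure_pmf.expectation (community n (x, q)) (\<lambda>G. real (num_copies F G)) = Nstar F x q"
proof -
  have "measure_pmf.expectation (bernoulli_graph S q) (\<lambda>G. real (num_copies F G)) = Nstar F x q"
    if "S \<in> {S. S \<subseteq> {1..n} \<and> card S = x}" for S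
    using that assms expectation_num_copies_bernoulli[of S q] Nstar_eq[of S x q] finite_subset[of S "{1..n}"] by simp
  then show ?thesis
    unfolding expectation_community[OF assms(1)] using assms(1) n_subsets[of "{1..n}" x] by simp
qed

lemma variance_community_copies:
  assumes "x \<le> n" "0 \<le> q" "q \<le> 1"
  shows "measure_pmf.expectation (community n (x, q)) (\<lambda>G. (real (num_copies F G) - Nstar F x q)\<^sup>2)
     \<le> var_const * (1 + Nstar F x q powr (2 - 1 / card E))"
proof -
  let ?A = "{S. S \<subseteq> {1..n} \<and> card S = x}"
  have "(\<Sum>S\<in>?A. measure_pmf.expectation (bernoulli_graph S q) (\<lambda>G. (real (num_copies F G) - Nstar F x q)\<^sup>2))
      \<le> (\<Sum>S\<in>?A. var_const * (1 + Nstar F x q powr (2 - 1 / card E)))"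
    using assms by (intro sum_mono variance_bernoulli_le) (auto intro: finite_subset)
  also have "\<dots> = real (n choose x) * (var_const * (1 + Nstar F x q powr (2 - 1 / card E)))"
    using n_subsets[of "{1..n}" x] by simp
  finally show ?thesis
    unfolding expectation_community[OF assms(1)] using assms(1) by (simp add: field_simps)
qed

end

section \<open>The error of the comparison with independent sums\<close>

lemma expectation_square_sum_Pi_pmf:
  fixes Y :: "'i \<Rightarrow> 'b \<Rightarrow> real"
  assumes I: "finite I" and fin: "\<And>i. i \<in> I \<Longrightarrow> finite (set_pmf (p i))"
    and zero: "\<And>i. i \<in> I \<Longrightarrow> measure_pmf.expectation (p i) (Y i) = 0"
  shows "measure_pmf.expectation (Pi_pmf I d p) (\<lambda>C. (\<Sum>i\<in>I. Y i (C i))\<^sup>2) =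
     (\<Sum>i\<in>I. measure_pmf.expectation (p i) (\<lambda>c. (Y i c)\<^sup>2))"
proof -
  let ?P = "Pi_pmf I d p"
  have "set_pmf ?P \<subseteq> PiE_dflt I d (set_pmf \<circ> p)" using I by (simp add: set_Pi_pmf)
  moreover have "finite (PiE_dflt I d (set_pmf \<circ> p))" using I fin by (intro finite_PiE_dflt) auto
  ultimately have finP: "finite (set_pmf ?P)" by (rule finite_subset)
  have int: "integrable (measure_pmf ?P) h" for h :: "('i \<Rightarrow> 'b) \<Rightarrow> real"
    by (rule integrable_measure_pmf_finite[OF finP])
  have comp: "measure_pmf.expectation ?P (\<lambda>C. h (C i)) = measure_pmf.expectation (p i) h" if "i \<in> I" for h :: "'b \<Rightarrow> real" and i
  proof -
    have "measure_pmf.expectation (map_pmf (\<lambda>C. C i) ?P) h = measure_pmf.expectation ?P (\<lambda>C. h (C i))"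
      by simp
    then show ?thesis using Pi_pmf_component[OF I, of i d p] that by simp
  qed
  have ind: "prob_space.indep_vars (measure_pmf ?P) (\<lambda>_. borel) (\<lambda>i C. Y i (C i)) I"
    by (rule prob_space.indep_vars_compose2[OF measure_pmf.prob_space_axioms indep_vars_Pi_pmf[OF I]]) simp
  have cross: "measure_pmf.expectation ?P (\<lambda>C. Y i (C i) * Y j (C j)) = 0" if ij: "i \<in> I" "j \<in> I" "i \<noteq> j" for i j
  proof -
    have "prob_space.indep_vars (measure_pmf ?P) (\<lambda>_. borel) (\<lambda>i C. Y i (C i)) {i, j}"
      using ij by (intro prob_space.indep_vars_subset[OF measure_pmf.prob_space_axioms ind]) auto
    then have "measure_pmf.expectation ?P (\<lambda>C. \<Prod>k\<in>{i, j}. Y k (C k)) = (\<Prod>k\<in>{i, j}. measure_pmf.expectation ?P (\<lambda>C. Y k (C k)))"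
      by (intro prob_space.indep_vars_lebesgue_integral[OF measure_pmf.prob_space_axioms] int) auto
    then show ?thesis using ij comp[OF ij(1), of "Y i"] zero[OF ij(1)] by simp
  qed
  have "measure_pmf.expectation ?P (\<lambda>C. (\<Sum>i\<in>I. Y i (C i))\<^sup>2) =
      (\<Sum>i\<in>I. \<Sum>j\<in>I. measure_pmf.expectation ?P (\<lambda>C. Y i (C i) * Y j (C j)))"
    unfolding power2_eq_square sum_product by (simp add: int)
  also have "\<dots> = (\<Sum>i\<in>I. \<Sum>j\<in>I. if i = j then measure_pmf.expectation (p i) (\<lambda>c. (Y i c)\<^sup>2) else 0)"
    using cross comp by (intro sum.cong refl) (auto simp: power2_eq_square)
  also have "\<dots> = (\<Sum>i\<in>I. measure_pmf.expectation (p i) (\<lambda>c. (Y i c)\<^sup>2))"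
    using I by simp
  finally show ?thesis .
qed

text \<open>A Chebyshev-type estimate for the first moment: beyond the free threshold
  \<open>s\<close> the square takes over. It is used with \<open>s = \<delta> * b\<close>, a small
  multiple of the norming constant.\<close>

lemma abs_le_square_split:
  fixes z s :: real
  assumes "s > 0"
  shows "\<bar>z\<bar> \<le> s + z\<^sup>2 / s"
proof (cases "\<bar>z\<bar> \<le> s")
  case False
  then have "\<bar>z\<bar> * s \<le> \<bar>z\<bar> * \<bar>z\<bar>" by (intro mult_left_mono) auto
  then have "\<bar>z\<bar> \<le> z\<^sup>2 / s" using assms by (simp add: power2_eq_square field_simps)
  then show ?thesis using assms by simp
next
  case True
  moreover have "0 \<le> z\<^sup>2 / s" using assms by simp
  ultimately show ?thesis by linarith
qed

lemma community_support:
  assumes "G \<in> set_pmf (community n w)"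
  shows "verts G \<subseteq> {1..n}" "edges G \<subseteq> all_pairs (verts G)"
proof -
  obtain x q where w: "w = (x, q)" by fastforce
  obtain S where S: "S \<subseteq> {1..n}" "G \<in> set_pmf (bernoulli_graph S q)"
    using assms finite_nonempty_sizes[of n x] by (auto simp: w community_def)
  then show "verts G \<subseteq> {1..n}" "edges G \<subseteq> all_pairs (verts G)"
    using subsetD[OF set_bernoulli_graph S(2)] finite_subset[OF S(1)] by auto
qed

context balanced_graph
begin

text \<open>Conditionally there are finitely many outcomes, so all expectations exist. The Lipschitz
  bound for \<open>u\<close> removes \<open>B\<close> and leaves three terms: the expected number of
  hits over at most \<open>n ^ v\<close> embeddings, the threshold \<open>\<delta>\<close>, and the
  second moment of the centred community counts, a sum of variances by independence.\<close>

lemma conditional_error_bound: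
  fixes \<omega> :: "nat \<Rightarrow> nat \<times> real" and u :: "real \<Rightarrow> real"
  assumes n: "n > 0" and b: "b > 0" and \<delta>: "\<delta> > 0" and L: "L \<ge> 0"
    and \<omega>: "\<And>i. i \<in> {1..m} \<Longrightarrow> fst (\<omega> i) \<le> n \<and> 0 \<le> snd (\<omega> i) \<and> snd (\<omega> i) \<le> 1"
    and u: "\<And>x y. \<bar>u x - u y\<bar> \<le> L * \<bar>x - y\<bar>"
  shows "\<bar>measure_pmf.expectation (union_graph n m \<omega>) (\<lambda>G. u ((real (num_copies F G) - B) / b))
      - u (((\<Sum>i\<in>{1..m}. mean_copies (\<omega> i)) - B) / b)\<bar>
    \<le> L * (real n ^ card V / b * (\<Sum>(e, c)\<in>spread_systems {1..m}. spread_prob n \<omega> c)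
        + \<delta> + (\<Sum>i\<in>{1..m}. var_const * (1 + mean_copies (\<omega> i) powr (2 - 1 / card E))) / (\<delta> * b\<^sup>2))"
proof -
  let ?I = "{1..m}"
  let ?P = "Pi_pmf ?I ({}, {}) (\<lambda>i. community n (\<omega> i))"
  define N where "N = (\<lambda>C :: nat \<Rightarrow> nat graph. real (num_copies F ({1..n}, \<Union>i\<in>?I. edges (C i))))"
  define s where "s = (\<Sum>i\<in>?I. mean_copies (\<omega> i))"
  define Y where "Y i c = real (num_copies F c) - mean_copies (\<omega> i)" for i and c :: "nat graph"
  define Z where "Z C = (\<Sum>i\<in>?I. Y i (C i))" for C :: "nat \<Rightarrow> nat graph"
  define h where "h f C = real (card (spread_hits (\<lambda>i. edges (C i)) ?I f))" for f :: "'v \<Rightarrow> nat" and C :: "nat \<Rightarrow> nat graph"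
  have finc: "finite (set_pmf (community n (\<omega> i)))" for i
    by (rule finite_subset[OF set_community]) (simp add: finite_all_pairs)
  have "set_pmf ?P \<subseteq> PiE_dflt ?I ({}, {}) (set_pmf \<circ> (\<lambda>i. community n (\<omega> i)))" by (simp add: set_Pi_pmf)
  then have finP: "finite (set_pmf ?P)"
    using finc by (elim finite_subset) (intro finite_PiE_dflt, auto)
  have int: "integrable (measure_pmf ?P) g" for g :: "(nat \<Rightarrow> nat graph) \<Rightarrow> real"
    by (rule integrable_measure_pmf_finite[OF finP])
  have point: "\<bar>u ((N C - B) / b) - u ((s - B) / b)\<bar>
      \<le> L * ((\<Sum>f\<in>embeddings {1..n}. h f C) / b + \<delta> + (Z C)\<^sup>2 / (\<delta> * b\<^sup>2))"
    if C: "C \<in> set_pmf ?P" for C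
  proof -
    have "C i \<in> set_pmf (community n (\<omega> i))" if "i \<in> ?I" for i
      using C that by (auto simp: set_Pi_pmf PiE_dflt_def)
    then have Cp: "verts (C i) \<subseteq> {1..n} \<and> edges (C i) \<subseteq> all_pairs (verts (C i))" if "i \<in> ?I" for i
      using community_support that by blast
    have "\<bar>N C - (\<Sum>i\<in>?I. real (num_copies F (C i)))\<bar> \<le> (\<Sum>f\<in>embeddings {1..n}. h f C)"
      unfolding N_def h_def by (rule num_copies_union) (use Cp in auto)
    moreover have "(\<Sum>i\<in>?I. real (num_copies F (C i))) - s = Z C"
      by (simp add: Z_def Y_def s_def sum_subtractf)
    moreover have "\<bar>Z C\<bar> \<le> \<delta> * b + (Z C)\<^sup>2 / (\<delta> * b)" using b \<delta> by (intro abs_le_square_split) simp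
    ultimately have "\<bar>N C - s\<bar> \<le> (\<Sum>f\<in>embeddings {1..n}. h f C) + (\<delta> * b + (Z C)\<^sup>2 / (\<delta> * b))"
      by linarith
    then have "\<bar>N C - s\<bar> / b \<le> ((\<Sum>f\<in>embeddings {1..n}. h f C) + (\<delta> * b + (Z C)\<^sup>2 / (\<delta> * b))) / b"
      using b by (intro divide_right_mono) auto
    also have "\<dots> = (\<Sum>f\<in>embeddings {1..n}. h f C) / b + \<delta> + (Z C)\<^sup>2 / (\<delta> * b\<^sup>2)"
      using b by (simp add: add_divide_distrib power2_eq_square)
    finally have "\<bar>(N C - B) / b - (s - B) / b\<bar> \<le> (\<Sum>f\<in>embeddings {1..n}. h f C) / b + \<delta> + (Z C)\<^sup>2 / (\<delta> * b\<^sup>2)"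
      using b by (simp add: diff_divide_distrib[symmetric] abs_divide)
    then show ?thesis using u[of "(N C - B) / b" "(s - B) / b"] L by (meson mult_left_mono order_trans)
  qed
  have "\<bar>measure_pmf.expectation (union_graph n m \<omega>) (\<lambda>G. u ((real (num_copies F G) - B) / b)) - u ((s - B) / b)\<bar>
      = \<bar>measure_pmf.expectation ?P (\<lambda>C. u ((N C - B) / b) - u ((s - B) / b))\<bar>"
  proof -
    have "measure_pmf.expectation (union_graph n m \<omega>) (\<lambda>G. u ((real (num_copies F G) - B) / b)) = measure_pmf.expectation ?P (\<lambda>C. u ((N C - B) / b))"
      unfolding union_graph_def N_def by (rule integral_map_pmf)
    then show ?thesis by (simp only: Bochner_Integration.integral_diff[OF int int] measure_pmf.prob_space lebesgue_integral_const) simp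
  qed
  also have "\<dots> \<le> measure_pmf.expectation ?P (\<lambda>C. \<bar>u ((N C - B) / b) - u ((s - B) / b)\<bar>)"
    by (rule integral_abs_bound)
  also have "\<dots> \<le> measure_pmf.expectation ?P (\<lambda>C. L * ((\<Sum>f\<in>embeddings {1..n}. h f C) / b + \<delta> + (Z C)\<^sup>2 / (\<delta> * b\<^sup>2)))"
    using point by (intro integral_mono_AE int) (auto simp: AE_measure_pmf_iff)
  also have "\<dots> = L * ((\<Sum>f\<in>embeddings {1..n}. measure_pmf.expectation ?P (h f)) / b + \<delta>
       + measure_pmf.expectation ?P (\<lambda>C. (Z C)\<^sup>2) / (\<delta> * b\<^sup>2))"
    by (simp add: int del: One_nat_def)
  also have "\<dots> \<le> L * (real n ^ card V / b * (\<Sum>(e, c)\<in>spread_systems ?I. spread_prob n \<omega> c)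
        + \<delta> + (\<Sum>i\<in>?I. var_const * (1 + mean_copies (\<omega> i) powr (2 - 1 / card E))) / (\<delta> * b\<^sup>2))"
  proof (intro mult_left_mono[OF _ L] add_mono order_refl)
    define W where "W = (\<Sum>(e, c)\<in>spread_systems ?I. spread_prob n \<omega> c)"
    have W0: "0 \<le> W"
      unfolding W_def spread_prob_def
    proof (intro sum_nonneg, clarify, intro prod_nonneg ballI)
      fix e c j assume "(e, c) \<in> spread_systems ?I" "j \<in> c ` V"
      then have "j \<in> ?I" by (auto simp: spread_systems_def)
      then show "0 \<le> (real (fst (\<omega> j)) / real n) ^ Suc (class_size c j) * snd (\<omega> j) ^ class_size c j"
        using \<omega> by simp
    qed
    have hW: "measure_pmf.expectation ?P (h f) \<le> W" if f: "f \<in> embeddings {1..n}" for f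
    proof -
      have "h f C = (\<Sum>(e, c)\<in>spread_systems ?I. indicator {C. \<forall>u\<in>V. f ` e u \<in> edges (C (c u))} C)" for C
      proof -
        have "spread_hits (\<lambda>i. edges (C i)) ?I f = {ec \<in> spread_systems ?I. \<forall>u\<in>V. f ` fst ec u \<in> edges (C (snd ec u))}"
          by (auto simp: spread_hits_def)
        then show ?thesis by (simp add: h_def sum.If_cases indicator_def of_bool_def case_prod_beta Int_def)
      qed
      then have "h f = (\<lambda>C. \<Sum>(e, c)\<in>spread_systems ?I. indicator {C. \<forall>u\<in>V. f ` e u \<in> edges (C (c u))} C)"
        by (rule ext)
      then have "measure_pmf.expectation ?P (h f) =
         (\<Sum>(e, c)\<in>spread_systems ?I. measure (measure_pmf ?P) {C. \<forall>u\<in>V. f ` e u \<in> edges (C (c u))})"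
        by (simp add: int case_prod_beta del: One_nat_def)
      also have "\<dots> \<le> W" unfolding W_def
      proof (rule sum_mono)
        fix ec assume ec: "ec \<in> spread_systems ?I"
        obtain e c where ec': "ec = (e, c)" by fastforce
        show "(case ec of (e, c) \<Rightarrow> measure (measure_pmf ?P) {C. \<forall>u\<in>V. f ` e u \<in> edges (C (c u))})
          \<le> (case ec of (e, c) \<Rightarrow> spread_prob n \<omega> c)"
          unfolding ec' prod.case by (rule prob_spread_hit_le[OF _ n \<omega> _ f]) (use ec ec' in auto)
      qed
      finally show ?thesis .
    qed
    have "(\<Sum>f\<in>embeddings {1..n}. measure_pmf.expectation ?P (h f)) \<le> (\<Sum>f\<in>(embeddings {1..n} :: ('v \<Rightarrow> nat) set). W)"
      by (intro sum_mono hW)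
    also have "\<dots> = real (card (embeddings {1..n})) * W" by simp
    also have "\<dots> \<le> real n ^ card V * W"
    proof (rule mult_right_mono[OF _ W0])
      have "card (embeddings {1..n}) \<le> card (V \<rightarrow>\<^sub>E {1..n})"
        by (intro card_mono finite_PiE) (auto simp: embeddings_def)
      then have "card (embeddings {1..n}) \<le> n ^ card V" by (simp add: card_PiE)
      then show "real (card (embeddings {1..n})) \<le> real n ^ card V" by (simp flip: of_nat_power)
    qed
    finally have "(\<Sum>f\<in>embeddings {1..n}. measure_pmf.expectation ?P (h f)) / b \<le> real n ^ card V * W / b"
      using b by (intro divide_right_mono) auto
    then show "(\<Sum>f\<in>embeddings {1..n}. measure_pmf.expectation ?P (h f)) / b \<le> real n ^ card V / b * W" by simp
    have "measure_pmf.expectation ?P (\<lambda>C. (Z C)\<^sup>2) = (\<Sum>i\<in>?I. measure_pmf.expectation (community n (\<omega> i)) (\<lambda>c. (Y i c)\<^sup>2))"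
      unfolding Z_def
    proof (rule expectation_square_sum_Pi_pmf)
      fix i assume i: "i \<in> ?I"
      have "measure_pmf.expectation (community n (\<omega> i)) (\<lambda>c. real (num_copies F c)) = mean_copies (\<omega> i)"
        using expectation_community_copies[of "fst (\<omega> i)" n "snd (\<omega> i)"] \<omega>[OF i] by (simp add: mean_copies_def)
      then show "measure_pmf.expectation (community n (\<omega> i)) (Y i) = 0"
        unfolding Y_def using finc by (simp add: integrable_measure_pmf_finite)
    qed (use finc in auto)
    also have "\<dots> \<le> (\<Sum>i\<in>?I. var_const * (1 + mean_copies (\<omega> i) powr (2 - 1 / card E)))"
    proof (rule sum_mono)
      fix i assume i: "i \<in> ?I"
      show "measure_pmf.expectation (community n (\<omega> i)) (\<lambda>c. (Y i c)\<^sup>2) \<le> var_const * (1 + mean_copies (\<omega> i) powr (2 - 1 / card E))"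
        using variance_community_copies[of "fst (\<omega> i)" n "snd (\<omega> i)"] \<omega>[OF i] by (simp add: mean_copies_def Y_def)
    qed
    finally show "measure_pmf.expectation ?P (\<lambda>C. (Z C)\<^sup>2) / (\<delta> * b\<^sup>2) \<le> (\<Sum>i\<in>?I. var_const * (1 + mean_copies (\<omega> i) powr (2 - 1 / card E))) / (\<delta> * b\<^sup>2)"
      using b \<delta> by (intro divide_right_mono) auto
  qed
  finally show ?thesis by (simp only: s_def)
qed

end

section \<open>Averaging the comparison over sizes and densities\<close>

locale community_law = balanced_graph F for F :: "'v graph" +
  fixes D :: "(nat \<times> real) measure"
  assumes probD: "prob_space D"
    and setsD [measurable_cong]: "sets D = sets (count_space UNIV \<Otimes>\<^sub>M borel)"
    and unitD: "AE w in D. 0 \<le> snd w \<and> snd w \<le> 1"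
begin

sublocale D: prob_space D by (rule probD)

text \<open>The condition \<open>fst w \<le> n\<close> means that the community size is not cut off,
  so \<open>Nstar\<close> is the exact conditional mean; the level \<open>T\<close> keeps the bound
  for the conditional variance integrable.\<close>

definition good :: "nat \<Rightarrow> real \<Rightarrow> nat \<times> real \<Rightarrow> bool" where
  "good n T w \<longleftrightarrow> fst w \<le> n \<and> 0 \<le> snd w \<and> snd w \<le> 1 \<and> mean_copies w \<le> T"

text \<open>Set to 0 outside the range where it is a probability bound, so that it lies between 0
  and 1 and is integrable without any moment condition.\<close>

definition edge_weight :: "nat \<Rightarrow> nat \<Rightarrow> nat \<times> real \<Rightarrow> real" where
  "edge_weight n s w = (if fst w \<le> n \<and> 0 \<le> snd w \<and> snd w \<le> 1
     then (real (fst w) / real n) ^ Suc s * snd w ^ s else 0)"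

definition var_weight :: "real \<Rightarrow> nat \<times> real \<Rightarrow> real" where
  "var_weight T w = (if 0 \<le> mean_copies w \<and> mean_copies w \<le> T then var_const * (1 + mean_copies w powr (2 - 1 / card E)) else 0)"

lemma fst_measurable [measurable]: "fst \<in> measurable D (count_space UNIV)"
  using measurable_fst[of "count_space UNIV :: nat measure" "borel :: real measure"]
  by (subst measurable_cong_sets[OF setsD refl])

lemma snd_measurable [measurable]: "snd \<in> borel_measurable D"
  using measurable_snd[of "count_space UNIV :: nat measure" "borel :: real measure"]
  by (subst measurable_cong_sets[OF setsD refl])

lemma mean_copies_measurable [measurable]: "mean_copies \<in> borel_measurable D"
  unfolding mean_copies_def[abs_def] Nstar_def by measurable

lemma good_measurable [measurable]: "Measurable.pred D (good n T)"
  unfolding good_def[abs_def] by measurable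

lemma edge_weight_measurable [measurable]: "edge_weight n s \<in> borel_measurable D"
  unfolding edge_weight_def[abs_def] by measurable

lemma var_weight_measurable [measurable]: "var_weight T \<in> borel_measurable D"
  unfolding var_weight_def[abs_def] by measurable

lemma edge_weight_bounds: "0 \<le> edge_weight n s w" "edge_weight n s w \<le> 1"
proof -
  have 1: "0 \<le> real (fst w) / real n \<and> real (fst w) / real n \<le> 1" if "fst w \<le> n"
    using that by (cases "n = 0") auto
  show "0 \<le> edge_weight n s w" using 1 by (simp add: edge_weight_def)
  show "edge_weight n s w \<le> 1"
    unfolding edge_weight_def using 1
    by (auto intro!: mult_le_one power_le_one zero_le_power simp del: power_Suc)
qed

lemma var_weight_bounds: "0 \<le> var_weight T w" "var_weight T w \<le> var_const * (1 + \<bar>T\<bar> powr (2 - 1 / card E))"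
proof -
  have 2: "0 \<le> 2 - 1 / real (card E)"
    using edges_pos(1)[OF simple two_conn card3] by (simp add: field_simps)
  show "0 \<le> var_weight T w" using var_const_pos by (simp add: var_weight_def add_nonneg_nonneg)
  show "var_weight T w \<le> var_const * (1 + \<bar>T\<bar> powr (2 - 1 / card E))"
    unfolding var_weight_def using var_const_pos 2
    by (auto intro!: mult_left_mono powr_mono2 mult_nonneg_nonneg add_nonneg_nonneg)
qed

lemma edge_weight_integrable [simp]: "integrable D (edge_weight n s)"
  by (rule D.integrable_const_bound[where B = 1]) (use edge_weight_bounds in auto)

lemma var_weight_integrable [simp]: "integrable D (var_weight T)"
  by (rule D.integrable_const_bound[where B = "var_const * (1 + \<bar>T\<bar> powr (2 - 1 / card E))"])
     (use var_weight_bounds in auto)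

abbreviation "PD m \<equiv> \<Pi>\<^sub>M i\<in>{1..m}. D"

lemma prob_PD: "prob_space (PD m)"
  by (intro prob_space_PiM probD)

lemma sets_PD: "sets (PD m) = sets (\<Pi>\<^sub>M i\<in>{1..m}. count_space UNIV \<Otimes>\<^sub>M borel)"
  using setsD by (intro sets_PiM_cong) auto

lemma component_measurable [measurable]: "i \<in> {1..m} \<Longrightarrow> (\<lambda>\<omega>. \<omega> i) \<in> measurable (PD m) D"
  by (rule measurable_component_singleton)

lemma union_kernel [measurable]: "(\<lambda>\<omega>. measure_pmf (union_graph n m \<omega>)) \<in> measurable (PD m) (subprob_algebra (count_space UNIV))"
  using union_graph_measurable measurable_cong_sets[OF sets_PD refl] by blast

lemma integral_component:
  fixes f :: "nat \<times> real \<Rightarrow> real"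
  assumes i: "i \<in> {1..m}" and f: "integrable D f"
  shows "integrable (PD m) (\<lambda>\<omega>. f (\<omega> i))" "(\<integral>\<omega>. f (\<omega> i) \<partial>PD m) = (\<integral>w. f w \<partial>D)"
proof -
  have d: "distr (PD m) D (\<lambda>\<omega>. \<omega> i) = D"
    by (rule distr_PiM_component[OF probD i])
  have [measurable]: "f \<in> borel_measurable D" using f by simp
  show "integrable (PD m) (\<lambda>\<omega>. f (\<omega> i))"
    using f i by (subst (asm) d[symmetric]) (simp add: integrable_distr_eq)
  show "(\<integral>\<omega>. f (\<omega> i) \<partial>PD m) = (\<integral>w. f w \<partial>D)"
    using i by (subst (2) d[symmetric]) (simp add: integral_distr)
qed

lemma integral_sum_components:
  fixes f :: "nat \<times> real \<Rightarrow> real"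
  assumes f: "integrable D f"
  shows "integrable (PD m) (\<lambda>\<omega>. \<Sum>i\<in>{1..m}. f (\<omega> i))"
    and "(\<integral>\<omega>. (\<Sum>i\<in>{1..m}. f (\<omega> i)) \<partial>PD m) = real m * (\<integral>w. f w \<partial>D)"
proof -
  show "integrable (PD m) (\<lambda>\<omega>. \<Sum>i\<in>{1..m}. f (\<omega> i))"
    by (intro Bochner_Integration.integrable_sum integral_component(1) f)
  have "(\<integral>\<omega>. (\<Sum>i\<in>{1..m}. f (\<omega> i)) \<partial>PD m) = (\<Sum>i\<in>{1..m}. \<integral>\<omega>. f (\<omega> i) \<partial>PD m)"
    by (intro Bochner_Integration.integral_sum integral_component(1) f)
  also have "\<dots> = (\<Sum>i\<in>{1..m}. \<integral>w. f w \<partial>D)"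
    by (intro sum.cong refl integral_component(2) f)
  finally show "(\<integral>\<omega>. (\<Sum>i\<in>{1..m}. f (\<omega> i)) \<partial>PD m) = real m * (\<integral>w. f w \<partial>D)" by simp
qed

lemma integral_edge_product:
  fixes J :: "nat set"
  assumes "J \<subseteq> {1..m}"
  shows "integrable (PD m) (\<lambda>\<omega>. \<Prod>j\<in>J. edge_weight n (s j) (\<omega> j))"
    and "(\<integral>\<omega>. (\<Prod>j\<in>J. edge_weight n (s j) (\<omega> j)) \<partial>PD m) = (\<Prod>j\<in>J. \<integral>w. edge_weight n (s j) w \<partial>D)"
proof -
  interpret P: product_sigma_finite "\<lambda>i. D" ..
  define f where "f j w = (if j \<in> J then edge_weight n (s j) w else 1)" for j w
  have f: "integrable D (f j)" for j unfolding f_def by (cases "j \<in> J") auto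
  have restrict: "(\<Prod>j\<in>{1..m}. if j \<in> J then h j else 1) = (\<Prod>j\<in>J. h j)" for h :: "nat \<Rightarrow> real"
    using prod.inter_restrict[of "{1..m}" h J] Int_absorb1[OF assms] by simp
  have eq: "(\<Prod>j\<in>{1..m}. f j (\<omega> j)) = (\<Prod>j\<in>J. edge_weight n (s j) (\<omega> j))" for \<omega>
    unfolding f_def by (rule restrict)
  have eq': "(\<Prod>j\<in>{1..m}. integral\<^sup>L D (f j)) = (\<Prod>j\<in>J. \<integral>w. edge_weight n (s j) w \<partial>D)"
  proof -
    have "integral\<^sup>L D (f j) = (if j \<in> J then \<integral>w. edge_weight n (s j) w \<partial>D else 1)" for j
      using D.prob_space by (cases "j \<in> J") (simp_all add: f_def[abs_def])
    then show ?thesis using restrict by simp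
  qed
  show "integrable (PD m) (\<lambda>\<omega>. \<Prod>j\<in>J. edge_weight n (s j) (\<omega> j))"
    using P.product_integrable_prod[of "{1..m}" f] f by (simp add: eq del: One_nat_def)
  show "(\<integral>\<omega>. (\<Prod>j\<in>J. edge_weight n (s j) (\<omega> j)) \<partial>PD m) = (\<Prod>j\<in>J. \<integral>w. edge_weight n (s j) w \<partial>D)"
    using P.product_integral_prod[of "{1..m}" f] f by (simp add: eq eq' del: One_nat_def)
qed

text \<open>In the first summand, \<open>m\<close> times the probability of a bad community bounds
  the probability that one occurs, and 2 is the largest distance between two values of a function
  bounded by 1. The rest is the average of the conditional bound.\<close>

definition total_error :: "real \<Rightarrow> nat \<Rightarrow> nat \<Rightarrow> real \<Rightarrow> real \<Rightarrow> real \<Rightarrow> real" where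
  "total_error L n m T \<delta> b =
     2 * (real m * measure D {w \<in> space D. \<not> good n T w}) +
     L * (real n ^ card V / b * (\<Sum>(e, c)\<in>spread_systems {1..m}. \<Prod>j\<in>c ` V. \<integral>w. edge_weight n (class_size c j) w \<partial>D)
        + \<delta> + real m * (\<integral>w. var_weight T w \<partial>D) / (\<delta> * b\<^sup>2))"

text \<open>Pointwise in the sizes and densities: if some community is bad, the number of bad ones
  is at least 1 and pays for the trivial bound 2; otherwise the conditional bound applies, and there
  the extended weights agree with the actual ones. Both cases are dominated by the single integrable
  function \<open>U\<close>.\<close>

lemma integrated_error_bound:
  fixes u :: "real \<Rightarrow> real"
  assumes n: "n > 0" and b: "b > 0" and \<delta>: "\<delta> > 0" and L: "L \<ge> 0"
    and [measurable]: "u \<in> borel_measurable borel"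
    and u1: "\<And>x. \<bar>u x\<bar> \<le> 1" and u: "\<And>x y. \<bar>u x - u y\<bar> \<le> L * \<bar>x - y\<bar>"
  shows "\<bar>(\<integral>G. u ((real (num_copies F G) - B) / b) \<partial>random_graph D n m)
      - (\<integral>\<omega>. u (((\<Sum>i\<in>{1..m}. mean_copies (\<omega> i)) - B) / b) \<partial>PD m)\<bar> \<le> total_error L n m T \<delta> b"
proof -
  interpret P: prob_space "PD m" by (rule prob_PD)
  let ?I = "{1..m}"
  define A where "A \<omega> = measure_pmf.expectation (union_graph n m \<omega>) (\<lambda>G. u ((real (num_copies F G) - B) / b))" for \<omega>
  define C where "C \<omega> = u (((\<Sum>i\<in>?I. mean_copies (\<omega> i)) - B) / b)" for \<omega>
  define U1 where "U1 \<omega> = (\<Sum>i\<in>?I. indicator {w. \<not> good n T w} (\<omega> i) :: real)" for \<omega>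
  define U2 where "U2 \<omega> = (\<Sum>(e, c)\<in>spread_systems ?I. \<Prod>j\<in>c ` V. edge_weight n (class_size c j) (\<omega> j))" for \<omega>
  define U3 where "U3 \<omega> = (\<Sum>i\<in>?I. var_weight T (\<omega> i))" for \<omega>
  define U where "U \<omega> = 2 * U1 \<omega> + L * (real n ^ card V / b * U2 \<omega> + \<delta> + U3 \<omega> / (\<delta> * b\<^sup>2))" for \<omega>
  have cI: "c ` V \<subseteq> ?I" if "(e, c) \<in> spread_systems ?I" for e c
    using that by (auto simp: spread_systems_def)
  have U_nonneg: "0 \<le> U1 \<omega>" "0 \<le> U2 \<omega>" "0 \<le> U3 \<omega>" for \<omega>
    by (simp_all add: U1_def U2_def U3_def sum_nonneg prod_nonneg edge_weight_bounds var_weight_bounds case_prod_beta)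
  have A1: "\<bar>A \<omega>\<bar> \<le> 1" for \<omega>
  proof -
    have "\<bar>A \<omega>\<bar> \<le> measure_pmf.expectation (union_graph n m \<omega>) (\<lambda>G. \<bar>u ((real (num_copies F G) - B) / b)\<bar>)"
      unfolding A_def by (rule integral_abs_bound)
    also have "\<dots> \<le> measure_pmf.expectation (union_graph n m \<omega>) (\<lambda>G. 1)"
      by (rule integral_mono') (use u1 in auto)
    finally show ?thesis by simp
  qed
  have Am: "A \<in> borel_measurable (PD m)"
    unfolding A_def[abs_def]
    by (rule measurable_compose[OF union_kernel integral_measurable_subprob_algebra]) simp
  have Cm: "C \<in> borel_measurable (PD m)"
    unfolding C_def[abs_def] by measurable
  have intA: "integrable (PD m) A" by (rule P.integrable_const_bound[where B = 1, OF AE_I2 Am]) (simp add: A1)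
  have intC: "integrable (PD m) C" by (rule P.integrable_const_bound[where B = 1, OF AE_I2 Cm]) (simp add: C_def u1)
  have ind: "integrable D (indicator {w. \<not> good n T w} :: _ \<Rightarrow> real)"
    by (rule D.integrable_const_bound[where B = 1]) (auto simp: indicator_def)
  have I1: "integrable (PD m) U1" "(\<integral>\<omega>. U1 \<omega> \<partial>PD m) = real m * measure D {w \<in> space D. \<not> good n T w}"
  proof -
    have "(\<integral>w. indicator {w. \<not> good n T w} w \<partial>D) = measure D {w \<in> space D. \<not> good n T w}"
      by (simp add: Int_def conj_commute)
    then show "integrable (PD m) U1" "(\<integral>\<omega>. U1 \<omega> \<partial>PD m) = real m * measure D {w \<in> space D. \<not> good n T w}"
      unfolding U1_def[abs_def] using integral_sum_components[OF ind] by simp_all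
  qed
  have I2: "integrable (PD m) U2" "(\<integral>\<omega>. U2 \<omega> \<partial>PD m) = (\<Sum>(e, c)\<in>spread_systems ?I. \<Prod>j\<in>c ` V. \<integral>w. edge_weight n (class_size c j) w \<partial>D)"
  proof -
    have i: "integrable (PD m) (\<lambda>\<omega>. \<Prod>j\<in>c ` V. edge_weight n (class_size c j) (\<omega> j))"
      and e: "(\<integral>\<omega>. (\<Prod>j\<in>c ` V. edge_weight n (class_size c j) (\<omega> j)) \<partial>PD m) = (\<Prod>j\<in>c ` V. \<integral>w. edge_weight n (class_size c j) w \<partial>D)"
      if "(e, c) \<in> spread_systems ?I" for e c
      by (rule integral_edge_product[OF cI[OF that]])+
    show "integrable (PD m) U2" unfolding U2_def[abs_def]
      using i by (intro Bochner_Integration.integrable_sum) auto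
    show "(\<integral>\<omega>. U2 \<omega> \<partial>PD m) = (\<Sum>(e, c)\<in>spread_systems ?I. \<Prod>j\<in>c ` V. \<integral>w. edge_weight n (class_size c j) w \<partial>D)"
      unfolding U2_def using i e
      by (subst Bochner_Integration.integral_sum) (auto intro!: sum.cong)
  qed
  have I3: "integrable (PD m) U3" "(\<integral>\<omega>. U3 \<omega> \<partial>PD m) = real m * (\<integral>w. var_weight T w \<partial>D)"
    unfolding U3_def[abs_def] by (rule integral_sum_components[OF var_weight_integrable])+
  have point: "\<bar>A \<omega> - C \<omega>\<bar> \<le> U \<omega>" for \<omega>
  proof (cases "\<forall>i\<in>?I. good n T (\<omega> i)")
    case True
    have \<omega>: "fst (\<omega> i) \<le> n \<and> 0 \<le> snd (\<omega> i) \<and> snd (\<omega> i) \<le> 1" if "i \<in> ?I" for i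
      using True that by (auto simp: good_def)
    have "\<bar>A \<omega> - C \<omega>\<bar> \<le> L * (real n ^ card V / b * (\<Sum>(e, c)\<in>spread_systems ?I. spread_prob n \<omega> c)
        + \<delta> + (\<Sum>i\<in>?I. var_const * (1 + mean_copies (\<omega> i) powr (2 - 1 / card E))) / (\<delta> * b\<^sup>2))"
      unfolding A_def C_def by (rule conditional_error_bound[OF n b \<delta> L \<omega> u])
    also have "(\<Sum>(e, c)\<in>spread_systems ?I. spread_prob n \<omega> c) = U2 \<omega>"
      unfolding U2_def spread_prob_def
    proof (intro sum.cong refl, clarify, intro prod.cong refl)
      fix e c j assume "(e, c) \<in> spread_systems ?I" "j \<in> c ` V"
      then have "j \<in> ?I" using cI by blast
      then show "(real (fst (\<omega> j)) / real n) ^ Suc (class_size c j) * snd (\<omega> j) ^ class_size c j = edge_weight n (class_size c j) (\<omega> j)"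
        using \<omega> by (simp add: edge_weight_def)
    qed
    also have "(\<Sum>i\<in>?I. var_const * (1 + mean_copies (\<omega> i) powr (2 - 1 / card E))) = U3 \<omega>"
      unfolding U3_def
    proof (intro sum.cong refl)
      fix i assume i: "i \<in> ?I"
      have "0 \<le> mean_copies (\<omega> i)" using \<omega>[OF i] by (simp add: mean_copies_def Nstar_def)
      then show "var_const * (1 + mean_copies (\<omega> i) powr (2 - 1 / card E)) = var_weight T (\<omega> i)"
        using True i by (simp add: var_weight_def good_def)
    qed
    finally show ?thesis using U_nonneg(1)[of \<omega>] by (simp add: U_def)
  next
    case False
    then obtain i where i: "i \<in> ?I" "\<not> good n T (\<omega> i)" by blast
    have "1 = (indicator {w. \<not> good n T w} (\<omega> i) :: real)" using i by simp
    also have "\<dots> \<le> U1 \<omega>" unfolding U1_def by (rule member_le_sum[OF i(1)]) auto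
    finally have "1 \<le> U1 \<omega>" .
    moreover have "0 \<le> L * (real n ^ card V / b * U2 \<omega> + \<delta> + U3 \<omega> / (\<delta> * b\<^sup>2))"
      using U_nonneg(2,3)[of \<omega>] L b \<delta> by (intro mult_nonneg_nonneg add_nonneg_nonneg divide_nonneg_nonneg) auto
    moreover have "\<bar>A \<omega> - C \<omega>\<bar> \<le> 2" using A1[of \<omega>] u1[of "((\<Sum>i\<in>?I. mean_copies (\<omega> i)) - B) / b"] by (simp add: C_def)
    ultimately show ?thesis unfolding U_def by linarith
  qed
  have intU: "integrable (PD m) U" unfolding U_def[abs_def] using I1 I2 I3 by (auto simp del: One_nat_def)
  have "(\<integral>G. u ((real (num_copies F G) - B) / b) \<partial>random_graph D n m) = (\<integral>\<omega>. A \<omega> \<partial>PD m)"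
    unfolding random_graph_def A_def
    by (rule integral_bind[where K = "count_space UNIV" and B = 1 and B' = 1])
       (use u1 P.finite_measure_axioms union_kernel in \<open>auto simp: measure_pmf.emeasure_space_1 simp del: One_nat_def\<close>)
  then have "\<bar>(\<integral>G. u ((real (num_copies F G) - B) / b) \<partial>random_graph D n m) - (\<integral>\<omega>. C \<omega> \<partial>PD m)\<bar> = \<bar>\<integral>\<omega>. A \<omega> - C \<omega> \<partial>PD m\<bar>"
    using intA intC by simp
  also have "\<dots> \<le> (\<integral>\<omega>. \<bar>A \<omega> - C \<omega>\<bar> \<partial>PD m)" by (rule integral_abs_bound)
  also have "\<dots> \<le> (\<integral>\<omega>. U \<omega> \<partial>PD m)"
    using point intA intC intU by (intro integral_mono) auto
  also have "\<dots> = total_error L n m T \<delta> b"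
    unfolding U_def total_error_def using I1 I2 I3 P.prob_space by (simp del: One_nat_def)
  finally show ?thesis by (simp add: C_def)
qed

end

section \<open>Asymptotics\<close>

lemma cos_lipschitz: "\<bar>cos x - cos y\<bar> \<le> \<bar>x - y\<bar>" for x y :: real
proof -
  have "\<bar>cos x - cos y\<bar> = 2 * (\<bar>sin ((x + y) / 2)\<bar> * \<bar>sin ((y - x) / 2)\<bar>)"
    by (simp add: cos_diff_cos abs_mult)
  also have "\<dots> \<le> 2 * (1 * \<bar>(y - x) / 2\<bar>)"
    by (intro mult_left_mono mult_mono abs_sin_x_le_abs_x) auto
  finally show ?thesis by (simp add: abs_minus_commute)
qed

lemma sin_lipschitz: "\<bar>sin x - sin y\<bar> \<le> \<bar>x - y\<bar>" for x y :: real
proof -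
  have "\<bar>sin x - sin y\<bar> = 2 * (\<bar>sin ((x - y) / 2)\<bar> * \<bar>cos ((x + y) / 2)\<bar>)"
    by (simp add: sin_diff_sin abs_mult)
  also have "\<dots> \<le> 2 * (\<bar>(x - y) / 2\<bar> * 1)"
    by (intro mult_left_mono mult_mono abs_sin_x_le_abs_x) auto
  finally show ?thesis by simp
qed

lemma Re_Im_char_distr:
  assumes "prob_space P" and [measurable]: "f \<in> borel_measurable P"
  shows "Re (char (distr P borel f) t) = (\<integral>x. cos (t * f x) \<partial>P)"
    and "Im (char (distr P borel f) t) = (\<integral>x. sin (t * f x) \<partial>P)"
proof -
  interpret prob_space P by fact
  have int: "complex_integrable P (\<lambda>x. iexp (t * f x))"
    by (rule integrable_const_bound[where B = 1]) auto
  have c: "char (distr P borel f) t = (CLINT x|P. iexp (t * f x))"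
    unfolding char_def by (subst integral_distr) auto
  have "Re (CLINT x|P. iexp (t * f x)) = (\<integral>x. Re (iexp (t * f x)) \<partial>P)"
    by (rule integral_Re[OF int, symmetric])
  then show "Re (char (distr P borel f) t) = (\<integral>x. cos (t * f x) \<partial>P)"
    by (simp add: c Re_exp)
  have "Im (CLINT x|P. iexp (t * f x)) = (\<integral>x. Im (iexp (t * f x)) \<partial>P)"
    by (rule integral_Im[OF int, symmetric])
  then show "Im (char (distr P borel f) t) = (\<integral>x. sin (t * f x) \<partial>P)"
    by (simp add: c Im_exp)
qed

text \<open>Colour the vertices one at a time: a new vertex repeats one of at most
  \<open>card A\<close> colours, or takes any of the \<open>card I\<close> colours at the price of
  one more factor \<open>x\<close>. With \<open>x = 1 / n\<close> and \<open>card I = m\<close> the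
  bound stays finite as \<open>m / n\<close> converges.\<close>

lemma sum_power_card_image:
  fixes x :: real
  assumes "finite A" "finite I" and x: "0 \<le> x" "x \<le> 1"
  shows "(\<Sum>c\<in>A \<rightarrow>\<^sub>E I. x ^ card (c ` A)) \<le> (real (card I) * x + real (card A)) ^ card A"
  using assms(1)
proof (induction A rule: finite_induct)
  case empty
  then show ?case by simp
next
  case (insert a A)
  let ?y = "real (card I) * x"
  have y0: "0 \<le> ?y" using x by simp
  have step: "(\<Sum>i\<in>I. x ^ card (insert i (c ` A))) \<le> (?y + real (card A)) * x ^ card (c ` A)" for c
  proof -
    have "(\<Sum>i\<in>I. x ^ card (insert i (c ` A))) \<le> (\<Sum>i\<in>I. (if i \<in> c ` A then 1 else 0) * x ^ card (c ` A) + x * x ^ card (c ` A))"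
      using insert.hyps x by (intro sum_mono) (auto simp: card_insert_if)
    also have "\<dots> = real (card (I \<inter> c ` A)) * x ^ card (c ` A) + ?y * x ^ card (c ` A)"
      using assms(2) by (simp add: sum.distrib sum_distrib_right[symmetric] sum.If_cases Int_def)
    also have "\<dots> \<le> real (card A) * x ^ card (c ` A) + ?y * x ^ card (c ` A)"
    proof -
      have "card (I \<inter> c ` A) \<le> card (c ` A)" using insert.hyps by (intro card_mono) auto
      also have "\<dots> \<le> card A" using insert.hyps by (intro card_image_le)
      finally show ?thesis using x by (intro add_right_mono mult_right_mono) auto
    qed
    finally show ?thesis by (simp add: algebra_simps)
  qed
  have "(\<Sum>c\<in>insert a A \<rightarrow>\<^sub>E I. x ^ card (c ` insert a A)) =
      (\<Sum>(i, c)\<in>I \<times> (A \<rightarrow>\<^sub>E I). x ^ card ((c(a := i)) ` insert a A))"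
    unfolding PiE_insert_eq using insert.hyps
    by (subst sum.reindex[OF inj_combinator]) (auto simp: case_prod_beta o_def)
  also have "\<dots> = (\<Sum>i\<in>I. \<Sum>c\<in>A \<rightarrow>\<^sub>E I. x ^ card ((c(a := i)) ` insert a A))"
    by (rule sum.cartesian_product[symmetric])
  also have "\<dots> = (\<Sum>c\<in>A \<rightarrow>\<^sub>E I. \<Sum>i\<in>I. x ^ card ((c(a := i)) ` insert a A))"
    by (rule sum.swap)
  also have "\<dots> = (\<Sum>c\<in>A \<rightarrow>\<^sub>E I. \<Sum>i\<in>I. x ^ card (insert i (c ` A)))"
  proof (intro sum.cong refl)
    fix c i
    have "(c(a := i)) ` A = c ` A" using insert.hyps by (intro image_cong) auto
    then have "(c(a := i)) ` insert a A = insert i (c ` A)" by (simp only: image_insert fun_upd_same)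
    then show "x ^ card ((c(a := i)) ` insert a A) = x ^ card (insert i (c ` A))" by (simp only:)
  qed
  also have "\<dots> \<le> (\<Sum>c\<in>A \<rightarrow>\<^sub>E I. (?y + real (card A)) * x ^ card (c ` A))"
    by (intro sum_mono step)
  also have "\<dots> = (?y + real (card A)) * (\<Sum>c\<in>A \<rightarrow>\<^sub>E I. x ^ card (c ` A))"
    by (simp add: sum_distrib_left)
  also have "\<dots> \<le> (?y + real (card A)) * (?y + real (card A)) ^ card A"
    using y0 by (intro mult_left_mono insert.IH) auto
  also have "\<dots> \<le> (?y + real (card (insert a A))) ^ card (insert a A)"
    using insert.hyps y0 by (simp add: mult_mono power_mono)
  finally show ?case .
qed

context community_law
begin

abbreviation "\<mu> \<equiv> distr D borel mean_copies"

lemma real_distribution_mu: "real_distribution \<mu>"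
  by (rule D.real_distribution_distr) simp

text \<open>The independent sum is represented on the product space that also drives the random
  graph. This couples the two counts and makes them comparable integrand by integrand.\<close>

lemma char_normalized_sum_PD:
  "char (normalized_sum \<mu> \<alpha> B m) t =
     char (distr (PD m) borel (\<lambda>\<omega>. ((\<Sum>i\<in>{1..m}. mean_copies (\<omega> i)) - B m) / real m powr (1 / \<alpha>))) t"
proof -
  let ?b = "real m powr (1 / \<alpha>)"
  have [measurable]: "(\<lambda>\<omega>. \<Sum>i\<in>{1..m}. mean_copies (\<omega> i)) \<in> borel_measurable (PD m)" by measurable
  have "char (distr (PD m) borel (\<lambda>\<omega>. ((\<Sum>i\<in>{1..m}. mean_copies (\<omega> i)) - B m) / ?b)) t =
    char (distr (distr (PD m) borel (\<lambda>\<omega>. \<Sum>i\<in>{1..m}. mean_copies (\<omega> i))) borel (\<lambda>x. (1 / ?b) * x + - B m / ?b)) t"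
    by (subst distr_distr) (auto simp: o_def diff_divide_distrib)
  also have "\<dots> = iexp (- (t * B m / ?b)) * char \<mu> (t / ?b) ^ m"
    by (subst char_affine, simp, subst char_sum_PiM_distr[OF probD]) auto
  finally show ?thesis unfolding char_normalized_sum[OF real_distribution_mu] by simp
qed

lemma real_distribution_normalized_copies: "real_distribution (normalized_copies F D \<alpha> B n m)"
  unfolding normalized_copies_def
  by (rule prob_space.real_distribution_distr[OF random_graph(1)[OF probD setsD]])
     (simp add: measurable_def random_graph(2)[OF probD setsD])

text \<open>Cosine and sine of \<open>t * x\<close> are bounded by 1 with Lipschitz constant
  \<open>\<bar>t\<bar>\<close>, so both parts of the characteristic function fall under the
  integrated bound; the factor 2 adds the two.\<close>

lemma char_difference:
  assumes n: "n > 0" and m: "m > 0" and \<delta>: "\<delta> > 0"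
  shows "norm (char (normalized_copies F D \<alpha> B n m) t - char (normalized_sum \<mu> \<alpha> B m) t)
     \<le> 2 * total_error \<bar>t\<bar> n m T \<delta> (real m powr (1 / \<alpha>))"
proof -
  let ?b = "real m powr (1 / \<alpha>)"
  let ?f = "\<lambda>G. (real (num_copies F G) - B m) / ?b"
  let ?g = "\<lambda>\<omega>. ((\<Sum>i\<in>{1..m}. mean_copies (\<omega> i)) - B m) / ?b"
  have b: "?b > 0" using m by simp
  have f: "?f \<in> borel_measurable (random_graph D n m)"
    by (simp add: measurable_def random_graph(2)[OF probD setsD])
  have g: "?g \<in> borel_measurable (PD m)" by measurable
  note R = Re_Im_char_distr[OF random_graph(1)[OF probD setsD] f, of t, folded normalized_copies_def]
  note S = Re_Im_char_distr[OF prob_PD g, of t, folded char_normalized_sum_PD]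
  have lip: "\<bar>t * x - t * y\<bar> = \<bar>t\<bar> * \<bar>x - y\<bar>" for x y
    by (simp add: right_diff_distrib[symmetric] abs_mult)
  have "\<bar>(\<integral>G. cos (t * ?f G) \<partial>random_graph D n m) - (\<integral>\<omega>. cos (t * ?g \<omega>) \<partial>PD m)\<bar> \<le> total_error \<bar>t\<bar> n m T \<delta> ?b"
    by (rule integrated_error_bound[OF n b \<delta>, where u = "\<lambda>x. cos (t * x)"])
       (use cos_lipschitz lip in \<open>auto intro: order_trans\<close>, metis cos_lipschitz lip)
  moreover have "\<bar>(\<integral>G. sin (t * ?f G) \<partial>random_graph D n m) - (\<integral>\<omega>. sin (t * ?g \<omega>) \<partial>PD m)\<bar> \<le> total_error \<bar>t\<bar> n m T \<delta> ?b"
    by (rule integrated_error_bound[OF n b \<delta>, where u = "\<lambda>x. sin (t * x)"])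
       (use sin_lipschitz lip in \<open>auto intro: order_trans\<close>, metis sin_lipschitz lip)
  ultimately show ?thesis
    using cmod_le[of "char (normalized_copies F D \<alpha> B n m) t - char (normalized_sum \<mu> \<alpha> B m) t"]
    unfolding minus_complex.sel R S by linarith
qed

lemma class_size_sum: "(\<Sum>j\<in>c ` V. class_size c j) = card V"
proof -
  have "card V = card (\<Union>j\<in>c ` V. {u \<in> V. c u = j})"
    by (rule arg_cong[where f = card]) auto
  also have "\<dots> = (\<Sum>j\<in>c ` V. card {u \<in> V. c u = j})"
    by (rule card_UN_disjoint) auto
  finally show ?thesis by (simp add: class_size_def)
qed

text \<open>A class has fewer members than endpoints and there are at most \<open>card V\<close>
  endpoints, so its size lies in the range covered by the moment conditions. In particular, a spread
  colouring is never constant.\<close>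

lemma class_size_bounds:
  assumes ec: "(e, c) \<in> spread_systems I" and j: "j \<in> c ` V"
  shows "1 \<le> class_size c j" "class_size c j \<le> card V - 1"
proof -
  obtain u where "u \<in> {u \<in> V. c u = j}" using j by auto
  then have "{u \<in> V. c u = j} \<noteq> {}" by blast
  then show "1 \<le> class_size c j" by (simp add: class_size_def Suc_le_eq card_gt_0_iff)
  have "e u \<subseteq> V" if "u \<in> V" for u
    using ec that simple_graph_edgeD(1)[OF simple, of "e u"] by (auto simp: spread_systems_def)
  then have "card (\<Union>u\<in>{u \<in> V. c u = j}. e u) \<le> card V" by (intro card_mono) auto
  then show "class_size c j \<le> card V - 1"
    using ec j by (auto simp: spread_systems_def spread_def class_size_def)
qed

end

section \<open>Orders of magnitude under the tail and moment conditions\<close>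

locale critical_law = community_law F D for F :: "'v graph" and D +
  fixes \<alpha> a :: real
  assumes heavy: "heavy_tail \<mu> \<alpha> a" and \<alpha>2: "\<alpha> < 2"
    and mean: "integrable D (\<lambda>w. real (fst w))"
    and moments: "\<And>s. s \<in> {1..card V - 1} \<Longrightarrow>
      integrable D (\<lambda>w. real (fst w) powr (1 + real s * (1 - 1 / (\<alpha> * real (card E)))) * snd w ^ s)"
begin

sublocale heavy_tail \<mu> \<alpha> a by (rule heavy)

definition scaled_weight :: "nat \<Rightarrow> nat \<Rightarrow> real" where
  "scaled_weight s n = real n powr (1 + real s - real s / (\<alpha> * real (card E))) * (\<integral>w. edge_weight n s w \<partial>D)"

text \<open>With \<open>r = s / (\<alpha> * e)\<close> the scaled integrand is
  \<open>Z w * (x / n) powr r\<close> on \<open>x \<le> n\<close>, where \<open>Z\<close> is the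
  integrable variable of the moment condition. The last factor is at most 1 and tends to 0, so
  dominated convergence gives convergence to 0 instead of mere boundedness.\<close>

lemma scaled_weight_tendsto:
  assumes s: "s \<in> {1..card V - 1}"
  shows "scaled_weight s \<longlonglongrightarrow> 0"
proof -
  define r where "r = real s / (\<alpha> * real (card E))"
  have eE: "card E > 0" using edges_pos(1)[OF simple two_conn card3] by simp
  have r: "r > 0" using s \<alpha>_pos eE by (simp add: r_def)
  define Z where "Z w = real (fst w) powr (1 + real s * (1 - 1 / (\<alpha> * real (card E)))) * snd w ^ s" for w :: "nat \<times> real"
  have exponent: "1 + real s * (1 - 1 / (\<alpha> * real (card E))) = real (Suc s) - r"
    by (simp add: r_def algebra_simps)
  have "(\<lambda>n. \<integral>w. real n powr (1 + real s - r) * edge_weight n s w \<partial>D) \<longlonglongrightarrow> (\<integral>w. 0 \<partial>D)"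
  proof (rule integral_dominated_convergence[where w = "\<lambda>w. norm (Z w)"])
    have eq: "real n powr (1 + real s - r) * edge_weight n s w =
        (if fst w \<le> n \<and> 0 \<le> snd w \<and> snd w \<le> 1 then Z w * (real (fst w) / real n) powr r else 0)" for n w
    proof (cases "fst w = 0 \<or> n = 0")
      case True
      then show ?thesis using r by (auto simp: edge_weight_def Z_def)
    next
      case False
      then have pos: "real (fst w) > 0" "real n > 0" by auto
      have "real n powr (1 + real s - r) * ((real (fst w) / real n) ^ Suc s * snd w ^ s) = Z w * (real (fst w) / real n) powr r"
      proof -
        have "real n powr (1 + real s - r) = real n ^ Suc s / real n powr r"
          using pos powr_diff[of "real n" "real (Suc s)" r] powr_realpow[of "real n" "Suc s"] by (simp add: add_ac)
        moreover have "Z w = real (fst w) ^ Suc s / real (fst w) powr r * snd w ^ s"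
          unfolding Z_def exponent using pos powr_realpow[of "real (fst w)" "Suc s"] by (simp add: powr_diff)
        ultimately show ?thesis using pos by (simp add: powr_divide power_divide del: power_Suc)
      qed
      then show ?thesis by (simp add: edge_weight_def del: power_Suc)
    qed
    show "AE w in D. (\<lambda>n. real n powr (1 + real s - r) * edge_weight n s w) \<longlonglongrightarrow> 0"
    proof (intro AE_I2)
      fix w :: "nat \<times> real"
      have "(\<lambda>n. real (fst w) / real n) \<longlonglongrightarrow> 0" by (rule lim_const_over_n)
      then have "(\<lambda>n. (real (fst w) / real n) powr r) \<longlonglongrightarrow> 0 powr r"
        using r by (intro tendsto_powr2) auto
      then have lim: "(\<lambda>n. norm (Z w) * (real (fst w) / real n) powr r) \<longlonglongrightarrow> 0"
        using r by (intro tendsto_mult_right_zero) simp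
      show "(\<lambda>n. real n powr (1 + real s - r) * edge_weight n s w) \<longlonglongrightarrow> 0"
        by (rule Lim_null_comparison[OF _ lim]) (auto simp: eq abs_mult)
    qed
    show "AE w in D. norm (real n powr (1 + real s - r) * edge_weight n s w) \<le> norm (Z w)" for n
    proof (intro AE_I2)
      fix w :: "nat \<times> real"
      have "(real (fst w) / real n) powr r \<le> 1" if "fst w \<le> n"
        using that r by (intro powr_le1) (auto simp: divide_le_eq_1)
      then have "\<bar>Z w\<bar> * (real (fst w) / real n) powr r \<le> \<bar>Z w\<bar> * 1" if "fst w \<le> n"
        using that by (intro mult_left_mono) auto
      then show "norm (real n powr (1 + real s - r) * edge_weight n s w) \<le> norm (Z w)"
        unfolding eq by (auto simp: abs_mult)
    qed
    show "integrable D (\<lambda>w. norm (Z w))" unfolding Z_def[abs_def] by (intro integrable_norm moments s)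
  qed auto
  then show ?thesis by (simp add: scaled_weight_def[abs_def] r_def)
qed

lemma scaled_weight_nonneg: "0 \<le> scaled_weight s n"
  unfolding scaled_weight_def using edge_weight_bounds by (intro mult_nonneg_nonneg integral_nonneg) auto

end

context critical_law
begin

lemma edge_integral_eq:
  assumes "n > 0"
  shows "(\<integral>w. edge_weight n s w \<partial>D) = scaled_weight s n * real n powr (- 1 - real s + real s / (\<alpha> * real (card E)))"
proof -
  have "real n powr (1 + real s - real s / (\<alpha> * real (card E))) * real n powr (- 1 - real s + real s / (\<alpha> * real (card E))) = 1"
    using assms by (simp add: powr_add[symmetric])
  then show ?thesis by (simp add: scaled_weight_def mult_ac)
qed

definition weight_bound :: "nat \<Rightarrow> real" where
  "weight_bound n = (\<Sum>s\<in>{1..card V - 1}. scaled_weight s n)"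

lemma weight_bound_tendsto: "weight_bound \<longlonglongrightarrow> 0"
  unfolding weight_bound_def[abs_def] by (rule tendsto_null_sum) (rule scaled_weight_tendsto)

lemma scaled_weight_le: "s \<in> {1..card V - 1} \<Longrightarrow> scaled_weight s n \<le> weight_bound n"
  unfolding weight_bound_def by (rule member_le_sum) (auto simp: scaled_weight_nonneg)

lemma weight_bound_nonneg: "0 \<le> weight_bound n"
  unfolding weight_bound_def by (intro sum_nonneg scaled_weight_nonneg)

text \<open>One of the scaled weights supplies the null factor, the others are at most 1. In the
  exponents the class sizes add up to \<open>card V\<close>, and each colour leaves one factor
  \<open>1 / n\<close> over, later balanced against the \<open>m\<close> choices of a
  colour.\<close>

lemma spread_product_le:
  assumes ec: "(e, c) \<in> spread_systems {1..m}" and n: "n > 0" and w: "weight_bound n \<le> 1"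
  shows "(\<Prod>j\<in>c ` V. \<integral>w. edge_weight n (class_size c j) w \<partial>D)
    \<le> weight_bound n * (real n powr (- real (card V) + real (card V) / (\<alpha> * real (card E))) * (1 / real n) ^ card (c ` V))"
proof -
  define J where "J = c ` V"
  define q where "q = 1 / (\<alpha> * real (card E))"
  have J: "finite J" "J \<noteq> {}" using card3 by (auto simp: J_def)
  have s: "class_size c j \<in> {1..card V - 1}" if "j \<in> J" for j
    using class_size_bounds[OF ec] that by (auto simp: J_def)
  have "(\<Prod>j\<in>J. \<integral>w. edge_weight n (class_size c j) w \<partial>D) =
      (\<Prod>j\<in>J. scaled_weight (class_size c j) n) * (\<Prod>j\<in>J. real n powr (- 1 - real (class_size c j) + real (class_size c j) * q))"
    unfolding edge_integral_eq[OF n] by (simp add: prod.distrib q_def)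
  also have "(\<Prod>j\<in>J. real n powr (- 1 - real (class_size c j) + real (class_size c j) * q)) =
      real n powr (\<Sum>j\<in>J. - 1 - real (class_size c j) + real (class_size c j) * q)"
    using n J by (intro powr_sum[symmetric]) auto
  also have "(\<Sum>j\<in>J. - 1 - real (class_size c j) + real (class_size c j) * q) = - real (card J) - real (card V) + real (card V) * q"
  proof -
    have "(\<Sum>j\<in>J. real (class_size c j)) = real (card V)"
      using class_size_sum[of c] by (simp add: J_def flip: of_nat_sum)
    then show ?thesis by (simp add: sum.distrib sum_subtractf sum_distrib_right[symmetric])
  qed
  also have "real n powr (- real (card J) - real (card V) + real (card V) * q) =
      real n powr (- real (card V) + real (card V) * q) * (1 / real n) ^ card J"
  proof -
    have "real n powr (- real (card J)) = (1 / real n) ^ card J"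
      using n by (simp add: powr_minus powr_realpow power_divide divide_inverse power_inverse)
    moreover have "- real (card J) - real (card V) + real (card V) * q = (- real (card V) + real (card V) * q) + - real (card J)"
      by simp
    ultimately show ?thesis by (simp only: powr_add)
  qed
  also have "(\<Prod>j\<in>J. scaled_weight (class_size c j) n) \<le> weight_bound n"
  proof -
    obtain j where j: "j \<in> J" using J by blast
    have "(\<Prod>j\<in>J. scaled_weight (class_size c j) n) = scaled_weight (class_size c j) n * (\<Prod>i\<in>J - {j}. scaled_weight (class_size c i) n)"
      by (rule prod.remove[OF J(1) j])
    also have "\<dots> \<le> weight_bound n * 1"
    proof (rule mult_mono)
      show "(\<Prod>i\<in>J - {j}. scaled_weight (class_size c i) n) \<le> 1"
        using s by (intro prod_le_1 conjI scaled_weight_nonneg order_trans[OF scaled_weight_le w]) auto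
    qed (auto intro: scaled_weight_le s j prod_nonneg scaled_weight_nonneg weight_bound_nonneg)
    finally show ?thesis by simp
  qed
  finally show ?thesis by (simp add: J_def q_def mult_right_mono)
qed

lemma spread_sum_le:
  assumes n: "n > 0" and w: "weight_bound n \<le> 1"
  shows "real n ^ card V * (\<Sum>(e, c)\<in>spread_systems {1..m}. \<Prod>j\<in>c ` V. \<integral>w. edge_weight n (class_size c j) w \<partial>D)
    \<le> weight_bound n * real n powr (1 / \<alpha>) * (real (card E) ^ card V * (real m / real n + real (card V)) ^ card V)"
proof -
  let ?p = "real n powr (- real (card V) + real (card V) / (\<alpha> * real (card E)))"
  have "(\<Sum>(e, c)\<in>spread_systems {1..m}. \<Prod>j\<in>c ` V. \<integral>w. edge_weight n (class_size c j) w \<partial>D)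
      \<le> (\<Sum>(e, c)\<in>spread_systems {1..m}. weight_bound n * (?p * (1 / real n) ^ card (c ` V)))"
    using spread_product_le[OF _ n w] by (intro sum_mono) (auto simp del: One_nat_def)
  \<comment> \<open>Enlarging to all pairs lets the sums over \<open>e\<close> and \<open>c\<close>
    separate; the terms depend on \<open>c\<close> only through its number of colours.\<close>
  also have "\<dots> \<le> (\<Sum>(e, c)\<in>(V \<rightarrow>\<^sub>E E) \<times> (V \<rightarrow>\<^sub>E {1..m}). weight_bound n * (?p * (1 / real n) ^ card (c ` V)))"
    by (intro sum_mono2) (auto simp: spread_systems_def weight_bound_nonneg intro!: finite_PiE mult_nonneg_nonneg)
  also have "\<dots> = (\<Sum>e\<in>V \<rightarrow>\<^sub>E E. weight_bound n * ?p * (\<Sum>c\<in>V \<rightarrow>\<^sub>E {1..m}. (1 / real n) ^ card (c ` V)))"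
    by (simp only: sum.cartesian_product[symmetric] sum_distrib_left mult.assoc)
  also have "\<dots> = real (card E) ^ card V * (weight_bound n * ?p * (\<Sum>c\<in>V \<rightarrow>\<^sub>E {1..m}. (1 / real n) ^ card (c ` V)))"
    by (simp add: card_PiE)
  also have "\<dots> \<le> real (card E) ^ card V * (weight_bound n * ?p * (real m / real n + real (card V)) ^ card V)"
    using sum_power_card_image[of V "{1..m}" "1 / real n"] n weight_bound_nonneg
    by (intro mult_left_mono mult_nonneg_nonneg) auto
  finally have "real n ^ card V * (\<Sum>(e, c)\<in>spread_systems {1..m}. \<Prod>j\<in>c ` V. \<integral>w. edge_weight n (class_size c j) w \<partial>D)
      \<le> real n ^ card V * (real (card E) ^ card V * (weight_bound n * ?p * (real m / real n + real (card V)) ^ card V))"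
    by (intro mult_left_mono) auto
  also have "\<dots> = (real n ^ card V * ?p) * (real (card E) ^ card V * (weight_bound n * (real m / real n + real (card V)) ^ card V))"
    by (simp only: mult_ac)
  also have "\<dots> \<le> real n powr (1 / \<alpha>) * (real (card E) ^ card V * (weight_bound n * (real m / real n + real (card V)) ^ card V))"
  proof (rule mult_right_mono)
    have "real n ^ card V * ?p = real n powr (real (card V) / (\<alpha> * real (card E)))"
      using n by (simp add: powr_realpow[symmetric] powr_add[symmetric])
    also have "\<dots> \<le> real n powr (1 / \<alpha>)"
    proof (rule powr_mono)
      have "card V \<le> card E" by (rule verts_le_edges[OF simple two_conn card3])
      then show "real (card V) / (\<alpha> * real (card E)) \<le> 1 / \<alpha>"
        using \<alpha>_pos card3 by (simp add: field_simps)
    qed (use n in simp)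
    finally show "real n ^ card V * ?p \<le> real n powr (1 / \<alpha>)" .
  qed (use weight_bound_nonneg in simp)
  finally show ?thesis by (simp only: mult_ac)
qed

text \<open>Markov's inequality on the event \<open>n < x\<close> itself: the truncated mean tends
  to 0, so this probability is \<open>o(1 / n)\<close> and remains negligible after multiplication
  by \<open>m\<close>. The full mean would leave only a bounded term.\<close>

lemma prob_not_good_le:
  assumes n: "n > 0" and K: "K > 0"
  shows "measure D {w \<in> space D. \<not> good n K w}
    \<le> (\<integral>w. real (fst w) * indicator {w. n < fst w} w \<partial>D) / real n + tailC * K powr - \<alpha>"
proof -
  have int: "integrable D (\<lambda>w. real (fst w) * indicator {w. n < fst w} w)"
    by (rule Bochner_Integration.integrable_bound[OF mean]) (auto simp: indicator_def)
  have "measure D {w \<in> space D. \<not> good n K w} \<le> measure D ({w \<in> space D. n < fst w} \<union> {w \<in> space D. K < mean_copies w})"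
  proof (rule D.finite_measure_mono_AE)
    show "AE w in D. w \<in> {w \<in> space D. \<not> good n K w} \<longrightarrow> w \<in> {w \<in> space D. n < fst w} \<union> {w \<in> space D. K < mean_copies w}"
      using unitD by eventually_elim (auto simp: good_def)
  qed measurable
  also have "\<dots> \<le> measure D {w \<in> space D. n < fst w} + measure D {w \<in> space D. K < mean_copies w}"
    by (rule measure_Un_le) measurable
  also have "measure D {w \<in> space D. K < mean_copies w} = measure \<mu> {K<..}"
    by (subst measure_distr) (auto intro!: arg_cong[where f = "measure D"])
  also have "\<dots> \<le> tailC * K powr - \<alpha>" by (rule tailC(2)[OF K])
  also have "measure D {w \<in> space D. n < fst w} \<le> (\<integral>w. real (fst w) * indicator {w. n < fst w} w \<partial>D) / real n"
  proof -
    have "measure D {w \<in> space D. n < fst w} = (\<integral>w. indicator {w \<in> space D. n < fst w} w \<partial>D)" by simp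
    also have "\<dots> \<le> (\<integral>w. real (fst w) * indicator {w. n < fst w} w / real n \<partial>D)"
    proof (rule integral_mono)
      show "integrable D (indicator {w \<in> space D. n < fst w} :: _ \<Rightarrow> real)"
        by (rule integrable_real_indicator) (auto simp: D.emeasure_eq_measure)
      show "integrable D (\<lambda>w. real (fst w) * indicator {w. n < fst w} w / real n)" using int by simp
    qed (use n in \<open>auto simp: indicator_def\<close>)
    finally show ?thesis by simp
  qed
  finally show ?thesis by simp
qed

lemma truncated_mean_tendsto: "(\<lambda>n. \<integral>w. real (fst w) * indicator {w. n < fst w} w \<partial>D) \<longlonglongrightarrow> 0"
proof -
  have "(\<lambda>n. \<integral>w. real (fst w) * indicator {w. n < fst w} w \<partial>D) \<longlonglongrightarrow> (\<integral>w. 0 \<partial>D)"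
  proof (rule integral_dominated_convergence[OF _ _ mean])
    show "AE w in D. (\<lambda>n. real (fst w) * indicator {w. n < fst w} w) \<longlonglongrightarrow> 0"
    proof (intro AE_I2)
      fix w :: "nat \<times> real"
      have "eventually (\<lambda>n. real (fst w) * indicator {w. n < fst w} w = 0) sequentially"
        using eventually_ge_at_top[of "fst w"] by eventually_elim auto
      then show "(\<lambda>n. real (fst w) * indicator {w. n < fst w} w) \<longlonglongrightarrow> 0"
        by (rule tendsto_eventually)
    qed
    show "AE w in D. norm (real (fst w) * indicator {w. n < fst w} w) \<le> real (fst w)" for n
      by (intro AE_I2) (auto simp: indicator_def)
  qed auto
  then show ?thesis by simp
qed

text \<open>Between 1 and \<open>K\<close> a power of order \<open>\<beta>\<close> is at most
  \<open>K powr (\<beta> - g)\<close> times one of order \<open>g\<close>, and order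
  \<open>g < \<alpha>\<close> has a finite mean. Values up to 1 account for the extra
  constant.\<close>

lemma var_integral_le:
  assumes g: "0 < g" "g < \<alpha>" and \<beta>: "2 - 1 / real (card E) \<le> \<beta>" "g \<le> \<beta>" and K: "K > 0"
  shows "(\<integral>w. var_weight K w \<partial>D) \<le> var_const * (2 + K powr (\<beta> - g) * (\<integral>x. x powr g \<partial>\<mu>))"
proof -
  have int: "integrable D (\<lambda>w. mean_copies w powr g)"
    using powr_integrable[OF g] by (simp add: integrable_distr_eq)
  have "(\<integral>w. var_weight K w \<partial>D) \<le> (\<integral>w. var_const * (2 + K powr (\<beta> - g) * mean_copies w powr g) \<partial>D)"
  proof (rule integral_mono)
    fix w
    have "mean_copies w powr (2 - 1 / card E) \<le> 1 + K powr (\<beta> - g) * mean_copies w powr g" if w: "0 \<le> mean_copies w" "mean_copies w \<le> K"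
    proof (cases "mean_copies w \<le> 1")
      case True
      then have "mean_copies w powr (2 - 1 / card E) \<le> 1"
        using w edges_pos(1)[OF simple two_conn card3] by (intro powr_le1) (auto simp: field_simps)
      then show ?thesis by (simp add: add_increasing2)
    next
      case False
      then have "mean_copies w powr (2 - 1 / card E) \<le> mean_copies w powr \<beta>" using \<beta> by (intro powr_mono) auto
      also have "\<dots> = mean_copies w powr (\<beta> - g) * mean_copies w powr g" by (simp add: powr_add[symmetric])
      also have "\<dots> \<le> K powr (\<beta> - g) * mean_copies w powr g" using w \<beta> by (intro mult_right_mono powr_mono2) auto
      finally show ?thesis by simp
    qed
    then show "var_weight K w \<le> var_const * (2 + K powr (\<beta> - g) * mean_copies w powr g)"
      unfolding var_weight_def using var_const_pos by (auto intro!: mult_left_mono add_nonneg_nonneg)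
  qed (use int in auto)
  also have "\<dots> = var_const * (2 + K powr (\<beta> - g) * (\<integral>w. mean_copies w powr g \<partial>D))"
    using int D.prob_space by simp
  also have "(\<integral>w. mean_copies w powr g \<partial>D) = (\<integral>x. x powr g \<partial>\<mu>)" by (simp add: integral_distr)
  finally show ?thesis .
qed

text \<open>The truncation level \<open>K = m powr \<theta>\<close> lies slightly above the order \<open>m powr (1 / \<alpha>)\<close>
  of the largest summand, low enough for the truncated variances to sum up to
  \<open>o(m powr (2 / \<alpha>))\<close>.\<close>

lemma truncation_exponents:
  obtains \<theta> g \<beta> where "0 < g" "g < \<alpha>" "2 - 1 / real (card E) \<le> \<beta>" "g \<le> \<beta>" "1 < \<theta> * \<alpha>"
    "1 + \<theta> * (\<beta> - g) - 2 / \<alpha> < 0"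
proof -
  \<comment> \<open>The maximum with \<open>\<alpha>\<close> secures \<open>g \<le> \<beta>\<close>
    even if \<open>2 - 1 / e\<close> lies below \<open>\<alpha>\<close>; \<open>\<beta>\<close> is
    still below 2, and \<open>z\<close> is the room left. The loss \<open>d\<close> in the moment
    and the loss through \<open>\<eta>\<close> take at most a quarter of \<open>z\<close> each; the
    12 is 4 times 3, where 3 bounds \<open>\<beta> - (\<alpha> - d)\<close>.\<close>
  define \<beta> where "\<beta> = max (2 - 1 / real (card E)) \<alpha>"
  define z where "z = 2 - \<beta>"
  define d where "d = min (z / 4) (\<alpha> / 2)"
  define \<eta> where "\<eta> = z / 12"
  have eE: "card E > 0" using edges_pos(1)[OF simple two_conn card3] by simp
  have z: "z > 0" using \<alpha>2 eE by (simp add: z_def \<beta>_def)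
  have d: "d > 0" "d \<le> z / 4" "d \<le> \<alpha> / 2" "d \<le> 1" using z \<alpha>_pos \<alpha>2 by (auto simp: d_def)
  have \<beta>: "\<alpha> \<le> \<beta>" "\<beta> < 2" using z by (auto simp: \<beta>_def z_def)
  have "\<eta> * (\<beta> - (\<alpha> - d)) \<le> \<eta> * 3" using z d \<beta> \<alpha>_pos by (intro mult_left_mono) (auto simp: \<eta>_def)
  then have neg: "\<alpha> + (1 + \<eta>) * (\<beta> - (\<alpha> - d)) - 2 < 0"
  proof -
    have "\<alpha> + (1 + \<eta>) * (\<beta> - (\<alpha> - d)) - 2 = d + \<eta> * (\<beta> - (\<alpha> - d)) - z"
      by (simp add: z_def algebra_simps)
    moreover have "\<eta> * 3 = z / 4" by (simp add: \<eta>_def)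
    ultimately show ?thesis using \<open>\<eta> * (\<beta> - (\<alpha> - d)) \<le> \<eta> * 3\<close> z d by linarith
  qed
  have "1 + (1 + \<eta>) / \<alpha> * (\<beta> - (\<alpha> - d)) - 2 / \<alpha> = (\<alpha> + (1 + \<eta>) * (\<beta> - (\<alpha> - d)) - 2) / \<alpha>"
    using \<alpha>_pos by (simp add: field_simps)
  also have "\<dots> < 0" using neg \<alpha>_pos by (simp add: divide_neg_pos)
  finally have "1 + (1 + \<eta>) / \<alpha> * (\<beta> - (\<alpha> - d)) - 2 / \<alpha> < 0" .
  then show ?thesis
    using that[of "\<alpha> - d" \<beta> "(1 + \<eta>) / \<alpha>"] d \<beta> z \<alpha>_pos by (auto simp: \<beta>_def \<eta>_def)
qed

text \<open>The level \<open>K\<close> is fixed before \<open>L\<close> and \<open>\<delta>\<close>.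
  The bad communities (\<open>e1\<close>), the spread systems (\<open>e2\<close>) and the truncated
  variances (\<open>e3\<close>) vanish in the limit for every fixed \<open>\<delta>\<close>, which
  leaves \<open>L * \<delta>\<close>; the further \<open>\<delta>\<close> is slack.\<close>

lemma total_error_tendsto:
  fixes n m :: "nat \<Rightarrow> nat"
  assumes n: "filterlim n at_top sequentially" and m: "filterlim m at_top sequentially"
    and \<nu>: "(\<lambda>k. real (m k) / real (n k)) \<longlonglongrightarrow> \<nu>" "\<nu> > 0"
  obtains K where "\<And>L \<delta>. \<delta> > 0 \<Longrightarrow> L \<ge> 0 \<Longrightarrow> eventually (\<lambda>k. total_error L (n k) (m k) (K k) \<delta> (real (m k) powr (1 / \<alpha>)) < L * \<delta> + \<delta>) sequentially"
proof -
  obtain \<theta> g \<beta> where ex: "0 < g" "g < \<alpha>" "2 - 1 / real (card E) \<le> \<beta>" "g \<le> \<beta>" "1 < \<theta> * \<alpha>"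
    "1 + \<theta> * (\<beta> - g) - 2 / \<alpha> < 0" using truncation_exponents .
  define K where "K k = real (m k) powr \<theta>" for k
  define b where "b k = real (m k) powr (1 / \<alpha>)" for k
  have pos: "eventually (\<lambda>k. n k > 0 \<and> m k > 0) sequentially"
    using eventually_compose_filterlim[OF eventually_gt_at_top n, of 0]
      eventually_compose_filterlim[OF eventually_gt_at_top m, of 0] by (rule eventually_conj)
  have mr: "filterlim (\<lambda>k. real (m k)) at_top sequentially"
    by (rule filterlim_compose[OF filterlim_real_sequentially m])
  have m_powr: "(\<lambda>k. real (m k) powr p) \<longlonglongrightarrow> 0" if "p < 0" for p
    by (rule tendsto_neg_powr[OF that mr])
  define tm where "tm n = (\<integral>w. real (fst w) * indicator {w. n < fst w} w \<partial>D)" for n :: nat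
  define M where "M = (\<integral>x. x powr g \<partial>\<mu>)"
  define e1 where "e1 k = real (m k) / real (n k) * tm (n k) + tailC * real (m k) powr (1 - \<theta> * \<alpha>)" for k
  define e2 where "e2 k = (real (m k) / real (n k)) powr - (1 / \<alpha>) * weight_bound (n k) *
      (real (card E) ^ card V * (real (m k) / real (n k) + real (card V)) ^ card V)" for k
  define e3 where "e3 k = var_const * (2 * real (m k) powr (1 - 2 / \<alpha>) + real (m k) powr (1 + \<theta> * (\<beta> - g) - 2 / \<alpha>) * M)" for k
  have "tm \<longlonglongrightarrow> 0" using truncated_mean_tendsto by (simp add: tm_def[abs_def])
  then have "(\<lambda>k. tm (n k)) \<longlonglongrightarrow> 0" by (rule filterlim_compose[OF _ n])
  then have e1: "e1 \<longlonglongrightarrow> \<nu> * 0 + tailC * 0"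
    unfolding e1_def[abs_def] using ex by (intro tendsto_add tendsto_mult \<nu> tendsto_const m_powr) auto
  have "(\<lambda>k. weight_bound (n k)) \<longlonglongrightarrow> 0" by (rule filterlim_compose[OF weight_bound_tendsto n])
  then have e2: "e2 \<longlonglongrightarrow> \<nu> powr - (1 / \<alpha>) * 0 * (real (card E) ^ card V * (\<nu> + real (card V)) ^ card V)"
    unfolding e2_def[abs_def] using \<nu> by (intro tendsto_intros) auto
  have "1 - 2 / \<alpha> < 0" using \<alpha>_pos \<alpha>2 by (simp add: field_simps)
  then have e3: "e3 \<longlonglongrightarrow> var_const * (2 * 0 + 0 * M)"
    unfolding e3_def[abs_def] using ex by (intro tendsto_add tendsto_mult tendsto_const m_powr) auto
  have w1: "eventually (\<lambda>k. weight_bound (n k) < 1) sequentially"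
    using filterlim_compose[OF weight_bound_tendsto n] by (rule order_tendstoD) simp
  have bound: "eventually (\<lambda>k. total_error L (n k) (m k) (K k) \<delta> (b k) \<le> 2 * e1 k + L * (e2 k + \<delta> + e3 k / \<delta>)) sequentially"
    if \<delta>: "\<delta> > 0" and L: "L \<ge> 0" for L \<delta>
    using pos w1
  proof eventually_elim
    case (elim k)
    define x where "x = real (m k)"
    define y where "y = real (n k)"
    have xy: "x > 0" "y > 0" using elim by (auto simp: x_def y_def)
    have Tk: "K k > 0" using xy by (simp add: K_def x_def[symmetric])
    have bk: "b k > 0" using xy by (simp add: b_def x_def[symmetric])
    have "x * measure D {w \<in> space D. \<not> good (n k) (K k) w} \<le> x * (tm (n k) / y + tailC * K k powr - \<alpha>)"
      unfolding tm_def y_def using elim xy Tk by (intro mult_left_mono prob_not_good_le) auto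
    also have "\<dots> = e1 k"
    proof -
      have "x * K k powr - \<alpha> = x powr (1 - \<theta> * \<alpha>)"
        using xy by (simp add: K_def x_def[symmetric] powr_powr powr_diff powr_minus field_simps)
      then show ?thesis by (simp add: e1_def x_def[symmetric] y_def[symmetric] distrib_left mult_ac)
    qed
    finally have 1: "x * measure D {w \<in> space D. \<not> good (n k) (K k) w} \<le> e1 k" .
    have "y ^ card V * (\<Sum>(e, c)\<in>spread_systems {1..m k}. \<Prod>j\<in>c ` V. \<integral>w. edge_weight (n k) (class_size c j) w \<partial>D) / b k
      \<le> weight_bound (n k) * y powr (1 / \<alpha>) * (real (card E) ^ card V * (x / y + real (card V)) ^ card V) / b k"
      unfolding y_def x_def using elim bk by (intro divide_right_mono spread_sum_le) auto
    also have "\<dots> = e2 k"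
    proof -
      have "y powr (1 / \<alpha>) / b k = (x / y) powr - (1 / \<alpha>)"
        using xy by (simp add: b_def x_def[symmetric] powr_divide powr_minus)
      moreover have "W * y powr (1 / \<alpha>) * R / b k = y powr (1 / \<alpha>) / b k * W * R" for W R by simp
      ultimately show ?thesis by (simp only: e2_def x_def[symmetric] y_def[symmetric])
    qed
    finally have 2: "y ^ card V / b k * (\<Sum>(e, c)\<in>spread_systems {1..m k}. \<Prod>j\<in>c ` V. \<integral>w. edge_weight (n k) (class_size c j) w \<partial>D) \<le> e2 k"
      by simp
    have "x * (\<integral>w. var_weight (K k) w \<partial>D) / (\<delta> * (b k)\<^sup>2) \<le> x * (var_const * (2 + K k powr (\<beta> - g) * M)) / (\<delta> * (b k)\<^sup>2)"
      unfolding M_def using xy \<delta> ex Tk by (intro divide_right_mono mult_left_mono var_integral_le) auto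
    also have "\<dots> = e3 k / \<delta>"
    proof -
      have b2: "(b k)\<^sup>2 = x powr (2 / \<alpha>)"
        using xy by (simp add: b_def x_def[symmetric] power2_eq_square powr_add[symmetric])
      have "x / (b k)\<^sup>2 = x powr (1 - 2 / \<alpha>)" using xy by (simp add: b2 powr_diff)
      moreover have "x * K k powr (\<beta> - g) / (b k)\<^sup>2 = x powr (1 + \<theta> * (\<beta> - g) - 2 / \<alpha>)"
        using xy powr_diff[of x "1 + \<theta> * (\<beta> - g)" "2 / \<alpha>"] powr_add[of x 1 "\<theta> * (\<beta> - g)"]
        by (simp only: b2 K_def x_def[symmetric] powr_powr powr_one)
      ultimately have "e3 k = var_const * (2 * (x / (b k)\<^sup>2) + x * K k powr (\<beta> - g) / (b k)\<^sup>2 * M)"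
        by (simp only: e3_def x_def[symmetric])
      also have "\<dots> = x * (var_const * (2 + K k powr (\<beta> - g) * M)) / (b k)\<^sup>2"
        by (simp add: add_divide_distrib algebra_simps)
      finally show ?thesis by simp
    qed
    finally have 3: "x * (\<integral>w. var_weight (K k) w \<partial>D) / (\<delta> * (b k)\<^sup>2) \<le> e3 k / \<delta>" .
    show ?case
      unfolding total_error_def x_def[symmetric] y_def[symmetric]
      by (intro add_mono mult_left_mono order_refl 1 2 3 L) auto
  qed
  have "eventually (\<lambda>k. total_error L (n k) (m k) (K k) \<delta> (b k) < L * \<delta> + \<delta>) sequentially"
    if \<delta>: "\<delta> > 0" and L: "L \<ge> 0" for L \<delta>
  proof -
    have "(\<lambda>k. 2 * e1 k + L * (e2 k + \<delta> + e3 k / \<delta>)) \<longlonglongrightarrow> 2 * 0 + L * (0 + \<delta> + 0 / \<delta>)"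
      using e1 e2 e3 \<delta> by (intro tendsto_intros) auto
    then have "eventually (\<lambda>k. 2 * e1 k + L * (e2 k + \<delta> + e3 k / \<delta>) < L * \<delta> + \<delta>) sequentially"
      by (rule order_tendstoD) (use \<delta> in simp)
    then show ?thesis using bound[OF \<delta> L] by eventually_elim simp
  qed
  then show ?thesis using that[of K] by (simp add: b_def)
qed

lemma char_difference_tendsto:
  fixes n m :: "nat \<Rightarrow> nat"
  assumes n: "filterlim n at_top sequentially" and m: "filterlim m at_top sequentially"
    and \<nu>: "(\<lambda>k. real (m k) / real (n k)) \<longlonglongrightarrow> \<nu>" "\<nu> > 0"
  shows "(\<lambda>k. char (normalized_copies F D \<alpha> B (n k) (m k)) t - char (normalized_sum \<mu> \<alpha> B (m k)) t) \<longlonglongrightarrow> 0"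
proof (rule tendstoI)
  fix \<epsilon> :: real assume \<epsilon>: "\<epsilon> > 0"
  obtain K where K: "\<And>L \<delta>. \<delta> > 0 \<Longrightarrow> L \<ge> 0 \<Longrightarrow> eventually (\<lambda>k. total_error L (n k) (m k) (K k) \<delta> (real (m k) powr (1 / \<alpha>)) < L * \<delta> + \<delta>) sequentially"
    using total_error_tendsto[OF assms] by blast
  \<comment> \<open>Makes \<open>2 * (\<bar>t\<bar> * \<delta> + \<delta>)\<close> equal to
    \<open>\<epsilon>\<close>, also for \<open>t = 0\<close>.\<close>
  define \<delta> where "\<delta> = \<epsilon> / (2 * (\<bar>t\<bar> + 1))"
  have \<delta>: "\<delta> > 0" using \<epsilon> by (simp add: \<delta>_def add_nonneg_pos)
  have "\<delta> * (2 * (\<bar>t\<bar> + 1)) = \<epsilon>" by (simp add: \<delta>_def add_nonneg_eq_0_iff)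
  then have eq: "2 * (\<bar>t\<bar> * \<delta> + \<delta>) = \<epsilon>" by (simp add: algebra_simps)
  have pos: "eventually (\<lambda>k. n k > 0) sequentially" "eventually (\<lambda>k. m k > 0) sequentially"
    using eventually_compose_filterlim[OF eventually_gt_at_top n, of 0]
      eventually_compose_filterlim[OF eventually_gt_at_top m, of 0] by auto
  show "eventually (\<lambda>k. dist (char (normalized_copies F D \<alpha> B (n k) (m k)) t - char (normalized_sum \<mu> \<alpha> B (m k)) t) 0 < \<epsilon>) sequentially"
    using K[OF \<delta>, of "\<bar>t\<bar>", OF abs_ge_zero] pos
  proof eventually_elim
    case (elim k)
    have "norm (char (normalized_copies F D \<alpha> B (n k) (m k)) t - char (normalized_sum \<mu> \<alpha> B (m k)) t)
      \<le> 2 * total_error \<bar>t\<bar> (n k) (m k) (K k) \<delta> (real (m k) powr (1 / \<alpha>))"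
      using elim by (intro char_difference \<delta>)
    also have "\<dots> < 2 * (\<bar>t\<bar> * \<delta> + \<delta>)" using elim by simp
    finally show ?case using eq by simp
  qed
qed

text \<open>Levy's continuity theorem in both directions turns the weak convergence of the
  independent sums, along the indices \<open>m k\<close>, into that of characteristic functions and
  back. \<open>B\<close> and \<open>G\<close> enter through this convergence alone, so
  \<open>\<alpha> = 1\<close> is included.\<close>

lemma normalized_copies_weak_conv:
  fixes n m :: "nat \<Rightarrow> nat"
  assumes nm: "filterlim n at_top sequentially" "filterlim m at_top sequentially"
    "(\<lambda>k. real (m k) / real (n k)) \<longlonglongrightarrow> \<nu>" "\<nu> > 0"
    and G: "real_distribution G" and conv: "weak_conv_m (normalized_sum \<mu> \<alpha> B) G"
  shows "weak_conv_m (\<lambda>k. normalized_copies F D \<alpha> B (n k) (m k)) G"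
proof (rule levy_continuity[OF real_distribution_normalized_copies G])
  fix t
  have "(\<lambda>m. char (normalized_sum \<mu> \<alpha> B m) t) \<longlonglongrightarrow> char G t"
    by (rule levy_continuity1[OF real_distribution_normalized_sum[OF real_distribution_mu] G conv])
  then have "(\<lambda>k. char (normalized_sum \<mu> \<alpha> B (m k)) t) \<longlonglongrightarrow> char G t"
    by (rule filterlim_compose[OF _ nm(2)])
  from tendsto_add[OF char_difference_tendsto[OF nm, of B t] this]
  show "(\<lambda>k. char (normalized_copies F D \<alpha> B (n k) (m k)) t) \<longlonglongrightarrow> char G t" by simp
qed

end

text \<open>For \<open>\<alpha> = 1\<close> the limit is not named: a shift that depends on the law
  of \<open>Nstar\<close>, and not only on its tail constants, can survive the centering. The claim
  there is that the copies inherit whatever stable limit the independent sums have under the same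
  \<open>B\<close>.\<close>

theorem theorem2:
  fixes M :: "'w measure" and X :: "'w \<Rightarrow> nat" and Q :: "'w \<Rightarrow> real"
    and F :: "'v graph" and n m :: "nat \<Rightarrow> nat" and \<nu> a \<alpha> :: real and B :: "nat \<Rightarrow> real"
  defines "D \<equiv> distr M (count_space UNIV \<Otimes>\<^sub>M borel) (\<lambda>\<omega>. (X \<omega>, Q \<omega>))"
    and "\<mu> \<equiv> distr M borel (\<lambda>\<omega>. Nstar F (X \<omega>) (Q \<omega>))"
  assumes "prob_space M"
    and "X \<in> measurable M (count_space UNIV)"
    and "Q \<in> borel_measurable M"
    and "\<forall>\<omega>\<in>space M. 0 \<le> Q \<omega> \<and> Q \<omega> \<le> 1"
    and "\<nu> > 0"
    and "filterlim n at_top sequentially"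
    and "filterlim m at_top sequentially"
    and "(\<lambda>k. real (m k) / real (n k)) \<longlonglongrightarrow> \<nu>"
    and "simple_graph F"
    and "balanced F"
    and "two_connected F"
    and "card (verts F) \<ge> 3"
    and "a > 0"
    and "0 < \<alpha>" and "\<alpha> < 2"
    and "integrable M (\<lambda>\<omega>. real (X \<omega>))"
    and "power_tail \<mu> \<alpha> a"
    and "\<forall>s\<in>{1..card (verts F) - 1}.
           integrable M (\<lambda>\<omega>. real (X \<omega>) powr (1 + real s * (1 - 1 / (\<alpha> * real (card (edges F)))))
                              * Q \<omega> ^ s)"
    and "centering \<mu> \<alpha> B"
  shows "(\<alpha> \<noteq> 1 \<longrightarrow> weak_conv_m (\<lambda>k. normalized_copies F D \<alpha> B (n k) (m k)) (stable_limit \<alpha> a)) \<and>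
         (\<alpha> = 1 \<longrightarrow> (\<forall>G. stable_distribution \<alpha> G \<and> weak_conv_m (normalized_sum \<mu> \<alpha> B) G
                        \<longrightarrow> weak_conv_m (\<lambda>k. normalized_copies F D \<alpha> B (n k) (m k)) G))"
proof -
  note assumptions = assms
  have [measurable]: "X \<in> measurable M (count_space UNIV)" "Q \<in> borel_measurable M" by fact+
  interpret M: prob_space M by fact
  have pair [measurable]: "(\<lambda>\<omega>. (X \<omega>, Q \<omega>)) \<in> measurable M (count_space UNIV \<Otimes>\<^sub>M borel)" by measurable
  have "community_law F D"
    unfolding community_law_def balanced_graph_def two_connected_graph_def community_law_axioms_def balanced_graph_axioms_def
  proof (intro conjI)
    show "prob_space D" unfolding D_def by (rule M.prob_space_distr[OF pair])
    show "sets D = sets (count_space UNIV \<Otimes>\<^sub>M borel)" by (simp add: D_def)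
    show "AE w in D. 0 \<le> snd w \<and> snd w \<le> 1"
      unfolding D_def using assumptions(6) by (subst AE_distr_iff[OF pair]) auto
  qed fact+
  then interpret community_law F D .
  have nsm: "mean_copies \<in> borel_measurable (count_space UNIV \<Otimes>\<^sub>M borel)"
    using mean_copies_measurable unfolding D_def by simp
  have \<mu>: "distr D borel mean_copies = \<mu>"
    unfolding D_def \<mu>_def by (subst distr_distr[OF nsm pair]) (simp add: o_def mean_copies_def)
  have nonneg: "measure \<mu> {..<0} = 0"
  proof -
    have "(\<lambda>\<omega>. Nstar F (X \<omega>) (Q \<omega>)) \<in> borel_measurable M"
      using measurable_compose[OF pair nsm] by (simp add: mean_copies_def)
    moreover have "(\<lambda>\<omega>. Nstar F (X \<omega>) (Q \<omega>)) -` {..<0} \<inter> space M = {}"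
      using assumptions(6) by (force simp: Nstar_def mult_less_0_iff)
    ultimately show ?thesis unfolding \<mu>_def by (subst measure_distr) auto
  qed
  have ht: "heavy_tail \<mu> \<alpha> a"
    using real_distribution_mu nonneg assumptions unfolding \<mu>
    by (auto simp: heavy_tail_def heavy_tail_axioms_def)
  have "critical_law F D \<alpha> a"
    unfolding critical_law_def critical_law_axioms_def
  proof (intro conjI allI impI community_law_axioms)
    show "heavy_tail (distr D borel mean_copies) \<alpha> a" unfolding \<mu> by (rule ht)
    show "integrable D (\<lambda>w. real (fst w))"
      unfolding D_def using assumptions(18) by (subst integrable_distr_eq[OF pair]) auto
    fix s assume s: "s \<in> {1..card V - 1}"
    have "(\<lambda>w :: nat \<times> real. real (fst w) powr (1 + real s * (1 - 1 / (\<alpha> * real (card E)))) * snd w ^ s)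
        \<in> borel_measurable (count_space UNIV \<Otimes>\<^sub>M borel)" by measurable
    then show "integrable D (\<lambda>w. real (fst w) powr (1 + real s * (1 - 1 / (\<alpha> * real (card E)))) * snd w ^ s)"
      unfolding D_def using assumptions(20) s by (subst integrable_distr_eq[OF pair]) auto
  qed fact
  then interpret critical_law F D \<alpha> a .
  note conv = normalized_copies_weak_conv[OF assumptions(8,9,10,7), unfolded \<mu>]
  show ?thesis
  proof (intro conjI impI allI)
    assume "\<alpha> \<noteq> 1"
    note lim = stable_limit_correct[OF ht this \<open>\<alpha> < 2\<close> \<open>centering \<mu> \<alpha> B\<close>]
    show "weak_conv_m (\<lambda>k. normalized_copies F D \<alpha> B (n k) (m k)) (stable_limit \<alpha> a)"
      by (rule conv[OF lim])
  next
    fix G assume "stable_distribution \<alpha> G \<and> weak_conv_m (normalized_sum \<mu> \<alpha> B) G"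
    then show "weak_conv_m (\<lambda>k. normalized_copies F D \<alpha> B (n k) (m k)) G"
      by (intro conv) (auto simp: stable_distribution_def)
  qed
qed

end
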